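(* Let $n\ge1$ be an integer, and let $\theta\in(\frac{2-n}{2},1]$ if $n=1,2$ and $\theta\in[0,1]$ if $n\geq 3$. Assume $\sigma<3-n-2\theta$, $2\leq p\leq\infty$ and $\frac1p+\frac1{p'}=1$. There exists a constant $C=C_{\sigma,n}>0$ (indexed by $\sigma$ and $n$ only) such that $$\Vert\Lambda_\theta(t)g\Vert_{H^\sigma_p(\mathbb{R}^n)}\leq C\,t^{1-\theta-\frac n2(1-\frac2p)}\Vert g\Vert_{L^{p'}(\mathbb{R}^n)}$$ for all $g\in\mathscr{S}(\mathbb{R}^n)$ and $t>0$.
   Context: For $t\geq 0$, $S(t)$ is the Fourier multiplier operator on $\mathbb{R}^n$ with symbol $$m(\xi,t)=e^{-\frac{|\xi|^2t}{2(1+|\xi|^2)}}\,\frac{2(1+|\xi|^2)}{|\xi|^2\sqrt{3+4|\xi|^2}}\,\sin\left(\frac{|\xi|^2\sqrt{3+4|\xi|^2}\,t}{2(1+|\xi|^2)}\right)$$ (equal to $t$ at $\xi=0$), and $\Lambda_\theta(t)=S(t)(I-\Delta)^{-1}(-\Delta)^\theta$, i.e. the Fourier multiplier operator with symbol $m(\xi,t)(1+|\xi|^2)^{-1}|\xi|^{2\theta}$. $\mathscr{S}(\mathbb{R}^n)$ is the Schwartz space. $H^\sigma_p(\mathbb{R}^n)=(I-\Delta)^{-\sigma/2}L^p(\mathbb{R}^n)$ is the Bessel potential space with norm $\Vert f\Vert_{H^\sigma_p}=\Vert(I-\Delta)^{\sigma/2}f\Vert_{L^p}$. *)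

theory Defs
  imports "HOL-Analysis.Analysis" "HOL-Probability.Essential_Supremum"
begin

section \<open>Schwartz functions\<close>

definition partial_deriv :: "'n::finite \<Rightarrow> (real^'n \<Rightarrow> complex) \<Rightarrow> real^'n \<Rightarrow> complex" where
  "partial_deriv i f x = frechet_derivative f (at x) (axis i 1)"

text \<open>A list of coordinate indices plays the role of a multi-index. Requiring every iterated
  partial derivative to be (totally) differentiable everywhere says that the function is smooth;
  it also ensures that \<^const>\<open>partial_deriv\<close> is never applied to a non-differentiable function.\<close>

definition iter_partial :: "'n::finite list \<Rightarrow> (real^'n \<Rightarrow> complex) \<Rightarrow> real^'n \<Rightarrow> complex" where
  "iter_partial is f = foldr partial_deriv is f"

definition schwartz :: "(real^'n::finite \<Rightarrow> complex) set" where
  "schwartz = {f. \<forall>is. (\<forall>x. iter_partial is f differentiable (at x)) \<and>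
     (\<forall>k::nat. bounded (range (\<lambda>x. norm x ^ k * norm (iter_partial is f x))))}"


section \<open>Fourier multipliers\<close>

text \<open>The normalisation is the one for which \<open>-\<Delta>\<close> has symbol \<open>|\<xi>|\<^sup>2\<close>.\<close>

definition fourier :: "(real^'n::finite \<Rightarrow> complex) \<Rightarrow> real^'n \<Rightarrow> complex" where
  "fourier f \<xi> = (LINT x|lborel. exp (- \<i> * complex_of_real (x \<bullet> \<xi>)) * f x)"

definition inv_fourier :: "(real^'n::finite \<Rightarrow> complex) \<Rightarrow> real^'n \<Rightarrow> complex" where
  "inv_fourier h x = complex_of_real (1 / (2 * pi) ^ CARD('n)) *
     (LINT \<xi>|lborel. exp (\<i> * complex_of_real (x \<bullet> \<xi>)) * h \<xi>)"

text \<open>The operator is only ever applied to Schwartz functions, with measurable symbols of at most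
  polynomial growth, so the integrals converge absolutely.\<close>

definition fourier_multiplier ::
    "(real^'n::finite \<Rightarrow> real) \<Rightarrow> (real^'n \<Rightarrow> complex) \<Rightarrow> real^'n \<Rightarrow> complex" where
  "fourier_multiplier a g = inv_fourier (\<lambda>\<xi>. complex_of_real (a \<xi>) * fourier g \<xi>)"

definition S_symbol :: "real \<Rightarrow> real^'n::finite \<Rightarrow> real" where
  "S_symbol t \<xi> =
     (if \<xi> = 0 then t
      else exp (- ((norm \<xi>)\<^sup>2 * t / (2 * (1 + (norm \<xi>)\<^sup>2)))) *
           (2 * (1 + (norm \<xi>)\<^sup>2) / ((norm \<xi>)\<^sup>2 * sqrt (3 + 4 * (norm \<xi>)\<^sup>2))) *
           sin ((norm \<xi>)\<^sup>2 * sqrt (3 + 4 * (norm \<xi>)\<^sup>2) * t / (2 * (1 + (norm \<xi>)\<^sup>2))))"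

text \<open>For \<open>\<theta> = 0\<close> the convention \<open>0 powr 0 = 0\<close> changes the symbol at \<open>\<xi> = 0\<close> only, which does not
  affect the operator.\<close>

definition Lambda_symbol :: "real \<Rightarrow> real \<Rightarrow> real^'n::finite \<Rightarrow> real" where
  "Lambda_symbol \<theta> t \<xi> = S_symbol t \<xi> * inverse (1 + (norm \<xi>)\<^sup>2) * norm \<xi> powr (2 * \<theta>)"

definition Lambda :: "real \<Rightarrow> real \<Rightarrow> (real^'n::finite \<Rightarrow> complex) \<Rightarrow> real^'n \<Rightarrow> complex" where
  "Lambda \<theta> t = fourier_multiplier (Lambda_symbol \<theta> t)"

text \<open>\<open>bessel_op s\<close> is \<open>(I - \<Delta>)\<^bsup>s/2\<^esup>\<close> on Schwartz functions.\<close>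

definition bessel_op :: "real \<Rightarrow> (real^'n::finite \<Rightarrow> complex) \<Rightarrow> real^'n \<Rightarrow> complex" where
  "bessel_op s = fourier_multiplier (\<lambda>\<xi>. (1 + (norm \<xi>)\<^sup>2) powr (s / 2))"


section \<open>Lebesgue and Bessel potential norms\<close>

text \<open>Intended for measurable functions and exponents \<open>1 \<le> p \<le> \<infinity>\<close>; the value is infinite
  outside \<open>L\<^sup>p\<close>.\<close>

definition Lp_norm :: "ennreal \<Rightarrow> (real^'n::finite \<Rightarrow> complex) \<Rightarrow> ennreal" where
  "Lp_norm p f =
     (if p = \<infinity> then esssup lborel (\<lambda>x. ennreal (norm (f x)))
      else let I = (\<integral>\<^sup>+ x. ennreal (norm (f x) powr enn2real p) \<partial>lborel)
           in if I = \<infinity> then \<infinity> else ennreal (enn2real I powr (1 / enn2real p)))"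

definition Lp_space :: "ennreal \<Rightarrow> (real^'n::finite \<Rightarrow> complex) set" where
  "Lp_space p = {f \<in> borel_measurable lborel. Lp_norm p f < \<infinity>}"

text \<open>Tempered distributions are represented by their action on Schwartz functions (the pairing is
  bilinear, without conjugation).\<close>

definition distr_of_fun :: "(real^'n::finite \<Rightarrow> complex) \<Rightarrow> (real^'n \<Rightarrow> complex) \<Rightarrow> complex" where
  "distr_of_fun f \<phi> = (LINT x|lborel. f x * \<phi> x)"

text \<open>The symbol of \<open>(I - \<Delta>)\<^bsup>s/2\<^esup>\<close> is even, so the operator is its own transpose for the bilinear
  pairing.\<close>

definition bessel_op_distr ::
    "real \<Rightarrow> ((real^'n::finite \<Rightarrow> complex) \<Rightarrow> complex) \<Rightarrow> (real^'n \<Rightarrow> complex) \<Rightarrow> complex" where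
  "bessel_op_distr s u \<phi> = u (bessel_op s \<phi>)"

text \<open>The norm of \<open>(I - \<Delta>)\<^bsup>s/2\<^esup> u\<close> in \<open>L\<^sup>p\<close>. The function \<open>h\<close> below is unique up to null sets if it
  exists, so the infimum only selects the common value of the norms; it is \<open>\<infinity>\<close> exactly if
  \<open>u\<close> does not belong to \<open>H\<^sup>s\<^sub>p\<close>.\<close>

definition bessel_norm :: "real \<Rightarrow> ennreal \<Rightarrow> ((real^'n::finite \<Rightarrow> complex) \<Rightarrow> complex) \<Rightarrow> ennreal" where
  "bessel_norm s p u =
     Inf {Lp_norm p h |h. h \<in> Lp_space p \<and>
            (\<forall>\<phi>\<in>schwartz. bessel_op_distr s u \<phi> = distr_of_fun h \<phi>)}"

end

(* The operator (I - Delta)^(sigma/2) Lambda_theta(t) is a Fourier multiplier with an integrable symbol M.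
   Its L^2 norm is at most sup |M| <= 2 t^(1-theta), because |sin u| <= u^(1-theta). Its norm from L^1 to
   L^infinity is controlled by the supremum of the kernel, which is O(t^(1-theta-n/2)): frequencies below 1
   are dominated by a Gaussian, and above 1 the symbol is exp(-t/2) sin(t|xi|) |xi|^(-n-eps) with
   eps = 3-n-2theta-sigma, plus an error that is integrable uniformly in theta. As eps may tend to 0 for fixed
   sigma, the main term is not bounded through its L^1 norm, but by integrating by parts along rays; this is
   what makes the constant depend on sigma and n only. Real interpolation between the two endpoints, arranged
   so that its constant stays bounded for all 2 < p < infinity, gives the remaining exponents. *)

theory Submission
  imports Defs "HOL-Probability.Probability"
begin


section \<open>Gaussian regularisation and the Plancherel identities\<close>

text \<open>The estimate is reduced to two numbers attached to an integrable symbol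
  \<open>m\<close>: a bound \<open>a\<close> for |m| and a bound \<open>a * v\<close> for its
  Fourier transform. Here a is a multiple of t^(1-theta) and v = t^(-n/2), so that the bound a
  v^(1-2/p) carries its whole dependence on p in the exponent of v. The hypotheses on theta enter
  through 1 <= theta + n/2. Then 1 - theta - n/2 is not positive, and the exponentially damped high
  frequencies are dominated by a multiple of t^(1-theta-n/2) for small t as well as for large t. The
  pieces of g that occur in the interpolation are truncations, which are merely integrable, and the
  factor |xi|^(2 theta) need not be smooth at the origin, so that Lambda_theta(t) g cannot be
  treated as a Schwartz function. Plancherel is therefore derived for integrable functions, by
  inserting a Gaussian weight. The L^2 bound needs only the inequality; the exact identity serves to
  recognise (I - Delta)^(sigma/2) Lambda_theta(t) g, defined by duality, as the multiplier applied
  to g.\<close>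

lemma
  fixes f :: "'a::euclidean_space \<Rightarrow> real \<Rightarrow> complex"
  assumes f: "\<And>b. b \<in> Basis \<Longrightarrow> integrable lborel (f b)"
  shows integrable_lborel_prod: "integrable lborel (\<lambda>x. \<Prod>b\<in>Basis. f b (x \<bullet> b))"
    and integral_lborel_prod: "(LINT x|lborel. (\<Prod>b\<in>Basis. f b (x \<bullet> b))) = (\<Prod>b\<in>Basis. LINT x|lborel. f b x)"
proof -
  interpret product_sigma_finite "\<lambda>_::'a. lborel :: real measure" ..
  have [measurable]: "f b \<in> borel_measurable borel" if "b \<in> Basis" for b
    using borel_measurable_integrable[OF f[OF that]] by simp
  have m [measurable]: "(\<lambda>x::'a. \<Prod>b\<in>Basis. f b (x \<bullet> b)) \<in> borel_measurable borel"
    by measurable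
  have *: "(\<Prod>b\<in>Basis. f b ((\<Sum>b\<in>Basis. x b *\<^sub>R b) \<bullet> b)) = (\<Prod>b\<in>Basis. f b (x b))" for x :: "'a \<Rightarrow> real"
    by (rule prod.cong) simp_all
  have m2: "(\<lambda>x. \<Sum>b\<in>Basis. x b *\<^sub>R b) \<in> measurable (Pi\<^sub>M Basis (\<lambda>_. lborel)) (borel :: 'a measure)"
    by measurable
  show "integrable lborel (\<lambda>x::'a. \<Prod>b\<in>Basis. f b (x \<bullet> b))"
    unfolding lborel_eq[where 'a='a]
    by (subst integrable_distr_eq[OF m2 m], unfold *)
       (rule product_integrable_prod[OF finite_Basis f])
  show "(LINT x|lborel. (\<Prod>b\<in>Basis. f b (x \<bullet> b))) = (\<Prod>b\<in>Basis. LINT x|lborel. f b x)"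
    unfolding lborel_eq[where 'a='a]
    by (subst integral_distr[OF m2 m], unfold *)
       (rule product_integral_prod[OF finite_Basis f])
qed

section \<open>Affine substitutions in Lebesgue integrals\<close>

lemma nn_integral_lborel_affine:
  fixes t :: "'a::euclidean_space"
  assumes [measurable]: "f \<in> borel_measurable borel" and "c \<noteq> 0"
  shows "(\<integral>\<^sup>+x. f x \<partial>lborel) = ennreal (\<bar>c\<bar> ^ DIM('a)) * (\<integral>\<^sup>+x. f (t + c *\<^sub>R x) \<partial>lborel)"
  by (subst lborel_affine[OF \<open>c \<noteq> 0\<close>, of t])
     (simp add: nn_integral_density nn_integral_distr nn_integral_cmult)

lemma lborel_integrable_affine:
  fixes f :: "'a::euclidean_space \<Rightarrow> 'b::{banach, second_countable_topology}"
  assumes f: "integrable lborel f" and "c \<noteq> 0"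
  shows "integrable lborel (\<lambda>x. f (t + c *\<^sub>R x))"
proof -
  have [measurable]: "f \<in> borel_measurable borel"
    using borel_measurable_integrable[OF f] by simp
  have "(\<integral>\<^sup>+x. ennreal (norm (f x)) \<partial>lborel) < \<infinity>"
    using f by (simp add: integrable_iff_bounded)
  then show ?thesis
    using \<open>c \<noteq> 0\<close> unfolding integrable_iff_bounded
    by (subst (asm) nn_integral_lborel_affine[where c=c and t=t])
       (auto simp: ennreal_mult_less_top)
qed

lemma lborel_integral_affine:
  fixes f :: "'a::euclidean_space \<Rightarrow> 'b::{banach, second_countable_topology}"
  assumes "c \<noteq> 0"
  shows "(LINT x|lborel. f x) = \<bar>c\<bar> ^ DIM('a) *\<^sub>R (LINT x|lborel. f (t + c *\<^sub>R x))"
proof (cases "integrable lborel f")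
  case True
  then have [measurable]: "f \<in> borel_measurable borel"
    using borel_measurable_integrable by force
  show ?thesis
    by (subst lborel_affine[OF \<open>c \<noteq> 0\<close>, of t])
       (simp add: integral_density integral_distr)
next
  case False
  have "\<not> integrable lborel (\<lambda>x. f (t + c *\<^sub>R x))"
  proof
    assume "integrable lborel (\<lambda>x. f (t + c *\<^sub>R x))"
    from lborel_integrable_affine[OF this, of "1 / c" "- t /\<^sub>R c"] assms
    have "integrable lborel f" by (simp add: scaleR_right_diff_distrib scaleR_add_right)
    with False show False ..
  qed
  with False show ?thesis by (simp add: not_integrable_integral_eq)
qed

text \<open>The sign of the exponent is a parameter: s = -1 gives the Fourier transform, s = 1 the
  inverse transform up to the factor (2 pi)^n. Duality and Plancherel are thus proved once for
  both.\<close>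

definition ft :: "real \<Rightarrow> ('a::euclidean_space \<Rightarrow> complex) \<Rightarrow> 'a \<Rightarrow> complex" where
  "ft s f x = (LINT y|lborel. iexp (s * (x \<bullet> y)) * f y)"

lemma integrable_iexp_mult:
  fixes f :: "'a::euclidean_space \<Rightarrow> complex"
  assumes "integrable lborel f" and [measurable]: "g \<in> borel_measurable borel"
  shows "integrable lborel (\<lambda>y. iexp (g y) * f y)"
proof -
  have [measurable]: "f \<in> borel_measurable borel"
    using borel_measurable_integrable[OF assms(1)] by simp
  show ?thesis
    by (rule Bochner_Integration.integrable_bound[OF assms(1)]) (auto simp: norm_mult)
qed

text \<open>Up to the factor sqrt(2 pi) this is the characteristic function of the standard normal
  distribution.\<close>

lemma gaussian_integral_1:
  "integrable lborel (\<lambda>x. complex_of_real (exp (- x\<^sup>2 / 2)) * iexp (t * x))"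
  "(LINT x|lborel. complex_of_real (exp (- x\<^sup>2 / 2)) * iexp (t * x)) =
    complex_of_real (sqrt (2 * pi) * exp (- t\<^sup>2 / 2))"
proof -
  have i: "integrable lborel std_normal_density" by simp
  have e: "exp (- x\<^sup>2 / 2) = sqrt (2 * pi) * std_normal_density x" for x
    by (simp add: std_normal_density_def)
  have "integrable lborel (\<lambda>x. complex_of_real (exp (- x\<^sup>2 / 2)))"
    unfolding e using i by (intro integrable_of_real integrable_mult_right) auto
  then show "integrable lborel (\<lambda>x. complex_of_real (exp (- x\<^sup>2 / 2)) * iexp (t * x))"
    by (subst mult.commute) (rule integrable_iexp_mult, auto)
  have "complex_of_real (exp (- (t\<^sup>2) / 2)) = char std_normal_distribution t"
    by (simp add: char_std_normal_distribution)
  also have "\<dots> = (LINT x|lborel. std_normal_density x *\<^sub>R iexp (t * x))"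
    unfolding char_def by (subst integral_density) auto
  finally have *: "(LINT x|lborel. std_normal_density x *\<^sub>R iexp (t * x)) = complex_of_real (exp (- t\<^sup>2 / 2))" ..
  have "(LINT x|lborel. complex_of_real (exp (- x\<^sup>2 / 2)) * iexp (t * x)) =
      (LINT x|lborel. sqrt (2 * pi) *\<^sub>R (std_normal_density x *\<^sub>R iexp (t * x)))"
    unfolding e by (simp add: scaleR_conv_of_real mult_ac)
  then show "(LINT x|lborel. complex_of_real (exp (- x\<^sup>2 / 2)) * iexp (t * x)) =
      complex_of_real (sqrt (2 * pi) * exp (- t\<^sup>2 / 2))"
    using * by (simp add: scaleR_conv_of_real)
qed

lemma gaussian_integral:
  fixes x :: "'a::euclidean_space"
  shows "integrable lborel (\<lambda>\<xi>. complex_of_real (exp (- (norm \<xi>)\<^sup>2 / 2)) * iexp (x \<bullet> \<xi>))" (is "integrable _ ?f")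
    and "(LINT \<xi>|lborel. complex_of_real (exp (- (norm \<xi>)\<^sup>2 / 2)) * iexp (x \<bullet> \<xi>)) =
      complex_of_real (sqrt (2 * pi) ^ DIM('a) * exp (- (norm x)\<^sup>2 / 2))"
proof -
  have n: "exp (- (norm y)\<^sup>2 / 2) = (\<Prod>b\<in>Basis. exp (- (y \<bullet> b)\<^sup>2 / 2))" for y :: 'a
    unfolding power2_norm_eq_inner exp_sum[OF finite_Basis, symmetric]
    by (subst euclidean_inner) (simp add: sum_divide_distrib sum_negf power2_eq_square)
  have e: "?f \<xi> = (\<Prod>b\<in>Basis. complex_of_real (exp (- (\<xi> \<bullet> b)\<^sup>2 / 2)) * iexp ((x \<bullet> b) * (\<xi> \<bullet> b)))" for \<xi>
    unfolding n prod.distrib exp_sum[OF finite_Basis, symmetric]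
    by (subst (2) euclidean_inner) (simp add: sum_distrib_left exp_sum)
  show "integrable lborel ?f" unfolding e
    by (rule integrable_lborel_prod) (rule gaussian_integral_1)
  have "integral\<^sup>L lborel ?f = (\<Prod>b\<in>Basis. complex_of_real (sqrt (2 * pi) * exp (- (x \<bullet> b)\<^sup>2 / 2)))"
    unfolding e by (subst integral_lborel_prod) (simp_all only: gaussian_integral_1)
  then show "integral\<^sup>L lborel ?f = complex_of_real (sqrt (2 * pi) ^ DIM('a) * exp (- (norm x)\<^sup>2 / 2))"
    unfolding n by (simp add: prod.distrib)
qed

definition gauss :: "real \<Rightarrow> 'a::euclidean_space \<Rightarrow> real" where
  "gauss c x = exp (- (norm (c *\<^sub>R x))\<^sup>2 / 2)"

text \<open>The unnormalised Fourier transform of \<open>gauss c\<close>. As c tends to 0,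
  \<open>gauss c\<close> tends to 1 pointwise while \<open>gauss_hat c\<close> concentrates at the
  origin.\<close>

definition gauss_hat :: "real \<Rightarrow> 'a::euclidean_space \<Rightarrow> real" where
  "gauss_hat c x = (sqrt (2 * pi) / c) ^ DIM('a) * gauss (1 / c) x"

lemma gauss_borel [measurable]: "gauss c \<in> borel_measurable borel"
  "gauss_hat c \<in> borel_measurable borel"
  unfolding gauss_def[abs_def] gauss_hat_def[abs_def] by measurable

lemma gauss_bounds: "0 \<le> gauss c x" "gauss c x \<le> 1"
  by (auto simp: gauss_def)

lemma gauss_hat_nonneg: "c > 0 \<Longrightarrow> 0 \<le> gauss_hat c x"
  by (auto simp: gauss_hat_def gauss_bounds)

lemma ft_gauss:
  fixes x :: "'a::euclidean_space"
  assumes "c > 0"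
  shows "integrable lborel (\<lambda>\<xi>. complex_of_real (gauss c \<xi>) * iexp (x \<bullet> \<xi>))"
    and "(LINT \<xi>|lborel. complex_of_real (gauss c \<xi>) * iexp (x \<bullet> \<xi>)) = complex_of_real (gauss_hat c x)"
proof -
  define f where "f \<xi> = complex_of_real (exp (- (norm \<xi>)\<^sup>2 / 2)) * iexp ((x /\<^sub>R c) \<bullet> \<xi>)" for \<xi> :: 'a
  have e: "complex_of_real (gauss c \<xi>) * iexp (x \<bullet> \<xi>) = f (0 + c *\<^sub>R \<xi>)" for \<xi>
  proof -
    have "(x /\<^sub>R c) \<bullet> (0 + c *\<^sub>R \<xi>) = x \<bullet> \<xi>" using assms by simp
    then show ?thesis unfolding f_def gauss_def by (simp only: add_0_left)
  qed
  have f: "integrable lborel f" unfolding f_def by (rule gaussian_integral(1))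
  show "integrable lborel (\<lambda>\<xi>. complex_of_real (gauss c \<xi>) * iexp (x \<bullet> \<xi>))"
    unfolding e using assms by (intro lborel_integrable_affine f) auto
  have "c ^ DIM('a) *\<^sub>R (LINT \<xi>|lborel. f (0 + c *\<^sub>R \<xi>)) = (LINT \<xi>|lborel. f \<xi>)"
    using assms by (subst lborel_integral_affine[of c f 0]) auto
  also have "\<dots> = complex_of_real (sqrt (2 * pi) ^ DIM('a) * exp (- (norm (x /\<^sub>R c))\<^sup>2 / 2))"
    unfolding f_def by (rule gaussian_integral(2))
  finally have "(LINT \<xi>|lborel. f (0 + c *\<^sub>R \<xi>)) =
      (sqrt (2 * pi) ^ DIM('a) * exp (- (norm (x /\<^sub>R c))\<^sup>2 / 2)) / c ^ DIM('a)"
    using assms by (simp add: scaleR_conv_of_real field_simps)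
  then show "(LINT \<xi>|lborel. complex_of_real (gauss c \<xi>) * iexp (x \<bullet> \<xi>)) = complex_of_real (gauss_hat c x)"
    unfolding e gauss_hat_def gauss_def[of "1 / c"]
    by (simp only: power_divide inverse_eq_divide times_divide_eq_left)
qed

lemma integrable_gauss: "c > 0 \<Longrightarrow> integrable lborel (gauss c :: 'a::euclidean_space \<Rightarrow> real)"
  using ft_gauss(1)[of c 0] by (simp add: complex_of_real_integrable_eq)

lemma integral_gauss:
  "(LINT x|lborel. gauss 1 (x::'a::euclidean_space)) = sqrt (2 * pi) ^ DIM('a)"
proof -
  have "complex_of_real (LINT x|lborel. gauss 1 (x::'a)) = complex_of_real (sqrt (2 * pi) ^ DIM('a))"
    using ft_gauss(2)[of 1 "0::'a"] by (simp add: gauss_hat_def gauss_def)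
  then show ?thesis by (simp only: of_real_eq_iff)
qed

text \<open>The mass does not depend on c, so that gauss_hat c / (2 pi)^n is an approximate
  identity. Allowing s = 1 and s = -1 covers kernels in x + y and in x - y.\<close>

lemma nn_integral_gauss_hat:
  fixes y :: "'a::euclidean_space"
  assumes "c > 0" "\<bar>s\<bar> = 1"
  shows "(\<integral>\<^sup>+x. ennreal (gauss_hat c (y + s *\<^sub>R x)) \<partial>lborel) = ennreal ((2 * pi) ^ DIM('a))"
proof -
  have "(\<integral>\<^sup>+x. ennreal (gauss_hat c (y + s *\<^sub>R x)) \<partial>lborel) = (\<integral>\<^sup>+x. ennreal (gauss_hat c (x::'a)) \<partial>lborel)"
    using assms by (subst nn_integral_lborel_affine[where c=s and t=y]) auto
  also have "\<dots> = ennreal (c ^ DIM('a)) * (\<integral>\<^sup>+x. ennreal (gauss_hat c (0 + c *\<^sub>R (x::'a))) \<partial>lborel)"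
    using assms by (subst nn_integral_lborel_affine[where c=c and t=0]) auto
  also have "(\<integral>\<^sup>+x. ennreal (gauss_hat c (0 + c *\<^sub>R (x::'a))) \<partial>lborel) =
      (\<integral>\<^sup>+x. ennreal ((sqrt (2 * pi) / c) ^ DIM('a)) * ennreal (gauss 1 (x::'a)) \<partial>lborel)"
    using assms by (intro nn_integral_cong) (simp add: gauss_hat_def gauss_def ennreal_mult'')
  also have "\<dots> = ennreal ((sqrt (2 * pi) / c) ^ DIM('a)) * ennreal (sqrt (2 * pi) ^ DIM('a))"
    by (subst nn_integral_cmult)
       (auto simp: gauss_bounds nn_integral_eq_integral integrable_gauss integral_gauss)
  also have "\<dots> = ennreal ((sqrt (2 * pi) / c) ^ DIM('a) * sqrt (2 * pi) ^ DIM('a))"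
    using assms by (intro ennreal_mult[symmetric]) auto
  also have "ennreal (c ^ DIM('a)) * \<dots> = ennreal (c ^ DIM('a) * ((sqrt (2 * pi) / c) ^ DIM('a) * sqrt (2 * pi) ^ DIM('a)))"
    using assms by (intro ennreal_mult[symmetric]) auto
  also have "c ^ DIM('a) * ((sqrt (2 * pi) / c) ^ DIM('a) * sqrt (2 * pi) ^ DIM('a)) =
      (2 * pi) ^ DIM('a)"
  proof -
    have "c * (sqrt (2 * pi) / c * sqrt (2 * pi)) = 2 * pi"
      using assms by simp
    then show ?thesis by (metis power_mult_distrib)
  qed
  finally show ?thesis .
qed

lemma norm_integral_le_nn_integral:
  fixes f :: "'a \<Rightarrow> 'b::{banach, second_countable_topology}"
  shows "ennreal (norm (integral\<^sup>L M f)) \<le> (\<integral>\<^sup>+x. ennreal (norm (f x)) \<partial>M)"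
  by (cases "integrable M f") (auto simp: integral_norm_bound_ennreal not_integrable_integral_eq)

text \<open>Justifies the exchange of integrals in \<open>ft_mult\<close>, where h is an exponential
  of modulus one.\<close>

lemma integrable_mult_pair:
  fixes f :: "'a::euclidean_space \<Rightarrow> complex" and g :: "'b::euclidean_space \<Rightarrow> complex"
  assumes "integrable lborel f" "integrable lborel g"
    and [measurable]: "(\<lambda>(x, y). h x y) \<in> borel_measurable (borel \<Otimes>\<^sub>M borel)"
    and h: "\<And>x y. norm (h x y) \<le> B"
  shows "integrable (lborel \<Otimes>\<^sub>M lborel) (\<lambda>(x, y). h x y * (f x * g y) :: complex)"
proof -
  have [measurable]: "f \<in> borel_measurable borel" "g \<in> borel_measurable borel"
    using borel_measurable_integrable[OF assms(1)] borel_measurable_integrable[OF assms(2)] by simp_all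
  have m: "(\<lambda>(x, y). h x y * (f x * g y)) \<in> borel_measurable (lborel \<Otimes>\<^sub>M lborel)"
    by measurable
  have 0: "integrable (lborel \<Otimes>\<^sub>M lborel) (\<lambda>(x, y). f x * g y)"
  proof (rule lborel_pair.Fubini_integrable)
    show "(\<lambda>(x, y). f x * g y) \<in> borel_measurable (lborel \<Otimes>\<^sub>M lborel)" by measurable
    show "integrable lborel (\<lambda>x. LINT y|lborel. norm (case (x, y) of (x, y) \<Rightarrow> f x * g y))"
      using assms(1) by (simp add: norm_mult)
    show "AE x in lborel. integrable lborel (\<lambda>y. case (x, y) of (x, y) \<Rightarrow> f x * g y)"
      using assms(2) by simp
  qed
  have B: "B \<ge> 0" using h[of undefined undefined] norm_ge_zero order_trans by blast
  have "integrable (lborel \<Otimes>\<^sub>M lborel) (\<lambda>z. of_real B * (case z of (x, y) \<Rightarrow> f x * g y))"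
    by (intro integrable_mult_right 0)
  then show ?thesis
    by (rule Bochner_Integration.integrable_bound[OF _ m])
       (auto simp: norm_mult B intro!: AE_I2 mult_right_mono h)
qed

section \<open>Boundedness, continuity and duality of the transform\<close>

lemma ft_borel [measurable]:
  assumes [measurable]: "f \<in> borel_measurable borel"
  shows "ft s f \<in> borel_measurable borel"
  unfolding ft_def[abs_def] by measurable

lemma norm_ft_le: "norm (ft s f x) \<le> (LINT y|lborel. norm (f y))"
proof -
  have "norm (ft s f x) \<le> (LINT y|lborel. norm (iexp (s * (x \<bullet> y)) * f y))"
    unfolding ft_def by (rule integral_norm_bound)
  then show ?thesis by (simp add: norm_mult)
qed

lemma continuous_ft:
  fixes f :: "'a::euclidean_space \<Rightarrow> complex"
  assumes f: "integrable lborel f"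
  shows "continuous_on UNIV (ft s f)"
proof -
  have [measurable]: "f \<in> borel_measurable borel"
    using borel_measurable_integrable[OF f] by simp
  have "(\<lambda>n. ft s f (u n)) \<longlonglongrightarrow> ft s f x" if "u \<longlonglongrightarrow> x" for u and x :: 'a
    unfolding ft_def
  proof (rule integral_dominated_convergence[where w="\<lambda>y. norm (f y)"])
    show "AE y in lborel. (\<lambda>n. iexp (s * (u n \<bullet> y)) * f y) \<longlonglongrightarrow> iexp (s * (x \<bullet> y)) * f y"
      by (intro AE_I2 tendsto_intros that)
  qed (use f in \<open>auto simp: norm_mult\<close>)
  then show ?thesis
    by (auto simp: continuous_on_sequentially comp_def)
qed

lemma ft_mult:
  fixes f g :: "'a::euclidean_space \<Rightarrow> complex"
  assumes "integrable lborel f" "integrable lborel g"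
  shows "(LINT \<xi>|lborel. ft s f \<xi> * g \<xi>) = (LINT x|lborel. f x * ft s g x)"
proof -
  have i: "integrable (lborel \<Otimes>\<^sub>M lborel) (\<lambda>(x, y). iexp (s * (x \<bullet> y)) * (f x * g y))"
    using assms by (rule integrable_mult_pair[where B=1]) auto
  have "(LINT \<xi>|lborel. ft s f \<xi> * g \<xi>) = (LINT y|lborel. LINT x|lborel. iexp (s * (x \<bullet> y)) * (f x * g y))"
    unfolding ft_def by (simp add: mult.assoc[symmetric] inner_commute)
  also have "\<dots> = (LINT x|lborel. LINT y|lborel. iexp (s * (x \<bullet> y)) * (f x * g y))"
    by (rule lborel_pair.Fubini_integral[OF i])
  also have "\<dots> = (LINT x|lborel. f x * ft s g x)"
    unfolding ft_def by (simp add: mult.left_commute[of _ "f _"])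
  finally show ?thesis .
qed

lemma integrable_ft_mult:
  fixes f :: "'a::euclidean_space \<Rightarrow> complex"
  assumes f: "integrable lborel f" and g: "integrable lborel g"
  shows "integrable lborel (\<lambda>\<xi>. ft s f \<xi> * g \<xi>)"
proof -
  have [measurable]: "f \<in> borel_measurable borel" "g \<in> borel_measurable borel"
    using borel_measurable_integrable[OF f] borel_measurable_integrable[OF g] by simp_all
  have "integrable lborel (\<lambda>\<xi>. complex_of_real (LINT y|lborel. norm (f y)) * g \<xi>)"
    by (intro integrable_mult_right g)
  then show ?thesis
    by (rule Bochner_Integration.integrable_bound)
       (auto simp: norm_mult intro!: mult_right_mono norm_ft_le order_trans[OF norm_ft_le abs_ge_self])
qed

text \<open>A regularised Parseval formula: the Gaussian makes all integrals absolutely convergent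
  for merely integrable f and g. The signs are independent because two cases are needed: s' = -s
  with the conjugate of f for the norm inequality, and s = s' = 1 for the bilinear pairing.\<close>

lemma ft_ft_gauss:
  fixes f g :: "'a::euclidean_space \<Rightarrow> complex"
  assumes f: "integrable lborel f" and g: "integrable lborel g" and c: "c > 0"
  shows "(LINT \<xi>|lborel. ft s f \<xi> * (ft s' g \<xi> * complex_of_real (gauss c \<xi>))) =
    (LINT x|lborel. f x * (LINT y|lborel. g y * complex_of_real (gauss_hat c (s *\<^sub>R x + s' *\<^sub>R y))))"
proof -
  have w: "integrable lborel (\<lambda>\<xi>::'a. complex_of_real (gauss c \<xi>))"
    by (intro integrable_of_real integrable_gauss c)
  have *: "ft s (\<lambda>\<xi>. ft s' g \<xi> * complex_of_real (gauss c \<xi>)) x =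
      (LINT y|lborel. g y * complex_of_real (gauss_hat c (s *\<^sub>R x + s' *\<^sub>R y)))" for x
  proof -
    have i: "integrable lborel (\<lambda>\<xi>. iexp (s * (x \<bullet> \<xi>)) * complex_of_real (gauss c \<xi>))"
      by (rule integrable_iexp_mult[OF w]) measurable
    have h: "ft s' (\<lambda>\<xi>. iexp (s * (x \<bullet> \<xi>)) * complex_of_real (gauss c \<xi>)) y =
        complex_of_real (gauss_hat c (s *\<^sub>R x + s' *\<^sub>R y))" for y
      unfolding ft_gauss(2)[OF c, symmetric] ft_def
      by (rule Bochner_Integration.integral_cong)
         (auto simp: inner_add_left distrib_left exp_add mult_ac)
    have "ft s (\<lambda>\<xi>. ft s' g \<xi> * complex_of_real (gauss c \<xi>)) x =
      (LINT \<xi>|lborel. ft s' g \<xi> * (iexp (s * (x \<bullet> \<xi>)) * complex_of_real (gauss c \<xi>)))"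
      unfolding ft_def[of s] by (simp add: mult_ac)
    also have "\<dots> = (LINT y|lborel. g y * ft s' (\<lambda>\<xi>. iexp (s * (x \<bullet> \<xi>)) * complex_of_real (gauss c \<xi>)) y)"
      by (rule ft_mult[OF g i])
    also have "\<dots> = (LINT y|lborel. g y * complex_of_real (gauss_hat c (s *\<^sub>R x + s' *\<^sub>R y)))"
      unfolding h ..
    finally show ?thesis .
  qed
  show ?thesis
    unfolding *[symmetric]
    by (rule ft_mult[OF f]) (rule integrable_ft_mult[OF g w])
qed

lemma cnj_ft: "cnj (ft s f \<xi>) = ft (- s) (\<lambda>x. cnj (f x)) \<xi>"
  unfolding ft_def by (subst Bochner_Integration.integral_cnj[symmetric]) (simp add: exp_cnj)

section \<open>Removing the Gaussian weight\<close>

lemma gauss_seq: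
  obtains c :: "nat \<Rightarrow> real" where "\<And>k. c k > 0" "\<And>x::'a::euclidean_space. (\<lambda>k. gauss (c k) x) \<longlonglongrightarrow> 1"
    "c \<longlonglongrightarrow> 0"
proof
  show l: "(\<lambda>k. inverse (real (Suc k))) \<longlonglongrightarrow> 0" by (rule LIMSEQ_inverse_real_of_nat)
  show "inverse (real (Suc k)) > 0" for k by simp
  have "(\<lambda>k. gauss (inverse (real (Suc k))) x) \<longlonglongrightarrow> exp (- (norm ((0::real) *\<^sub>R x))\<^sup>2 / 2)" for x :: 'a
    unfolding gauss_def by (intro tendsto_intros l) auto
  then show "(\<lambda>k. gauss (inverse (real (Suc k))) x) \<longlonglongrightarrow> 1" for x :: 'a by simp
qed

text \<open>With the weight inserted, the left side becomes a quadratic form in f with kernel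
  \<open>gauss_hat\<close>. Schur's test bounds it: |f(x) f(y)| is at most half the sum of the
  squares, and the kernel has mass (2 pi)^n in either variable. The bound is independent of c, and
  the right side may be infinite.\<close>

lemma plancherel_le:
  fixes f :: "'a::euclidean_space \<Rightarrow> complex"
  assumes f: "integrable lborel f" and s: "\<bar>s\<bar> = 1"
  shows "(\<integral>\<^sup>+\<xi>. ennreal ((norm (ft s f \<xi>))\<^sup>2) \<partial>lborel)
    \<le> ennreal ((2 * pi) ^ DIM('a)) * (\<integral>\<^sup>+x. ennreal ((norm (f x))\<^sup>2) \<partial>lborel)"
proof -
  have [measurable]: "f \<in> borel_measurable borel"
    using borel_measurable_integrable[OF f] by simp
  define R where "R = ennreal ((2 * pi) ^ DIM('a)) * (\<integral>\<^sup>+x. ennreal ((norm (f x))\<^sup>2) \<partial>lborel)"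
  have cf: "integrable lborel (\<lambda>x. cnj (f x))" using f by simp
  have [measurable]: "(\<lambda>x. cnj (f x)) \<in> borel_measurable borel"
    using borel_measurable_integrable[OF cf] by simp
  have main: "(\<integral>\<^sup>+\<xi>. ennreal ((norm (ft s f \<xi>))\<^sup>2 * gauss c \<xi>) \<partial>lborel) \<le> R" if c: "c > 0" for c
  proof -
    let ?H = "\<lambda>x y::'a. gauss_hat c (s *\<^sub>R x + (- s) *\<^sub>R y)"
    let ?J = "\<lambda>x. LINT y|lborel. cnj (f y) * complex_of_real (?H x y)"
    let ?P = "\<lambda>x y. ennreal ((norm (f x))\<^sup>2 / 2) * ennreal (?H x y)"
    let ?Q = "\<lambda>x y. ennreal ((norm (f y))\<^sup>2 / 2) * ennreal (?H x y)"
    have w: "integrable lborel (\<lambda>\<xi>::'a. complex_of_real (gauss c \<xi>))"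
      by (intro integrable_of_real integrable_gauss c)
    have e: "ft s f \<xi> * (ft (- s) (\<lambda>x. cnj (f x)) \<xi> * complex_of_real (gauss c \<xi>)) =
      complex_of_real ((norm (ft s f \<xi>))\<^sup>2 * gauss c \<xi>)" for \<xi>
      unfolding cnj_ft[symmetric] by (simp add: complex_norm_square[symmetric] mult.assoc[symmetric])
    have "integrable lborel (\<lambda>\<xi>. ft s f \<xi> * (ft (- s) (\<lambda>x. cnj (f x)) \<xi> * complex_of_real (gauss c \<xi>)))"
      by (intro integrable_ft_mult f cf w)
    then have i: "integrable lborel (\<lambda>\<xi>. (norm (ft s f \<xi>))\<^sup>2 * gauss c \<xi>)"
      unfolding e by (simp only: complex_of_real_integrable_eq)
    have "(\<integral>\<^sup>+\<xi>. ennreal ((norm (ft s f \<xi>))\<^sup>2 * gauss c \<xi>) \<partial>lborel) =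
        ennreal (LINT \<xi>|lborel. (norm (ft s f \<xi>))\<^sup>2 * gauss c \<xi>)"
      by (intro nn_integral_eq_integral i) (auto simp: gauss_bounds)
    also have "(LINT \<xi>|lborel. (norm (ft s f \<xi>))\<^sup>2 * gauss c \<xi>) =
        norm (LINT \<xi>|lborel. ft s f \<xi> * (ft (- s) (\<lambda>x. cnj (f x)) \<xi> * complex_of_real (gauss c \<xi>)))"
      unfolding e integral_complex_of_real norm_of_real
      by (intro abs_of_nonneg[symmetric] integral_nonneg_AE) (auto simp: gauss_bounds)
    also have "\<dots> = norm (LINT x|lborel. f x * ?J x)"
      by (subst ft_ft_gauss[OF f cf c]) simp
    also have "ennreal \<dots> \<le> (\<integral>\<^sup>+x. ennreal (norm (f x * ?J x)) \<partial>lborel)"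
      by (rule norm_integral_le_nn_integral)
    also have "\<dots> \<le> (\<integral>\<^sup>+x. \<integral>\<^sup>+y. (?P x y + ?Q x y) \<partial>lborel \<partial>lborel)"
    proof (rule nn_integral_mono)
      fix x :: 'a
      have "ennreal (norm (f x * ?J x))
        \<le> ennreal (norm (f x)) * (\<integral>\<^sup>+y. ennreal (norm (cnj (f y) * complex_of_real (?H x y))) \<partial>lborel)"
        unfolding norm_mult[of "f x"] by (subst ennreal_mult) (auto intro!: mult_left_mono norm_integral_le_nn_integral)
      also have "\<dots> = (\<integral>\<^sup>+y. ennreal (norm (f x)) * ennreal (norm (cnj (f y) * complex_of_real (?H x y))) \<partial>lborel)"
        by (rule nn_integral_cmult[symmetric]) measurable
      also have "\<dots> \<le> (\<integral>\<^sup>+y. (?P x y + ?Q x y) \<partial>lborel)"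
      proof (rule nn_integral_mono)
        fix y :: 'a
        let ?G = "?H x y"
        have G: "?G \<ge> 0" using c by (rule gauss_hat_nonneg)
        have "norm (f x) * norm (f y) \<le> (norm (f x))\<^sup>2 / 2 + (norm (f y))\<^sup>2 / 2"
          using sum_squares_bound[of "norm (f x)" "norm (f y)"] by simp
        then have "norm (f x) * norm (f y) * ?G \<le> ((norm (f x))\<^sup>2 / 2 + (norm (f y))\<^sup>2 / 2) * ?G"
          using G by (rule mult_right_mono)
        then have "ennreal (norm (f x) * norm (f y) * ?G) \<le> ennreal ((norm (f x))\<^sup>2 / 2 * ?G + (norm (f y))\<^sup>2 / 2 * ?G)"
          by (intro ennreal_leI) (simp add: distrib_right)
        then show "ennreal (norm (f x)) * ennreal (norm (cnj (f y) * complex_of_real ?G))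
          \<le> ennreal ((norm (f x))\<^sup>2 / 2) * ennreal ?G + ennreal ((norm (f y))\<^sup>2 / 2) * ennreal ?G"
          using G by (simp add: norm_mult ennreal_mult[symmetric] mult.assoc)
      qed
      finally show "ennreal (norm (f x * ?J x))
        \<le> (\<integral>\<^sup>+y. (?P x y + ?Q x y) \<partial>lborel)" .
    qed
    also have "\<dots> = (\<integral>\<^sup>+x. \<integral>\<^sup>+y. ?P x y \<partial>lborel \<partial>lborel) +
        (\<integral>\<^sup>+x. \<integral>\<^sup>+y. ?Q x y \<partial>lborel \<partial>lborel)"
      by (subst nn_integral_add[symmetric], measurable, subst nn_integral_add, measurable)
    also have "(\<integral>\<^sup>+x. \<integral>\<^sup>+y. ?Q x y \<partial>lborel \<partial>lborel) =
        (\<integral>\<^sup>+y. \<integral>\<^sup>+x. ?Q x y \<partial>lborel \<partial>lborel)"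
      by (rule lborel_pair.Fubini') measurable
    also have "\<dots> = (\<integral>\<^sup>+y. ennreal ((norm (f y))\<^sup>2 / 2) * ennreal ((2 * pi) ^ DIM('a)) \<partial>lborel)"
      using s by (subst nn_integral_cmult, measurable, subst add.commute, subst nn_integral_gauss_hat[OF c]) auto
    also have "(\<integral>\<^sup>+x. \<integral>\<^sup>+y. ?P x y \<partial>lborel \<partial>lborel) =
        (\<integral>\<^sup>+y. ennreal ((norm (f y))\<^sup>2 / 2) * ennreal ((2 * pi) ^ DIM('a)) \<partial>lborel)"
      using s by (subst nn_integral_cmult, measurable, subst nn_integral_gauss_hat[OF c]) auto
    also have "(\<integral>\<^sup>+y. ennreal ((norm (f y))\<^sup>2 / 2) * ennreal ((2 * pi) ^ DIM('a)) \<partial>lborel) +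
        (\<integral>\<^sup>+y. ennreal ((norm (f y))\<^sup>2 / 2) * ennreal ((2 * pi) ^ DIM('a)) \<partial>lborel) = 
        (\<integral>\<^sup>+y. ennreal ((2 * pi) ^ DIM('a)) * ennreal ((norm (f y))\<^sup>2) \<partial>lborel)"
      by (subst nn_integral_add[symmetric], measurable)
         (auto simp: ennreal_mult[symmetric] ennreal_plus[symmetric] mult_ac simp del: ennreal_plus intro!: nn_integral_cong)
    also have "\<dots> = R" unfolding R_def by (rule nn_integral_cmult) measurable
    finally show ?thesis .
  qed
  obtain c :: "nat \<Rightarrow> real" where c: "\<And>k. c k > 0" "\<And>x::'a. (\<lambda>k. gauss (c k) x) \<longlonglongrightarrow> 1"
    by (rule gauss_seq) blast
  \<comment> \<open>Fatou's lemma removes the weight; as only an upper bound is claimed, square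
    integrability of the transform need not be known beforehand.\<close>
  have "(\<integral>\<^sup>+\<xi>. ennreal ((norm (ft s f \<xi>))\<^sup>2) \<partial>lborel) =
      (\<integral>\<^sup>+\<xi>. liminf (\<lambda>k. ennreal ((norm (ft s f \<xi>))\<^sup>2 * gauss (c k) \<xi>)) \<partial>lborel)"
  proof (rule nn_integral_cong)
    fix \<xi> :: 'a
    have "(\<lambda>k. ennreal ((norm (ft s f \<xi>))\<^sup>2 * gauss (c k) \<xi>)) \<longlonglongrightarrow> ennreal ((norm (ft s f \<xi>))\<^sup>2 * 1)"
      by (intro tendsto_intros c)
    then show "ennreal ((norm (ft s f \<xi>))\<^sup>2) = liminf (\<lambda>k. ennreal ((norm (ft s f \<xi>))\<^sup>2 * gauss (c k) \<xi>))"
      by (simp add: lim_imp_Liminf)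
  qed
  also have "\<dots> \<le> liminf (\<lambda>k. \<integral>\<^sup>+\<xi>. ennreal ((norm (ft s f \<xi>))\<^sup>2 * gauss (c k) \<xi>) \<partial>lborel)"
    by (rule nn_integral_liminf) measurable
  also have "\<dots> \<le> R"
    by (rule Liminf_le) (simp_all add: main c)
  finally show ?thesis unfolding R_def .
qed


lemma norm2_integrable_mult:
  fixes f g :: "'a::euclidean_space \<Rightarrow> complex"
  assumes [measurable]: "f \<in> borel_measurable borel" "g \<in> borel_measurable borel"
    and f: "(\<integral>\<^sup>+x. ennreal ((norm (f x))\<^sup>2) \<partial>lborel) < \<infinity>"
    and g: "(\<integral>\<^sup>+x. ennreal ((norm (g x))\<^sup>2) \<partial>lborel) < \<infinity>"
  shows "integrable lborel (\<lambda>x. f x * g x)"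
proof -
  have "integrable lborel (\<lambda>x. (norm (f x))\<^sup>2)" "integrable lborel (\<lambda>x. (norm (g x))\<^sup>2)"
    using f g by (auto simp: integrable_iff_bounded)
  then have "integrable lborel (\<lambda>x. (norm (f x))\<^sup>2 + (norm (g x))\<^sup>2)"
    by (rule Bochner_Integration.integrable_add)
  then show ?thesis
  proof (rule Bochner_Integration.integrable_bound)
    have "norm (f x) * norm (g x) \<le> (norm (f x))\<^sup>2 + (norm (g x))\<^sup>2" for x
    proof -
      have "0 \<le> norm (f x) * norm (g x)" by simp
      then show ?thesis using sum_squares_bound[of "norm (f x)" "norm (g x)"] by linarith
    qed
    then show "AE x in lborel. norm (f x * g x) \<le> norm ((norm (f x))\<^sup>2 + (norm (g x))\<^sup>2)"
      by (auto simp: norm_mult)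
  qed measurable
qed

lemma nn_integral_norm2_finite:
  fixes f :: "'a::euclidean_space \<Rightarrow> complex"
  assumes f: "integrable lborel f" and B: "\<And>x. norm (f x) \<le> B"
  shows "(\<integral>\<^sup>+x. ennreal ((norm (f x))\<^sup>2) \<partial>lborel) < \<infinity>"
proof -
  have [measurable]: "f \<in> borel_measurable borel"
    using borel_measurable_integrable[OF f] by simp
  have "(\<integral>\<^sup>+x. ennreal ((norm (f x))\<^sup>2) \<partial>lborel) \<le> (\<integral>\<^sup>+x. ennreal B * ennreal (norm (f x)) \<partial>lborel)"
    using B by (intro nn_integral_mono)
      (auto simp: power2_eq_square ennreal_mult[symmetric] order_trans[OF norm_ge_zero B] intro!: ennreal_leI mult_right_mono)
  also have "\<dots> = ennreal B * (\<integral>\<^sup>+x. ennreal (norm (f x)) \<partial>lborel)"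
    by (rule nn_integral_cmult) measurable
  also have "\<dots> < \<infinity>"
    using f by (auto simp: integrable_iff_bounded ennreal_mult_less_top)
  finally show ?thesis .
qed

text \<open>Substituting y = -x + c z turns the moving kernel into the fixed Gaussian
  \<open>gauss 1\<close>, and dominated convergence applies. The factor (2 pi)^n arises from two
  factors sqrt(2 pi)^n: one in \<open>gauss_hat\<close>, one from the integral of
  \<open>gauss 1\<close>.\<close>

lemma gauss_hat_approx:
  fixes v :: "'a::euclidean_space \<Rightarrow> complex"
  assumes v: "continuous_on UNIV v" "\<And>x. norm (v x) \<le> B" and c: "\<And>k. c k > 0" "c \<longlonglongrightarrow> (0::real)"
  shows "(\<lambda>k. LINT y|lborel. v y * complex_of_real (gauss_hat (c k) (x + y))) \<longlonglongrightarrow> (2 * pi) ^ DIM('a) * v (- x)"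
proof -
  have [measurable]: "v \<in> borel_measurable borel"
    using v(1) by (rule borel_measurable_continuous_onI)
  let ?a = "sqrt (2 * pi) ^ DIM('a)"
  let ?h = "\<lambda>k z. v (- x + c k *\<^sub>R z) * complex_of_real (gauss_hat (c k) (x + (- x + c k *\<^sub>R z)))"
  let ?w = "\<lambda>k z. v (- x + c k *\<^sub>R z) * complex_of_real (gauss 1 z)"
  have e: "(LINT y|lborel. v y * complex_of_real (gauss_hat (c k) (x + y))) =
      (LINT z|lborel. complex_of_real ?a * ?w k z)" for k
  proof -
    have "(LINT y|lborel. v y * complex_of_real (gauss_hat (c k) (x + y))) =
      \<bar>c k\<bar> ^ DIM('a) *\<^sub>R (LINT z|lborel. ?h k z)"
      using c(1)[of k] by (intro lborel_integral_affine) simp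
    also have "\<dots> = (LINT z|lborel. \<bar>c k\<bar> ^ DIM('a) *\<^sub>R ?h k z)"
      by simp
    also have "\<dots> = (LINT z|lborel. complex_of_real ?a * ?w k z)"
    proof (rule Bochner_Integration.integral_cong[OF refl])
      fix z :: 'a
      have "\<bar>c k\<bar> ^ DIM('a) * gauss_hat (c k) (x + (- x + c k *\<^sub>R z)) = ?a * gauss 1 z"
        using c(1)[of k] by (simp add: gauss_hat_def gauss_def power_divide)
      then have *: "complex_of_real (\<bar>c k\<bar> ^ DIM('a)) * complex_of_real (gauss_hat (c k) (x + (- x + c k *\<^sub>R z))) =
          complex_of_real ?a * complex_of_real (gauss 1 z)"
        by (simp only: of_real_mult[symmetric])
      show "\<bar>c k\<bar> ^ DIM('a) *\<^sub>R ?h k z =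
          complex_of_real ?a * ?w k z"
        unfolding scaleR_conv_of_real by (subst (1 2) mult.left_commute) (simp only: *)
    qed
    finally show ?thesis .
  qed
  have "(\<lambda>k. LINT z|lborel. complex_of_real ?a * ?w k z) \<longlonglongrightarrow>
      (LINT z|lborel. complex_of_real ?a * (v (- x) * complex_of_real (gauss 1 (z::'a))))"
  proof (rule integral_dominated_convergence[where w="\<lambda>z. ?a * (B * gauss 1 z)"])
    show "integrable lborel (\<lambda>z::'a. ?a * (B * gauss 1 z))"
      by (intro integrable_mult_right integrable_gauss) simp
    have "(\<lambda>k. v (- x + c k *\<^sub>R z)) \<longlonglongrightarrow> v (- x)" for z
    proof (rule continuous_on_tendsto_compose[OF v(1)])
      have "(\<lambda>k. - x + c k *\<^sub>R z) \<longlonglongrightarrow> - x + 0 *\<^sub>R z" by (intro tendsto_intros c)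
      then show "(\<lambda>k. - x + c k *\<^sub>R z) \<longlonglongrightarrow> - x" by simp
    qed auto
    then show "AE z in lborel. (\<lambda>k. complex_of_real ?a * ?w k z)
        \<longlonglongrightarrow> complex_of_real ?a * (v (- x) * complex_of_real (gauss 1 z))"
      by (intro AE_I2 tendsto_intros)
    show "AE z in lborel. norm (complex_of_real ?a * ?w k z) \<le> ?a * (B * gauss 1 z)" for k
      using v(2) by (auto simp: norm_mult norm_power gauss_bounds intro!: mult_left_mono mult_right_mono)
  qed measurable
  also have "(LINT z|lborel. complex_of_real ?a * (v (- x) * complex_of_real (gauss 1 (z::'a)))) =
     complex_of_real ?a * (v (- x) * complex_of_real ?a)"
    by (simp add: integral_gauss)
  also have "\<dots> = complex_of_real (?a * ?a) * v (- x)"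
    by (simp only: of_real_mult mult_ac)
  also have "?a * ?a = (sqrt (2 * pi) * sqrt (2 * pi)) ^ DIM('a)"
    by (rule power_mult_distrib[symmetric])
  also have "sqrt (2 * pi) * sqrt (2 * pi) = 2 * pi" by simp
  finally show ?thesis unfolding e by simp
qed

text \<open>The pairing is bilinear, hence the reflection in place of a conjugate. The roles are
  deliberately unequal: continuity and boundedness of v give pointwise convergence of the smoothed
  function, whereas u is only required to lie in L^1 and L^2. Square integrability of both makes the
  product of the transforms integrable, which dominates the weighted integrals.\<close>

lemma plancherel_pairing:
  fixes u v :: "'a::euclidean_space \<Rightarrow> complex"
  assumes u: "integrable lborel u" "(\<integral>\<^sup>+x. ennreal ((norm (u x))\<^sup>2) \<partial>lborel) < \<infinity>"
    and v: "integrable lborel v" "continuous_on UNIV v" "\<And>x. norm (v x) \<le> B"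
  shows "(LINT x|lborel. ft 1 u x * ft 1 v x) = (2 * pi) ^ DIM('a) * (LINT \<xi>|lborel. u \<xi> * v (- \<xi>))"
proof -
  let ?G = "\<lambda>c x. LINT y|lborel. v y * complex_of_real (gauss_hat c (x + y))"
  have [measurable]: "u \<in> borel_measurable borel" "v \<in> borel_measurable borel"
    using borel_measurable_integrable[OF u(1)] borel_measurable_integrable[OF v(1)] by simp_all
  have v2: "(\<integral>\<^sup>+x. ennreal ((norm (v x))\<^sup>2) \<partial>lborel) < \<infinity>"
    by (rule nn_integral_norm2_finite[OF v(1,3)])
  have fin: "(\<integral>\<^sup>+x. ennreal ((norm (ft 1 f x))\<^sup>2) \<partial>lborel) < \<infinity>"
    if "integrable lborel f" "(\<integral>\<^sup>+x. ennreal ((norm (f x))\<^sup>2) \<partial>lborel) < \<infinity>" for f :: "'a \<Rightarrow> complex"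
    using plancherel_le[OF that(1), of 1] that(2)
    by (auto elim!: order.strict_trans1 simp: ennreal_mult_less_top)
  have i: "integrable lborel (\<lambda>x. ft 1 u x * ft 1 v x)"
    by (intro norm2_integrable_mult fin u v v2) measurable
  obtain c :: "nat \<Rightarrow> real" where c: "\<And>k. c k > 0" "\<And>x::'a. (\<lambda>k. gauss (c k) x) \<longlonglongrightarrow> 1" "c \<longlonglongrightarrow> 0"
    by (rule gauss_seq) blast
  have B: "B \<ge> 0" using v(3) norm_ge_zero order_trans by blast
  have 1: "(\<lambda>k. LINT x|lborel. ft 1 u x * (ft 1 v x * complex_of_real (gauss (c k) x))) \<longlonglongrightarrow>
      (LINT x|lborel. ft 1 u x * ft 1 v x)"
  proof (rule integral_dominated_convergence[where w="\<lambda>x. norm (ft 1 u x * ft 1 v x)"])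
    have "(\<lambda>k. ft 1 u x * (ft 1 v x * complex_of_real (gauss (c k) x))) \<longlonglongrightarrow> ft 1 u x * (ft 1 v x * complex_of_real 1)" for x
      by (intro tendsto_intros c)
    then show "AE x in lborel. (\<lambda>k. ft 1 u x * (ft 1 v x * complex_of_real (gauss (c k) x))) \<longlonglongrightarrow> ft 1 u x * ft 1 v x"
      by simp
    show "AE x in lborel. norm (ft 1 u x * (ft 1 v x * complex_of_real (gauss (c k) x))) \<le> norm (ft 1 u x * ft 1 v x)" for k
      by (auto simp: norm_mult gauss_bounds mult.assoc intro!: mult_left_mono mult_left_le)
  qed (use i in \<open>auto intro: integrable_norm\<close>)
  have 2: "(\<lambda>k. LINT x|lborel. u x * (?G (c k) x)) \<longlonglongrightarrow>
      (LINT x|lborel. u x * ((2 * pi) ^ DIM('a) * v (- x)))"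
  proof (rule integral_dominated_convergence[where w="\<lambda>x. B * (2 * pi) ^ DIM('a) * norm (u x)"])
    show "AE x in lborel. (\<lambda>k. u x * (?G (c k) x)) \<longlonglongrightarrow>
        u x * ((2 * pi) ^ DIM('a) * v (- x))"
      by (intro AE_I2 tendsto_mult tendsto_const gauss_hat_approx[OF v(2,3) c(1,3)])
    have "norm (?G (c k) x) \<le> B * (2 * pi) ^ DIM('a)" for k x
    proof -
      have "ennreal (norm (?G (c k) x)) \<le>
         (\<integral>\<^sup>+y. ennreal (norm (v y * complex_of_real (gauss_hat (c k) (x + y)))) \<partial>lborel)"
        by (rule norm_integral_le_nn_integral)
      also have "\<dots> \<le> (\<integral>\<^sup>+y. ennreal B * ennreal (gauss_hat (c k) (x + 1 *\<^sub>R y)) \<partial>lborel)"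
        using gauss_hat_nonneg[OF c(1)[of k], where 'a='a] v(3) B
        by (intro nn_integral_mono)
           (auto simp: norm_mult abs_of_nonneg ennreal_mult[symmetric] intro!: ennreal_leI mult_right_mono)
      also have "\<dots> = ennreal B * ennreal ((2 * pi) ^ DIM('a))"
        by (subst nn_integral_cmult, measurable, subst nn_integral_gauss_hat[OF c(1)]) auto
      also have "\<dots> = ennreal (B * (2 * pi) ^ DIM('a))"
        using B by (simp add: ennreal_mult)
      finally show ?thesis using B by (simp add: ennreal_le_iff)
    qed
    then show "AE x in lborel. norm (u x * (?G (c k) x)) \<le>
        B * (2 * pi) ^ DIM('a) * norm (u x)" for k
      by (auto simp: norm_mult mult.commute[of "norm (u _)"] intro!: mult_right_mono)
    show "integrable lborel (\<lambda>x. B * (2 * pi) ^ DIM('a) * norm (u x))"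
      by (intro integrable_mult_right integrable_norm u)
  qed measurable
  have "(LINT x|lborel. ft 1 u x * (ft 1 v x * complex_of_real (gauss (c k) x))) =
      (LINT x|lborel. u x * (?G (c k) x))" for k
    using ft_ft_gauss[OF u(1) v(1) c(1), of 1 1 k] by simp
  with 1 have "(\<lambda>k. LINT x|lborel. u x * (?G (c k) x)) \<longlonglongrightarrow>
      (LINT x|lborel. ft 1 u x * ft 1 v x)"
    by simp
  from LIMSEQ_unique[OF this 2] show ?thesis
    by (simp add: mult.left_commute[of "u _"])
qed

section \<open>Integration along rays and an oscillatory integral\<close>

text \<open>For fixed s the substitution xi = s eta turns the weight s^(n-1) into 1/s. After
  exchanging the integrals, each nonzero xi is counted with the integral of 1/s over |xi|/2 <= s <=
  |xi|.\<close>

lemma nn_integral_polar: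
  fixes F :: "'a::euclidean_space \<Rightarrow> ennreal"
  assumes [measurable]: "F \<in> borel_measurable borel"
  shows "(\<integral>\<^sup>+s. \<integral>\<^sup>+\<eta>. ennreal (indicator {0<..} s * indicator {1..2} (norm \<eta>) * s ^ (DIM('a) - 1)) * F (s *\<^sub>R \<eta>) \<partial>lborel \<partial>lborel) =
    ennreal (ln 2) * (\<integral>\<^sup>+\<xi>. F \<xi> \<partial>lborel)"
proof -
  let ?w = "\<lambda>s \<eta>::'a. indicator {0<..} s * indicator {1..2} (norm \<eta>) * s ^ (DIM('a) - 1) :: real"
  let ?q = "\<lambda>s \<xi>::'a. indicator {1..2} (norm \<xi> / s) * indicator {0<..} s * (1 / s) :: real"
  have "(\<integral>\<^sup>+\<eta>. ennreal (?w s \<eta>) * F (s *\<^sub>R \<eta>) \<partial>lborel) =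
      (\<integral>\<^sup>+\<xi>. F \<xi> * ennreal (?q s \<xi>) \<partial>lborel)" for s :: real
  proof (cases "s > 0")
    case True
    have "(\<integral>\<^sup>+\<xi>. F \<xi> * ennreal (?q s \<xi>) \<partial>lborel) =
        ennreal (\<bar>s\<bar> ^ DIM('a)) * (\<integral>\<^sup>+\<eta>. F (0 + s *\<^sub>R \<eta>) * ennreal (?q s (0 + s *\<^sub>R \<eta>)) \<partial>lborel)"
    proof (rule nn_integral_lborel_affine)
      show "(\<lambda>\<xi>. F \<xi> * ennreal (?q s \<xi>)) \<in> borel_measurable borel"
        by measurable
    qed (use True in simp)
    also have "\<dots> = (\<integral>\<^sup>+\<eta>. ennreal (\<bar>s\<bar> ^ DIM('a)) * (F (0 + s *\<^sub>R \<eta>) * ennreal (?q s (0 + s *\<^sub>R \<eta>))) \<partial>lborel)"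
      by (rule nn_integral_cmult[symmetric]) measurable
    also have "\<dots> = (\<integral>\<^sup>+\<eta>. ennreal (?w s \<eta>) * F (s *\<^sub>R \<eta>) \<partial>lborel)"
    proof (rule nn_integral_cong)
      fix \<eta> :: 'a
      have i: "indicator {1..2} (norm (0 + s *\<^sub>R \<eta>) / s) = (indicator {1..2} (norm \<eta>) :: real)"
        using True by (auto simp: indicator_def)
      have p: "\<bar>s\<bar> ^ DIM('a) * (1 / s) = s ^ (DIM('a) - 1)"
        using True by (cases "DIM('a)") auto
      have "ennreal (\<bar>s\<bar> ^ DIM('a)) * ennreal (indicator {1..2} (norm \<eta>) * indicator {0<..} s * (1 / s)) =
          ennreal (\<bar>s\<bar> ^ DIM('a) * (indicator {1..2} (norm \<eta>) * indicator {0<..} s * (1 / s)))"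
        by (rule ennreal_mult'[symmetric]) simp
      also have "\<bar>s\<bar> ^ DIM('a) * (indicator {1..2} (norm \<eta>) * indicator {0<..} s * (1 / s)) =
          indicator {0<..} s * indicator {1..2} (norm \<eta>) * s ^ (DIM('a) - 1)"
        unfolding p[symmetric] by (simp only: mult_ac)
      finally show "ennreal (\<bar>s\<bar> ^ DIM('a)) * (F (0 + s *\<^sub>R \<eta>) * ennreal (?q s (0 + s *\<^sub>R \<eta>))) =
          ennreal (?w s \<eta>) * F (s *\<^sub>R \<eta>)"
        unfolding i by (simp only: mult.commute[of "F _"] mult.assoc[symmetric] add_0_left)
    qed
    finally show ?thesis ..
  qed simp
  then have "(\<integral>\<^sup>+s. \<integral>\<^sup>+\<eta>. ennreal (?w s \<eta>) * F (s *\<^sub>R \<eta>) \<partial>lborel \<partial>lborel) =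
      (\<integral>\<^sup>+s. \<integral>\<^sup>+\<xi>. F \<xi> * ennreal (?q s \<xi>) \<partial>lborel \<partial>lborel)"
    by simp
  also have "\<dots> = (\<integral>\<^sup>+\<xi>. \<integral>\<^sup>+s. F \<xi> * ennreal (?q s \<xi>) \<partial>lborel \<partial>lborel)"
    by (rule lborel_pair.Fubini'[symmetric]) measurable
  also have "\<dots> = (\<integral>\<^sup>+\<xi>. ennreal (ln 2) * F \<xi> \<partial>lborel)"
  proof (rule nn_integral_cong_AE)
    have "AE \<xi> in lborel. \<xi> \<noteq> (0::'a)" by (rule AE_lborel_singleton)
    then show "AE \<xi> in lborel. (\<integral>\<^sup>+s. F \<xi> * ennreal (?q s \<xi>) \<partial>lborel) = ennreal (ln 2) * F \<xi>"
    proof eventually_elim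
      case (elim \<xi>)
      then have "norm \<xi> > 0" by simp
      have "(\<integral>\<^sup>+s. F \<xi> * ennreal (?q s \<xi>) \<partial>lborel) =
          F \<xi> * (\<integral>\<^sup>+s. ennreal (?q s \<xi>) \<partial>lborel)"
        by (rule nn_integral_cmult) measurable
      also have "(\<integral>\<^sup>+s. ennreal (?q s \<xi>) \<partial>lborel) =
          (\<integral>\<^sup>+s. ennreal (1 / s) * indicator {norm \<xi> / 2..norm \<xi>} s \<partial>lborel)"
      proof (rule nn_integral_cong)
        fix s :: real
        show "ennreal (?q s \<xi>) =
            ennreal (1 / s) * indicator {norm \<xi> / 2..norm \<xi>} s"
          using \<open>norm \<xi> > 0\<close> by (cases "s > 0") (auto simp: indicator_def field_simps)
      qed
      also have "\<dots> = ennreal (ln (norm \<xi>) - ln (norm \<xi> / 2))"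
      proof -
        have pos: "x > 0" if "x \<in> {norm \<xi> / 2..norm \<xi>}" for x
          using that \<open>norm \<xi> > 0\<close> unfolding atLeastAtMost_iff by linarith
        show ?thesis
          by (rule nn_integral_FTC_Icc) (auto dest!: pos intro!: derivative_eq_intros pos[THEN less_imp_le] simp del: atLeastAtMost_iff)
      qed
      also have "ln (norm \<xi>) - ln (norm \<xi> / 2) = ln 2"
        using \<open>norm \<xi> > 0\<close> by (simp add: ln_div)
      finally show ?case by (simp add: mult.commute)
    qed
  qed
  also have "\<dots> = ennreal (ln 2) * (\<integral>\<^sup>+\<xi>. F \<xi> \<partial>lborel)"
    by (rule nn_integral_cmult) measurable
  finally show ?thesis .
qed

text \<open>The measure of the unit sphere is replaced by Lebesgue measure on the shell
  \<open>1 \<le> |\<eta>| \<le> 2\<close>, every ray being covered with total weight \<open>\<integral> ds/s = ln 2\<close>.\<close>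

lemma polar_measure:
  "distr (density (lborel \<Otimes>\<^sub>M lborel) (\<lambda>(s, \<eta>). ennreal (indicator {0<..} s * indicator {1..2} (norm \<eta>) * s ^ (DIM('a) - 1))))
     borel (\<lambda>(s, \<eta>). s *\<^sub>R \<eta>) = density lborel (\<lambda>_::'a::euclidean_space. ennreal (ln 2))"
  (is "distr (density _ ?w) _ ?T = _")
proof (rule measure_eqI)
  fix A assume "A \<in> sets (distr (density (lborel \<Otimes>\<^sub>M lborel) ?w) borel ?T)"
  then have [measurable]: "A \<in> sets borel" by simp
  have "emeasure (distr (density (lborel \<Otimes>\<^sub>M lborel) ?w) borel ?T) A =
      (\<integral>\<^sup>+x. indicator A x \<partial>distr (density (lborel \<Otimes>\<^sub>M lborel) ?w) borel ?T)"
    by simp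
  also have "\<dots> = (\<integral>\<^sup>+x. indicator A (?T x) \<partial>density (lborel \<Otimes>\<^sub>M lborel) ?w)"
    by (intro nn_integral_distr) measurable
  also have "\<dots> = (\<integral>\<^sup>+x. ?w x * indicator A (?T x) \<partial>(lborel \<Otimes>\<^sub>M lborel))"
    by (rule nn_integral_density) measurable
  also have "\<dots> = (\<integral>\<^sup>+s. \<integral>\<^sup>+\<eta>. ennreal (indicator {0<..} s * indicator {1..2} (norm \<eta>) * s ^ (DIM('a) - 1)) * indicator A (s *\<^sub>R \<eta>) \<partial>lborel \<partial>lborel)"
    by (subst lborel.nn_integral_fst[symmetric]) (simp_all, measurable)
  also have "\<dots> = ennreal (ln 2) * (\<integral>\<^sup>+\<xi>. indicator A \<xi> \<partial>(lborel :: 'a measure))"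
    by (rule nn_integral_polar) measurable
  also have "\<dots> = emeasure (density lborel (\<lambda>_. ennreal (ln 2))) A"
    by (simp add: emeasure_density_const)
  finally show "emeasure (distr (density (lborel \<Otimes>\<^sub>M lborel) ?w) borel ?T) A = emeasure (density lborel (\<lambda>_. ennreal (ln 2))) A" .
qed simp

text \<open>The absolute value stays outside the radial integral, so that cancellation along each
  ray is preserved. The ball of radius 2 merely contains the shell.\<close>

lemma polar_bound:
  fixes F :: "'a::euclidean_space \<Rightarrow> real"
  assumes F: "integrable lborel F"
    and L: "\<And>\<eta>. norm \<eta> \<in> {1..2} \<Longrightarrow> \<bar>LINT s|lborel. indicator {0<..} s * s ^ (DIM('a) - 1) * F (s *\<^sub>R \<eta>)\<bar> \<le> L"
  shows "\<bar>LINT \<xi>|lborel. F \<xi>\<bar> \<le> L * measure lborel (cball (0::'a) 2) / ln 2"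
proof -
  have [measurable]: "F \<in> borel_measurable borel"
    using borel_measurable_integrable[OF F] by simp
  define w where "w = (\<lambda>(s, \<eta>::'a). indicator {0<..} s * indicator {1..2} (norm \<eta>) * s ^ (DIM('a) - 1) :: real)"
  have wm [measurable]: "w \<in> borel_measurable (lborel \<Otimes>\<^sub>M lborel)" unfolding w_def by measurable
  have w0: "0 \<le> w z" for z by (auto simp: w_def indicator_def split: prod.split)
  have pm: "distr (density (lborel \<Otimes>\<^sub>M lborel) (\<lambda>z. ennreal (w z))) borel (\<lambda>(s, \<eta>). s *\<^sub>R \<eta>) =
      density lborel (\<lambda>_::'a. ennreal (ln 2))"
    using polar_measure[where 'a='a] by (simp add: w_def case_prod_unfold)
  have Tm: "(\<lambda>(s, \<eta>). s *\<^sub>R \<eta>) \<in> measurable (density (lborel \<Otimes>\<^sub>M lborel) (\<lambda>z. ennreal (w z))) (borel :: 'a measure)"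
    by measurable
  have "integrable (density lborel (\<lambda>_::'a. ennreal (ln 2))) F"
    using F by (subst integrable_density) auto
  then have "integrable (density (lborel \<Otimes>\<^sub>M lborel) (\<lambda>z. ennreal (w z))) (\<lambda>z. F ((\<lambda>(s, \<eta>). s *\<^sub>R \<eta>) z))"
    unfolding pm[symmetric] by (subst (asm) integrable_distr_eq[OF Tm]) measurable
  then have i: "integrable (lborel \<Otimes>\<^sub>M lborel) (\<lambda>z. w z * F ((\<lambda>(s, \<eta>). s *\<^sub>R \<eta>) z))"
    using w0 by (subst (asm) integrable_density) auto
  have "(LINT \<xi>|density lborel (\<lambda>_::'a. ennreal (ln 2)). F \<xi>) = (LINT z|density (lborel \<Otimes>\<^sub>M lborel) (\<lambda>z. ennreal (w z)). F ((\<lambda>(s, \<eta>). s *\<^sub>R \<eta>) z))"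
    unfolding pm[symmetric] by (rule integral_distr[OF Tm]) measurable
  also have "\<dots> = (LINT z|(lborel \<Otimes>\<^sub>M lborel). w z * F ((\<lambda>(s, \<eta>). s *\<^sub>R \<eta>) z))"
    using w0 by (subst integral_density) auto
  also have "\<dots> = (LINT \<eta>|lborel. LINT s|lborel. w (s, \<eta>) * F (s *\<^sub>R \<eta>))"
    using i by (subst lborel_pair.integral_snd) (auto simp: case_prod_unfold)
  finally have e: "ln 2 * (LINT \<xi>|lborel. F \<xi>) = (LINT \<eta>|lborel. LINT s|lborel. w (s, \<eta>) * F (s *\<^sub>R \<eta>))"
    by (subst (asm) integral_density) auto
  \<comment> \<open>Basis vectors lie in the shell, so the hypothesis on \<open>L\<close> is not
    vacuous and forces its sign.\<close>
  have L0: "L \<ge> 0"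
  proof -
    obtain b :: 'a where "b \<in> Basis" using nonempty_Basis by blast
    then have "norm b \<in> {1..2}" by simp
    from L[OF this] show ?thesis by linarith
  qed
  have "norm (LINT \<eta>|lborel. LINT s|lborel. w (s, \<eta>) * F (s *\<^sub>R \<eta>)) \<le> (LINT \<eta>|lborel. L * indicator (cball (0::'a) 2) \<eta>)"
  proof (rule Bochner_Integration.integral_norm_bound_integral)
    show "integrable lborel (\<lambda>\<eta>. LINT s|lborel. w (s, \<eta>) * F (s *\<^sub>R \<eta>))"
      using i by (intro lborel_pair.integrable_snd) (auto simp: case_prod_unfold)
    show "integrable lborel (\<lambda>\<eta>::'a. L * indicator (cball 0 2) \<eta>)"
      by (intro integrable_mult_right integrable_real_indicator) (use emeasure_lborel_cball_finite[of "0::'a" 2] in auto)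
    fix \<eta> :: 'a
    show "norm (LINT s|lborel. w (s, \<eta>) * F (s *\<^sub>R \<eta>)) \<le> L * indicator (cball 0 2) \<eta>"
    proof (cases "norm \<eta> \<in> {1..2}")
      case True
      then have "(LINT s|lborel. w (s, \<eta>) * F (s *\<^sub>R \<eta>)) = (LINT s|lborel. indicator {0<..} s * s ^ (DIM('a) - 1) * F (s *\<^sub>R \<eta>))"
        by (simp add: w_def)
      with True L[of \<eta>] show ?thesis by simp
    next
      case False
      then show ?thesis using L0 by (simp add: w_def)
    qed
  qed
  also have "\<dots> = L * measure lborel (cball (0::'a) 2)" by simp
  finally have "\<bar>ln 2 * (LINT \<xi>|lborel. F \<xi>)\<bar> \<le> L * measure lborel (cball (0::'a) 2)" unfolding e by simp
  then show ?thesis by (simp add: abs_mult field_simps)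
qed

section \<open>Power tails and sine integrals along a ray\<close>

lemma nn_integral_powr_tail:
  assumes "e > 0" "b > (0::real)"
  shows "(\<integral>\<^sup>+s. ennreal (indicator {b..} s * s powr (- 1 - e)) \<partial>lborel) = ennreal (b powr (- e) / e)"
proof -
  have "((\<lambda>x. x powr (- 1 - e)) has_integral - (b powr ((- 1 - e) + 1)) / ((- 1 - e) + 1)) {b..}"
    using assms by (intro has_integral_powr_to_inf) auto
  then have "((\<lambda>x. x powr (- 1 - e)) has_integral b powr (- e) / e) {b..}"
    by simp
  from nn_integral_has_integral_lebesgue[OF _ this] show ?thesis by simp
qed

lemma integrable_norm_powr_tail:
  assumes e: "e > 0"
  shows "integrable lborel (\<lambda>\<xi>::'a::euclidean_space. indicator {1..} (norm \<xi>) * norm \<xi> powr (- real DIM('a) - e))"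
proof -
  let ?F = "\<lambda>\<xi>::'a. indicator {1..} (norm \<xi>) * norm \<xi> powr (- real DIM('a) - e)"
  have "ennreal (ln 2) * (\<integral>\<^sup>+\<xi>. ennreal (?F \<xi>) \<partial>lborel) =
    (\<integral>\<^sup>+s. \<integral>\<^sup>+\<eta>. ennreal (indicator {0<..} s * indicator {1..2} (norm (\<eta>::'a)) * s ^ (DIM('a) - 1)) * ennreal (?F (s *\<^sub>R \<eta>)) \<partial>lborel \<partial>lborel)"
    by (rule nn_integral_polar[symmetric]) measurable
  \<comment> \<open>A point s eta with |eta| <= 2 lies outside the unit ball only if s >=
    1/2.\<close>
  also have "\<dots> \<le> (\<integral>\<^sup>+s. \<integral>\<^sup>+\<eta>. ennreal (indicator {1/2..} s * s powr (- 1 - e)) * indicator (cball 0 2) (\<eta>::'a) \<partial>lborel \<partial>lborel)"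
  proof (intro nn_integral_mono)
    fix s :: real and \<eta> :: 'a
    show "ennreal (indicator {0<..} s * indicator {1..2} (norm \<eta>) * s ^ (DIM('a) - 1)) * ennreal (?F (s *\<^sub>R \<eta>)) \<le>
        ennreal (indicator {1/2..} s * s powr (- 1 - e)) * indicator (cball 0 2) \<eta>"
    proof (cases "s > 0 \<and> norm \<eta> \<in> {1..2} \<and> s * norm \<eta> \<ge> 1")
      case True
      then have s: "s > 0" and n: "1 \<le> norm \<eta>" "norm \<eta> \<le> 2" and sn: "1 \<le> s * norm \<eta>" by auto
      have "s * norm \<eta> \<le> s * 2" using s n by (intro mult_left_mono) auto
      then have s2: "s \<ge> 1/2" using sn by linarith
      have "norm \<eta> powr (- real DIM('a) - e) \<le> 1 powr (- real DIM('a) - e)"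
        using n e by (intro powr_mono2') auto
      then have "s powr (- 1 - e) * norm \<eta> powr (- real DIM('a) - e) \<le> s powr (- 1 - e) * 1"
        by (intro mult_left_mono) auto
      moreover have "s ^ (DIM('a) - 1) * (s * norm \<eta>) powr (- real DIM('a) - e) = s powr (- 1 - e) * norm \<eta> powr (- real DIM('a) - e)"
      proof -
        have "s ^ (DIM('a) - 1) = s powr (real DIM('a) - 1)"
          using s by (simp add: powr_realpow[symmetric] of_nat_diff Suc_leI DIM_positive)
        then show ?thesis using s n by (simp add: powr_mult powr_add[symmetric] mult.assoc[symmetric])
      qed
      ultimately show ?thesis using s s2 n sn
        by (simp add: ennreal_mult[symmetric])
    next
      case False
      then show ?thesis by (auto simp: indicator_def)
    qed
  qed
  also have "\<dots> = (\<integral>\<^sup>+s. ennreal (indicator {1/2..} s * s powr (- 1 - e)) \<partial>lborel) * emeasure lborel (cball (0::'a) 2)"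
    by (simp add: nn_integral_cmult_indicator nn_integral_multc)
  also have "\<dots> < \<infinity>"
    using nn_integral_powr_tail[OF e, of "1/2"] emeasure_lborel_cball_finite[of "0::'a" 2]
    by (auto simp: ennreal_mult_less_top)
  finally have "(\<integral>\<^sup>+\<xi>. ennreal (?F \<xi>) \<partial>lborel) < \<infinity>"
    by (auto simp: ennreal_mult_less_top)
  then show ?thesis by (intro integrableI_nonneg) auto
qed

text \<open>The constant depends neither on the frequency a nor on e. The interval is split at s =
  1/a. Below, |sin(a s)| <= a s leaves an integrand of size a b^(-e) on a length of at most 1/a;
  above, one integration by parts gains the factor 1/a. The two parts contribute 1 and 2.\<close>

lemma sin_powr_integral_bound:
  fixes a b e R :: real
  assumes e: "e > 0" and b: "0 < b" and R: "b \<le> R" and a: "a > 0"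
  shows "\<bar>integral {b..R} (\<lambda>s. sin (a * s) * s powr (- 1 - e))\<bar> \<le> 3 * b powr (- e)"
proof -
  define g where "g s = sin (a * s) * s powr (- 1 - e)" for s
  have cont: "continuous_on {p..q} g" if "p \<ge> b" for p q
    unfolding g_def using that b by (auto intro!: continuous_intros)
  have low: "\<bar>integral {p..q} g\<bar> \<le> b powr (- e)" if pq: "b \<le> p" "p \<le> q" "a * q \<le> 1" for p q
  proof -
    have "norm (integral (cbox p q) g) \<le> (a * b powr (- e)) * measure lborel (cbox p q)"
    proof (rule integrable_bound)
      show "0 \<le> a * b powr (- e)" using a by simp
      show "g integrable_on cbox p q" using cont[OF pq(1)] by (simp add: integrable_continuous_interval)
      fix s assume s: "s \<in> cbox p q"
      then have "s \<ge> b" "s > 0" using pq b by auto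
      have "\<bar>sin (a * s)\<bar> \<le> \<bar>a * s\<bar>" by (rule abs_sin_x_le_abs_x)
      then have "\<bar>sin (a * s)\<bar> * s powr (- 1 - e) \<le> (a * s) * s powr (- 1 - e)"
        using a \<open>s > 0\<close> by (intro mult_right_mono) auto
      also have "(a * s) * s powr (- 1 - e) = a * s powr (- e)"
        using \<open>s > 0\<close> powr_mult_base[of s "- 1 - e"] by simp
      also have "\<dots> \<le> a * b powr (- e)"
        using a b \<open>s \<ge> b\<close> e by (intro mult_left_mono powr_mono2') auto
      finally show "norm (g s) \<le> a * b powr (- e)" by (simp add: g_def abs_mult)
    qed
    also have "\<dots> = a * (q - p) * b powr (- e)" using pq by simp
    also have "\<dots> \<le> 1 * b powr (- e)"
    proof (intro mult_right_mono)
      have "0 \<le> a * p" using a b pq by simp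
      then show "a * (q - p) \<le> 1" using pq by (simp add: right_diff_distrib)
    qed simp
    finally show ?thesis by simp
  qed
  have high: "\<bar>integral {p..q} g\<bar> \<le> 2 * b powr (- e)" if pq: "b \<le> p" "p \<le> q" "1 \<le> a * p" for p q
  proof -
    have p0: "p > 0" "q > 0" using b pq by auto
    \<comment> \<open>Integration by parts: \<open>g + ?h\<close> is the derivative of -cos(a s)
      s^(-1-e) / a. The remainder \<open>?h\<close> is dominated by \<open>?k\<close>, which is
      again an exact derivative, so its integral involves no factor 1/e.\<close>
    let ?h = "\<lambda>s. cos (a * s) * ((1 + e) * s powr (- 2 - e) / a)"
    let ?k = "\<lambda>s. (1 + e) * s powr (- 2 - e) / a"
    have "((\<lambda>s. g s + ?h s) has_integral (- cos (a * q) * q powr (- 1 - e) / a - (- cos (a * p) * p powr (- 1 - e) / a))) {p..q}"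
    proof (rule fundamental_theorem_of_calculus[OF pq(2)])
      fix s assume "s \<in> {p..q}"
      then have "s > 0" using p0 by auto
      then have D2: "((\<lambda>s. s powr (- 1 - e)) has_real_derivative (- 1 - e) * s powr (- 2 - e)) (at s)"
        using has_real_derivative_powr[of s "- 1 - e"] by simp
      have D1: "((\<lambda>s. cos (a * s)) has_real_derivative - a * sin (a * s)) (at s)"
        by (auto intro!: derivative_eq_intros)
      have "((\<lambda>s. (- 1 / a) * (cos (a * s) * s powr (- 1 - e))) has_real_derivative
          (- 1 / a) * (- a * sin (a * s) * s powr (- 1 - e) + (- 1 - e) * s powr (- 2 - e) * cos (a * s))) (at s)"
        by (intro DERIV_cmult DERIV_mult D1 D2)
      moreover have "(\<lambda>s. (- 1 / a) * (cos (a * s) * s powr (- 1 - e))) = (\<lambda>s. - cos (a * s) * s powr (- 1 - e) / a)"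
        by simp
      moreover have "(- 1 / a) * (- a * S * P + (- 1 - e) * Q * C) = S * P + C * ((1 + e) * Q / a)" for S P Q C
        using a by (simp add: field_simps)
      ultimately have "((\<lambda>s. - cos (a * s) * s powr (- 1 - e) / a) has_real_derivative g s + ?h s) (at s)"
        unfolding g_def by metis
      then show "((\<lambda>s. - cos (a * s) * s powr (- 1 - e) / a) has_vector_derivative g s + ?h s) (at s within {p..q})"
        unfolding has_real_derivative_iff_has_vector_derivative[symmetric]
        by (rule has_field_derivative_at_within)
    qed
    moreover have hc: "?h integrable_on {p..q}"
      using p0 a by (intro integrable_continuous_interval continuous_intros) auto
    ultimately have "((\<lambda>s. (g s + ?h s) - ?h s) has_integral (- cos (a * q) * q powr (- 1 - e) / a - (- cos (a * p) * p powr (- 1 - e) / a)) - integral {p..q} ?h) {p..q}"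
      by (intro has_integral_diff integrable_integral)
    then have *: "integral {p..q} g = - cos (a * q) * q powr (- 1 - e) / a + cos (a * p) * p powr (- 1 - e) / a - integral {p..q} ?h"
      by (simp add: integral_unique)
    have "(?k has_integral (- (q powr (- 1 - e)) / a - (- (p powr (- 1 - e)) / a))) {p..q}"
    proof (rule fundamental_theorem_of_calculus[OF pq(2)])
      fix s assume "s \<in> {p..q}"
      then have "s > 0" using p0 by auto
      then have "((\<lambda>s. s powr (- 1 - e)) has_real_derivative (- 1 - e) * s powr (- 2 - e)) (at s)"
        using has_real_derivative_powr[of s "- 1 - e"] by simp
      then have "((\<lambda>s. (- 1 / a) * s powr (- 1 - e)) has_real_derivative (- 1 / a) * ((- 1 - e) * s powr (- 2 - e))) (at s)"
        by (rule DERIV_cmult)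
      moreover have "(- 1 / a) * ((- 1 - e) * Q) = (1 + e) * Q / a" for Q
        using a by (simp add: field_simps)
      moreover have "(\<lambda>s. (- 1 / a) * s powr (- 1 - e)) = (\<lambda>s. - (s powr (- 1 - e)) / a)"
        by simp
      ultimately have "((\<lambda>s. - (s powr (- 1 - e)) / a) has_real_derivative (1 + e) * s powr (- 2 - e) / a) (at s)"
        by metis
      then show "((\<lambda>s. - (s powr (- 1 - e)) / a) has_vector_derivative (1 + e) * s powr (- 2 - e) / a) (at s within {p..q})"
        unfolding has_real_derivative_iff_has_vector_derivative[symmetric]
        by (rule has_field_derivative_at_within)
    qed
    then have hI: "(?k has_integral (p powr (- 1 - e) / a - q powr (- 1 - e) / a)) {p..q}"
      by simp
    have hi: "?k integrable_on {p..q}"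
      and hv: "integral {p..q} ?k = p powr (- 1 - e) / a - q powr (- 1 - e) / a"
      using has_integral_integrable[OF hI] integral_unique[OF hI] by blast+
    have "norm (integral {p..q} ?h) \<le> integral {p..q} ?k"
    proof (rule integral_norm_bound_integral[OF hc hi])
      fix s
      have "\<bar>cos (a * s)\<bar> * ((1 + e) * s powr (- 2 - e) / a) \<le> 1 * ((1 + e) * s powr (- 2 - e) / a)"
        using a e by (intro mult_right_mono) auto
      then show "norm (?h s) \<le> (1 + e) * s powr (- 2 - e) / a"
        using a e by (simp add: abs_mult)
    qed
    then have h: "\<bar>integral {p..q} ?h\<bar> \<le> p powr (- 1 - e) / a - q powr (- 1 - e) / a" unfolding hv real_norm_def .
    have cb: "\<bar>cos (a * r) * r powr (- 1 - e) / a\<bar> \<le> r powr (- 1 - e) / a" for r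
    proof -
      have "\<bar>cos (a * r)\<bar> * (r powr (- 1 - e) / a) \<le> 1 * (r powr (- 1 - e) / a)"
        using a by (intro mult_right_mono) auto
      then show ?thesis using a by (simp add: abs_mult)
    qed
    \<comment> \<open>The boundary term at q is compensated by the bound for the remainder: Q + P +
      (P - Q) = 2 P.\<close>
    have "\<bar>integral {p..q} g\<bar> \<le> 2 * (p powr (- 1 - e) / a)"
    proof -
      have tri: "\<bar>- C + D - I\<bar> \<le> 2 * P" if "\<bar>C\<bar> \<le> Q" "\<bar>D\<bar> \<le> P" "\<bar>I\<bar> \<le> P - Q" for C D I P Q :: real
        using that by linarith
      have "integral {p..q} g = - (cos (a * q) * q powr (- 1 - e) / a) + cos (a * p) * p powr (- 1 - e) / a - integral {p..q} ?h"
        unfolding * by simp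
      then show ?thesis using tri[OF cb[of q] cb[of p] h] by (simp only:)
    qed
    also have "p powr (- 1 - e) / a \<le> p powr (- e)"
    proof -
      have "p powr (- e) = p * p powr (- 1 - e)" using p0 powr_mult_base[of p "- 1 - e"] by simp
      moreover have "1 * p powr (- 1 - e) \<le> (a * p) * p powr (- 1 - e)" using pq by (intro mult_right_mono) auto
      ultimately show ?thesis using a by (simp add: field_simps)
    qed
    also have "p powr (- e) \<le> b powr (- e)"
      using b pq e by (intro powr_mono2') auto
    finally show ?thesis by simp
  qed
  have "\<bar>integral {b..R} g\<bar> \<le> 3 * b powr (- e)"
  proof -
    consider "a * R \<le> 1" | "1 \<le> a * b" | "a * b \<le> 1" "1 \<le> a * R" by linarith
    then show ?thesis
    proof cases
      case 1
      then show ?thesis using low[of b R] R by simp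
    next
      case 2
      then show ?thesis using high[of b R] R by simp
    next
      case 3
      then have c: "b \<le> 1 / a" "1 / a \<le> R" using a by (auto simp: field_simps)
      have "integral {b..R} g = integral {b..1/a} g + integral {1/a..R} g"
        using c cont[of b] by (intro Henstock_Kurzweil_Integration.integral_combine[symmetric] integrable_continuous_interval) auto
      then show ?thesis using low[of b "1/a"] high[of "1/a" R] c a by simp
    qed
  qed
  then show ?thesis by (simp add: g_def[abs_def])
qed

lemma sin_powr_tail:
  fixes a b e :: real
  assumes e: "e > 0" and b: "0 < b"
  shows "integrable lborel (\<lambda>s. indicator {b..} s * (sin (a * s) * s powr (- 1 - e)))"
    and "\<bar>LINT s|lborel. indicator {b..} s * (sin (a * s) * s powr (- 1 - e))\<bar> \<le> 3 * b powr (- e)"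
proof -
  have i: "integrable lborel (\<lambda>s. indicator {b..} s * (sin (a * s) * s powr (- 1 - e)))" for a
  proof (rule Bochner_Integration.integrable_bound)
    show "integrable lborel (\<lambda>s. indicator {b..} s * s powr (- 1 - e))"
      using nn_integral_powr_tail[OF e b] by (intro integrableI_nonneg) auto
    have "\<bar>sin (a * s)\<bar> * s powr (- 1 - e) \<le> 1 * s powr (- 1 - e)" for s
      by (intro mult_right_mono) auto
    then show "AE s in lborel. norm (indicator {b..} s * (sin (a * s) * s powr (- 1 - e))) \<le> norm (indicator {b..} s * s powr (- 1 - e))"
      by (auto simp: indicator_def abs_mult)
  qed measurable
  then show "integrable lborel (\<lambda>s. indicator {b..} s * (sin (a * s) * s powr (- 1 - e)))" .
  have pos: "\<bar>LINT s|lborel. indicator {b..} s * (sin (a * s) * s powr (- 1 - e))\<bar> \<le> 3 * b powr (- e)" if a: "a > 0" for a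
  proof (rule tendsto_upperbound)
    have si: "set_integrable lborel {b..} (\<lambda>s. sin (a * s) * s powr (- 1 - e))"
      using i[of a] by (simp add: set_integrable_def)
    have "((\<lambda>R. set_lebesgue_integral lborel {b..R} (\<lambda>s. sin (a * s) * s powr (- 1 - e))) \<longlongrightarrow>
        set_lebesgue_integral lborel {b..} (\<lambda>s. sin (a * s) * s powr (- 1 - e))) at_top"
      by (rule tendsto_set_lebesgue_integral_at_top) (auto simp: si)
    then show "((\<lambda>R. \<bar>set_lebesgue_integral lborel {b..R} (\<lambda>s. sin (a * s) * s powr (- 1 - e))\<bar>) \<longlongrightarrow>
        \<bar>LINT s|lborel. indicator {b..} s * (sin (a * s) * s powr (- 1 - e))\<bar>) at_top"
      by (intro tendsto_rabs) (simp add: set_lebesgue_integral_def)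
    show "\<forall>\<^sub>F R in at_top. \<bar>set_lebesgue_integral lborel {b..R} (\<lambda>s. sin (a * s) * s powr (- 1 - e))\<bar> \<le> 3 * b powr (- e)"
    proof (rule eventually_mono[OF eventually_ge_at_top[of b]])
      fix R assume R: "b \<le> R"
      have "set_integrable lborel {b..R} (\<lambda>s. sin (a * s) * s powr (- 1 - e))"
        by (rule set_integrable_subset[OF si]) auto
      then show "\<bar>set_lebesgue_integral lborel {b..R} (\<lambda>s. sin (a * s) * s powr (- 1 - e))\<bar> \<le> 3 * b powr (- e)"
        using sin_powr_integral_bound[OF e b R a] by (simp add: set_borel_integral_eq_integral(2))
    qed
  qed simp
  consider "a > 0" | "a = 0" | "- a > 0" by linarith
  then show "\<bar>LINT s|lborel. indicator {b..} s * (sin (a * s) * s powr (- 1 - e))\<bar> \<le> 3 * b powr (- e)"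
  proof cases
    case 3
    from pos[OF this] show ?thesis by simp
  qed (use pos in auto)
qed

text \<open>Along a ray, the product of sine and cosine is half the sum of two sines with the linear
  phases (t|eta| + x.eta) s and (t|eta| - x.eta) s, to which the one-dimensional bound applies.
  Uniformity in e survives because the factor b^(n+e) from the ray and the factor b^(-e) from the
  sine integrals combine to b^n <= 1.\<close>

lemma oscillatory_bound:
  fixes x :: "'a::euclidean_space"
  assumes e: "e > 0"
  shows "\<bar>LINT \<xi>|lborel. indicator {1..} (norm \<xi>) * norm \<xi> powr (- real DIM('a) - e) * sin (t * norm \<xi>) * cos (x \<bullet> \<xi>)\<bar>
    \<le> 3 * measure lborel (cball (0::'a) 2) / ln 2"
proof (rule polar_bound)
  let ?F = "\<lambda>\<xi>::'a. indicator {1..} (norm \<xi>) * norm \<xi> powr (- real DIM('a) - e) * sin (t * norm \<xi>) * cos (x \<bullet> \<xi>)"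
  show "integrable lborel (\<lambda>\<xi>. indicator {1..} (norm \<xi>) * norm \<xi> powr (- real DIM('a) - e) * sin (t * norm \<xi>) * cos (x \<bullet> \<xi>))"
  proof (rule Bochner_Integration.integrable_bound[OF integrable_norm_powr_tail[OF e, where 'a='a]])
    have "\<bar>p * sin u * cos v\<bar> \<le> \<bar>p\<bar>" for p u v :: real
    proof -
      have "\<bar>p\<bar> * (\<bar>sin u\<bar> * \<bar>cos v\<bar>) \<le> \<bar>p\<bar> * (1 * 1)"
        by (intro mult_left_mono mult_mono) auto
      then show ?thesis by (simp add: abs_mult mult.assoc)
    qed
    then show "AE \<xi> in lborel. norm (indicator {1..} (norm \<xi>) * norm \<xi> powr (- real DIM('a) - e) * sin (t * norm \<xi>) * cos (x \<bullet> \<xi>))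
      \<le> norm (indicator {1..} (norm \<xi>) * norm \<xi> powr (- real DIM('a) - e))"
      unfolding real_norm_def by (intro AE_I2)
  qed measurable
  fix \<eta> :: 'a assume n: "norm \<eta> \<in> {1..2}"
  \<comment> \<open>The parameter at which the ray through eta leaves the unit ball.\<close>
  define b where "b = 1 / norm \<eta>"
  have b: "b > 0" "b \<le> 1" using n by (auto simp: b_def divide_le_eq_1)
  let ?g = "\<lambda>a s. indicator {b..} s * (sin (a * s) * s powr (- 1 - e))"
  let ?k = "b powr (real DIM('a) + e) / 2"
  let ?h = "\<lambda>s. indicator {0<..} s * s ^ (DIM('a) - 1) * ?F (s *\<^sub>R \<eta>)"
  have "?h s
      = ?k * (?g (t * norm \<eta> + x \<bullet> \<eta>) s + ?g (t * norm \<eta> - x \<bullet> \<eta>) s)" for s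
  proof (cases "s \<ge> b")
    case True
    then have s: "s > 0" using b by linarith
    have "b * norm \<eta> \<le> s * norm \<eta>" using True by (rule mult_right_mono) simp
    moreover have "b * norm \<eta> = 1" using n by (auto simp: b_def)
    ultimately have "1 \<le> s * norm \<eta>" by linarith
    note s = s this
    have "s ^ (DIM('a) - 1) = s powr (real DIM('a) - 1)"
      using s by (simp add: powr_realpow[symmetric] of_nat_diff Suc_leI DIM_positive)
    moreover have "norm \<eta> powr (- real DIM('a) - e) = b powr (real DIM('a) + e)"
      using n by (simp add: b_def powr_minus_divide[symmetric] powr_divide)
    ultimately have p: "s ^ (DIM('a) - 1) * (s * norm \<eta>) powr (- real DIM('a) - e) = b powr (real DIM('a) + e) * s powr (- 1 - e)"
      using s n by (simp add: powr_mult powr_add[symmetric] mult.assoc[symmetric])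
    have sc: "sin (t * (s * norm \<eta>)) * cos (s * (x \<bullet> \<eta>)) = (sin ((t * norm \<eta> + x \<bullet> \<eta>) * s) + sin ((t * norm \<eta> - x \<bullet> \<eta>) * s)) / 2"
      unfolding sin_times_cos by (simp add: algebra_simps)
    have "?h s =
        (s ^ (DIM('a) - 1) * (s * norm \<eta>) powr (- real DIM('a) - e)) * (sin (t * (s * norm \<eta>)) * cos (s * (x \<bullet> \<eta>)))"
      using s by simp
    then show ?thesis unfolding p sc using True by (simp add: algebra_simps)
  next
    case False
    have "s * norm \<eta> < b * norm \<eta>" using False n by (intro mult_strict_right_mono) auto
    moreover have "b * norm \<eta> = 1" using n by (auto simp: b_def)
    ultimately have "\<not> (s > 0 \<and> 1 \<le> s * norm \<eta>)" by linarith
    with False show ?thesis by (auto simp: indicator_def)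
  qed
  note pt = this
  have "\<bar>LINT s|lborel. ?h s\<bar> =
     \<bar>?k * ((LINT s|lborel. ?g (t * norm \<eta> + x \<bullet> \<eta>) s) + (LINT s|lborel. ?g (t * norm \<eta> - x \<bullet> \<eta>) s))\<bar>"
    unfolding pt integral_mult_right_zero
    by (subst Bochner_Integration.integral_add[OF sin_powr_tail(1)[OF e b(1)] sin_powr_tail(1)[OF e b(1)]]) (rule refl)
  also have "\<dots> = ?k * \<bar>(LINT s|lborel. ?g (t * norm \<eta> + x \<bullet> \<eta>) s) + (LINT s|lborel. ?g (t * norm \<eta> - x \<bullet> \<eta>) s)\<bar>"
    by (simp add: abs_mult)
  also have "\<dots> \<le> ?k * (3 * b powr (- e) + 3 * b powr (- e))"
    using sin_powr_tail(2)[OF e b(1), of "t * norm \<eta> + x \<bullet> \<eta>"] sin_powr_tail(2)[OF e b(1), of "t * norm \<eta> - x \<bullet> \<eta>"]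
    by (intro mult_left_mono) auto
  also have "\<dots> = 3 * (b powr (real DIM('a) + e) * b powr (- e))" by simp
  also have "b powr (real DIM('a) + e) * b powr (- e) = b powr real DIM('a)"
    by (simp add: powr_add[symmetric])
  also have "b powr real DIM('a) \<le> 1"
    using b by (intro powr_le1) auto
  finally show "\<bar>LINT s|lborel. ?h s\<bar> \<le> 3"
    by simp
qed

section \<open>Fourier transforms of Schwartz functions\<close>

lemma integrable_decay:
  fixes g :: "'a::euclidean_space \<Rightarrow> 'b::{banach, second_countable_topology}"
  assumes [measurable]: "g \<in> borel_measurable borel"
    and C: "\<And>x. norm (g x) * (1 + norm x) ^ (DIM('a) + 1) \<le> C"
  shows "integrable lborel g"
proof (rule Bochner_Integration.integrable_bound)
  show "integrable lborel (\<lambda>x::'a. C * indicator (cball 0 1) x + C * (indicator {1..} (norm x) * norm x powr (- real DIM('a) - 1)))"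
    using emeasure_lborel_cball_finite[of "0::'a" 1]
    by (intro Bochner_Integration.integrable_add integrable_mult_right integrable_norm_powr_tail) auto
  have "norm (g 0) \<le> C" using C[of 0] by simp
  then have C0: "C \<ge> 0" using norm_ge_zero order_trans by blast
  have "norm (g x) \<le> C * indicator (cball 0 1) x + C * (indicator {1..} (norm x) * norm x powr (- real DIM('a) - 1))" for x
  proof (cases "norm x \<le> 1")
    case True
    have "norm (g x) * 1 \<le> norm (g x) * (1 + norm x) ^ (DIM('a) + 1)"
      by (intro mult_left_mono one_le_power) auto
    then have "norm (g x) \<le> C" using C[of x] by linarith
    then show ?thesis using True C0 by (auto simp: add_increasing2)
  next
    case False
    then have n: "norm x > 1" by simp
    have "norm (g x) * norm x ^ (DIM('a) + 1) \<le> norm (g x) * (1 + norm x) ^ (DIM('a) + 1)"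
      by (intro mult_left_mono power_mono) auto
    then have "norm (g x) * norm x ^ (DIM('a) + 1) \<le> C" using C[of x] by linarith
    moreover have "norm x powr (- real DIM('a) - 1) = inverse (norm x ^ (DIM('a) + 1))"
    proof -
      have "- real DIM('a) - 1 = - real (DIM('a) + 1)" by simp
      moreover have "norm x > 0" using n by linarith
      ultimately show ?thesis by (simp only: powr_minus powr_realpow)
    qed
    moreover have "norm x ^ (DIM('a) + 1) > 0" using n by (intro zero_less_power) linarith
    ultimately have "norm (g x) \<le> C * norm x powr (- real DIM('a) - 1)"
      by (simp only: pos_le_divide_eq[symmetric] divide_inverse)
    then show ?thesis using n by simp
  qed
  then show "AE x in lborel. norm (g x) \<le> norm (C * indicator (cball 0 1) x + C * (indicator {1..} (norm x) * norm x powr (- real DIM('a) - 1)))"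
    by (intro AE_I2) (smt (verit) real_norm_def)
qed measurable

lemma iter_partial_schwartz:
  assumes "f \<in> schwartz"
  shows "iter_partial is f \<in> schwartz"
proof -
  have "iter_partial js (iter_partial is f) = iter_partial (js @ is) f" for js
    by (simp add: iter_partial_def)
  with assms show ?thesis by (simp add: schwartz_def)
qed

lemma partial_deriv_schwartz:
  assumes "f \<in> schwartz"
  shows "partial_deriv i f \<in> schwartz"
  using iter_partial_schwartz[OF assms, of "[i]"] by (simp add: iter_partial_def)

lemma schwartz_differentiable: "f \<in> schwartz \<Longrightarrow> f differentiable (at x)"
  unfolding schwartz_def by (auto dest!: spec[of _ "[]"] simp: iter_partial_def)

lemma schwartz_continuous: "f \<in> schwartz \<Longrightarrow> continuous_on UNIV f"
  by (intro continuous_at_imp_continuous_on ballI differentiable_imp_continuous_within schwartz_differentiable)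

lemma schwartz_borel: "f \<in> schwartz \<Longrightarrow> f \<in> borel_measurable borel"
  by (intro borel_measurable_continuous_onI schwartz_continuous)

lemma weighted_bound:
  assumes "bounded (range (\<lambda>x. norm x ^ (0::nat) * norm (f x)))" "bounded (range (\<lambda>x. norm x ^ k * norm (f x)))"
  shows "\<exists>C. \<forall>x. norm (f x) * (1 + norm x) ^ k \<le> C"
proof -
  obtain A B where A: "\<And>x. norm (f x) \<le> A" and B: "\<And>x. norm x ^ k * norm (f x) \<le> B"
    using assms unfolding bounded_iff by auto
  have "norm (f x) * (1 + norm x) ^ k \<le> 2 ^ k * A + 2 ^ k * B" for x
  proof -
    have "0 \<le> norm (f x)" "0 \<le> norm x ^ k * norm (f x)" by auto
    then have AB: "A \<ge> 0" "B \<ge> 0" using A[of x] B[of x] by linarith+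
    show ?thesis
    proof (cases "norm x \<le> 1")
      case True
      then have "norm (f x) * (1 + norm x) ^ k \<le> A * 2 ^ k"
        using A[of x] AB by (intro mult_mono power_mono) auto
      also have "\<dots> \<le> 2 ^ k * A + 2 ^ k * B" using AB by simp
      finally show ?thesis .
    next
      case False
      then have "norm (f x) * (1 + norm x) ^ k \<le> norm (f x) * (2 * norm x) ^ k"
        by (intro mult_left_mono power_mono) auto
      also have "\<dots> = 2 ^ k * (norm x ^ k * norm (f x))" by (simp add: power_mult_distrib)
      also have "\<dots> \<le> 2 ^ k * B" using B by (intro mult_left_mono) auto
      also have "\<dots> \<le> 2 ^ k * A + 2 ^ k * B" using AB by simp
      finally show ?thesis .
    qed
  qed
  then show ?thesis by blast
qed

lemma schwartz_decay:
  assumes "f \<in> schwartz"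
  shows "\<exists>C. \<forall>x. norm (f x) * (1 + norm x) ^ k \<le> C"
proof (rule weighted_bound)
  have b: "bounded (range (\<lambda>x. norm x ^ k * norm (f x)))" for k
    using assms unfolding schwartz_def by (auto dest!: spec[of _ "[]"] simp: iter_partial_def)
  show "bounded (range (\<lambda>x. norm x ^ (0::nat) * norm (f x)))" by (rule b)
  show "bounded (range (\<lambda>x. norm x ^ k * norm (f x)))" by (rule b)
qed

lemma schwartz_integrable: "f \<in> schwartz \<Longrightarrow> integrable lborel f"
  using schwartz_decay[where f=f] integrable_decay[of f, OF schwartz_borel] by meson

lemma fourier_eq_ft: "fourier f = ft (- 1) f"
  unfolding fourier_def[abs_def] ft_def[abs_def] by (simp add: inner_commute)

lemma inv_fourier_eq_ft: "inv_fourier h x = complex_of_real (1 / (2 * pi) ^ CARD('n)) * ft 1 h x" for x :: "real^'n::finite"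
  unfolding inv_fourier_def ft_def by simp

section \<open>Derivatives and decay on the Fourier side\<close>

lemma ft_translate:
  fixes f :: "'a::euclidean_space \<Rightarrow> complex"
  shows "ft s (\<lambda>x. f (a + x)) \<xi> = iexp (- s * (\<xi> \<bullet> a)) * ft s f \<xi>"
proof -
  have "ft s f \<xi> = (LINT y|lborel. iexp (s * (\<xi> \<bullet> (a + 1 *\<^sub>R y))) * f (a + 1 *\<^sub>R y))"
    unfolding ft_def by (subst lborel_integral_affine[where c=1 and t=a]) auto
  also have "\<dots> = (LINT y|lborel. iexp (s * (\<xi> \<bullet> a)) * (iexp (s * (\<xi> \<bullet> y)) * f (a + y)))"
    by (rule Bochner_Integration.integral_cong) (auto simp: inner_add_right distrib_left exp_add)
  also have "\<dots> = iexp (s * (\<xi> \<bullet> a)) * ft s (\<lambda>x. f (a + x)) \<xi>"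
    unfolding ft_def by simp
  finally show ?thesis
    by (simp add: mult.assoc[symmetric] exp_add[symmetric])
qed

lemma exp_diff_quotient:
  fixes z :: complex
  assumes h: "h \<longlonglongrightarrow> (0::real)" "\<And>k. h k \<noteq> 0"
  shows "(\<lambda>k. (exp (z * complex_of_real (h k)) - 1) / complex_of_real (h k)) \<longlonglongrightarrow> z"
proof -
  have "((\<lambda>w. exp (z * w)) has_field_derivative z) (at 0)"
    by (auto intro!: derivative_eq_intros)
  then have "(\<lambda>w. (exp (z * w) - 1) / w) \<midarrow>0\<rightarrow> z"
    by (simp add: has_field_derivative_iff)
  moreover have "filterlim (\<lambda>k. complex_of_real (h k)) (at 0) sequentially"
    using tendsto_of_real[OF h(1), where 'a=complex] h(2) by (simp add: filterlim_at)
  ultimately show ?thesis by (rule filterlim_compose)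
qed

lemma partial_deriv_tendsto:
  fixes f :: "real^'n::finite \<Rightarrow> complex"
  assumes f: "f differentiable (at x)" and h: "h \<longlonglongrightarrow> (0::real)" "\<And>k. h k > 0"
  shows "(\<lambda>k. (f (h k *\<^sub>R axis i 1 + x) - f x) / complex_of_real (h k)) \<longlonglongrightarrow> partial_deriv i f x"
proof -
  define D where "D = frechet_derivative f (at x)"
  have D: "(f has_derivative D) (at x)"
    using f unfolding D_def by (simp add: frechet_derivative_works)
  then have l: "(\<lambda>h. norm (f (x + h) - f x - D h) / norm h) \<midarrow>0\<rightarrow> 0" and bl: "bounded_linear D"
    by (auto simp: has_derivative_at)
  have hz: "(\<lambda>k. h k *\<^sub>R (axis i 1 :: real^'n)) \<longlonglongrightarrow> 0 *\<^sub>R axis i 1"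
    by (intro tendsto_intros h)
  have "filterlim (\<lambda>k. h k *\<^sub>R (axis i 1 :: real^'n)) (at 0) sequentially"
    using hz h(2) by (simp add: filterlim_at less_imp_neq[OF h(2), symmetric] axis_eq_0_iff)
  from filterlim_compose[OF l this]
  have "(\<lambda>k. norm (f (x + h k *\<^sub>R axis i 1) - f x - D (h k *\<^sub>R axis i 1)) / norm (h k *\<^sub>R (axis i 1 :: real^'n))) \<longlonglongrightarrow> 0" .
  moreover have "norm (f (x + h k *\<^sub>R axis i 1) - f x - D (h k *\<^sub>R axis i 1)) / norm (h k *\<^sub>R (axis i 1 :: real^'n)) =
      norm ((f (h k *\<^sub>R axis i 1 + x) - f x) / complex_of_real (h k) - D (axis i 1))" for k
  proof -
    have "D (h k *\<^sub>R axis i 1) = complex_of_real (h k) * D (axis i 1)"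
      unfolding scaleR_conv_of_real[symmetric] by (rule linear_scale[OF bounded_linear.linear[OF bl]])
    then have "(f (h k *\<^sub>R axis i 1 + x) - f x) / complex_of_real (h k) - D (axis i 1) =
        (f (x + h k *\<^sub>R axis i 1) - f x - D (h k *\<^sub>R axis i 1)) / complex_of_real (h k)"
      using h(2)[of k] by (simp add: diff_divide_distrib add.commute)
    then show ?thesis using h(2)[of k] by (simp add: norm_divide norm_axis_1)
  qed
  ultimately have "(\<lambda>k. norm ((f (h k *\<^sub>R axis i 1 + x) - f x) / complex_of_real (h k) - D (axis i 1))) \<longlonglongrightarrow> 0"
    by simp
  then show ?thesis
    unfolding partial_deriv_def D_def[symmetric] using Lim_null tendsto_norm_zero_iff by blast
qed

text \<open>A mean value bound on the segment; it supplies the majorant for dominated convergence of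
  difference quotients.\<close>

lemma diff_quotient_bound:
  fixes f :: "real^'n::finite \<Rightarrow> complex"
  assumes f: "\<And>x. f differentiable (at x)" and B: "\<And>s. 0 \<le> s \<Longrightarrow> s \<le> h \<Longrightarrow> norm (partial_deriv i f (s *\<^sub>R axis i 1 + x)) \<le> B"
    and h: "h > 0"
  shows "norm ((f (h *\<^sub>R axis i 1 + x) - f x) / complex_of_real h) \<le> B"
proof -
  let ?g = "\<lambda>s. f (s *\<^sub>R axis i 1 + x)"
  have "norm (?g h - ?g 0) \<le> B * norm (h - 0)"
  proof (rule differentiable_bound[of "{0..h}"])
    fix s assume s: "s \<in> {0..h}"
    let ?y = "s *\<^sub>R axis i 1 + x"
    have D: "(f has_derivative frechet_derivative f (at ?y)) (at ?y)"
      using f[of ?y] by (simp add: frechet_derivative_works)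
    have "((\<lambda>s. s *\<^sub>R axis i 1 + x) has_derivative (\<lambda>r. r *\<^sub>R axis i 1)) (at s within {0..h})"
      by (auto intro!: derivative_eq_intros)
    from has_derivative_compose[OF this D]
    show "(?g has_derivative (\<lambda>r. frechet_derivative f (at ?y) (r *\<^sub>R axis i 1))) (at s within {0..h})" .
    have "bounded_linear (frechet_derivative f (at ?y))" using D by (rule has_derivative_bounded_linear)
    then have e: "frechet_derivative f (at ?y) (r *\<^sub>R axis i 1) = r *\<^sub>R partial_deriv i f ?y" for r
      by (simp add: linear_simps partial_deriv_def)
    show "onorm (\<lambda>r. frechet_derivative f (at ?y) (r *\<^sub>R axis i 1)) \<le> B"
      unfolding e using B[of s] s
      by (intro onorm_le) (auto simp: mult.commute[of B] intro!: mult_left_mono)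
  qed (use h in auto)
  then show ?thesis using h by (simp add: norm_divide field_simps)
qed

text \<open>Difference quotients replace integration by parts: a translation becomes multiplication
  by an exponential, whose own difference quotient converges to the symbol of the
  derivative.\<close>

lemma ft_partial_deriv:
  fixes f :: "real^'n::finite \<Rightarrow> complex"
  assumes f: "f \<in> schwartz"
  shows "ft s (partial_deriv i f) \<xi> = (- \<i> * complex_of_real (s * \<xi> $ i)) * ft s f \<xi>"
proof -
  let ?N = "DIM(real^'n) + 1"
  let ?p = "\<lambda>x::real^'n. (1 + norm x) ^ ?N"
  define h :: "nat \<Rightarrow> real" where "h k = inverse (real (Suc k))" for k
  have h: "h \<longlonglongrightarrow> 0" "h k > 0" "h k \<le> 1" for k
    unfolding h_def by (rule LIMSEQ_inverse_real_of_nat) (auto simp: field_simps)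
  have [measurable]: "f \<in> borel_measurable borel" "partial_deriv i f \<in> borel_measurable borel"
    by (intro schwartz_borel f partial_deriv_schwartz)+
  obtain C where C: "\<And>x. norm (partial_deriv i f x) * ?p x \<le> C"
    using schwartz_decay[OF partial_deriv_schwartz[OF f]] by blast
  let ?u = "\<lambda>k x. (f (h k *\<^sub>R axis i 1 + x) - f x) / complex_of_real (h k)"
  \<comment> \<open>The steps \<open>h k\<close> are at most 1, so every point y of the segment
    starting at x satisfies 1 + |x| <= 2 (1 + |y|). The decay of the derivative at y therefore costs
    only a factor 2^N at x.\<close>
  define w :: "real^'n \<Rightarrow> real" where "w x = C * 2 ^ ?N / ?p x" for x
  have wi: "integrable lborel w"
  proof (rule integrable_decay)
    have "w x * ?p x = C * 2 ^ ?N" for x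
    proof -
      have "?p x > 0" by (intro zero_less_power) (simp add: add_pos_nonneg)
      then have "?p x \<noteq> 0" by (rule less_imp_neq[symmetric])
      from iffD1[OF nonzero_eq_divide_eq[OF this] w_def] show ?thesis .
    qed
    moreover have "C \<ge> 0" using order_trans[OF _ C[of 0]] by simp
    ultimately show "norm (w x) * ?p x \<le> C * 2 ^ ?N" for x
      by (simp add: w_def)
    show "w \<in> borel_measurable borel" unfolding w_def by measurable
  qed
  have dom: "norm (?u k x) \<le> w x" for k x
  proof (rule diff_quotient_bound)
    fix r assume r: "0 \<le> r" "r \<le> h k"
    let ?y = "r *\<^sub>R axis i 1 + x"
    have "norm x \<le> norm ?y + norm (r *\<^sub>R (axis i 1 :: real^'n))"
      using norm_triangle_ineq4[of ?y "r *\<^sub>R axis i 1"] by simp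
    then have "norm x \<le> norm ?y + 1" using r h(3)[of k] by (simp add: norm_axis_1)
    moreover have "1 + a \<le> 2 * (1 + b)" if "a \<le> b + 1" "0 \<le> b" for a b :: real
      using add_mono[OF that] by simp
    ultimately have "1 + norm x \<le> 2 * (1 + norm ?y)" using norm_ge_zero[of ?y] by blast
    then have "?p x \<le> 2 ^ ?N * ?p ?y"
      using power_mono[of "1 + norm x" "2 * (1 + norm ?y)" ?N] by (simp only: power_mult_distrib) (simp add: add_nonneg_nonneg)
    then have "norm (partial_deriv i f ?y) * ?p x \<le> norm (partial_deriv i f ?y) * (2 ^ ?N * ?p ?y)"
      by (rule mult_left_mono) simp
    also have "\<dots> = 2 ^ ?N * (norm (partial_deriv i f ?y) * ?p ?y)" by (simp only: mult_ac)
    also have "\<dots> \<le> 2 ^ ?N * C" using C by (intro mult_left_mono) auto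
    finally have "norm (partial_deriv i f ?y) * ?p x \<le> C * 2 ^ ?N" by (simp only: mult.commute)
    moreover have "?p x > 0" by (intro zero_less_power) (simp add: add_pos_nonneg)
    ultimately show "norm (partial_deriv i f ?y) \<le> w x"
      by (simp only: w_def pos_le_divide_eq)
  qed (use f h in \<open>auto intro: schwartz_differentiable\<close>)
  have 1: "(\<lambda>k. ft s (?u k) \<xi>) \<longlonglongrightarrow> ft s (partial_deriv i f) \<xi>"
    unfolding ft_def
  proof (rule integral_dominated_convergence[OF _ _ wi])
    show "AE x in lborel. (\<lambda>k. iexp (s * (\<xi> \<bullet> x)) * ?u k x) \<longlonglongrightarrow> iexp (s * (\<xi> \<bullet> x)) * partial_deriv i f x"
      by (intro AE_I2 tendsto_mult tendsto_const partial_deriv_tendsto schwartz_differentiable f h)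
    show "AE x in lborel. norm (iexp (s * (\<xi> \<bullet> x)) * ?u k x) \<le> w x" for k
    proof -
      have "norm (iexp v * z) = norm z" for v :: real and z by (simp add: norm_mult)
      then show ?thesis using dom by (intro AE_I2) (simp only:)
    qed
  qed measurable
  have e: "ft s (?u k) \<xi> = (exp ((- \<i> * complex_of_real (s * \<xi> $ i)) * complex_of_real (h k)) - 1) / complex_of_real (h k) * ft s f \<xi>" for k
  proof -
    have fi: "integrable lborel f" using f by (rule schwartz_integrable)
    have fi2: "integrable lborel (\<lambda>x. f (h k *\<^sub>R axis i 1 + x))"
      using lborel_integrable_affine[OF fi, of 1] by simp
    have i1: "integrable lborel (\<lambda>y. iexp (s * (\<xi> \<bullet> y)) * f y)"
      by (rule integrable_iexp_mult[OF fi]) measurable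
    have i2: "integrable lborel (\<lambda>y. iexp (s * (\<xi> \<bullet> y)) * f (h k *\<^sub>R axis i 1 + y))"
      by (rule integrable_iexp_mult[OF fi2]) measurable
    have "ft s (?u k) \<xi> = (ft s (\<lambda>x. f (h k *\<^sub>R axis i 1 + x)) \<xi> - ft s f \<xi>) / complex_of_real (h k)"
      unfolding ft_def
      unfolding Bochner_Integration.integral_diff[OF i2 i1, symmetric] by (simp add: right_diff_distrib)
    also have "\<dots> = (iexp (- s * (\<xi> \<bullet> (h k *\<^sub>R axis i 1))) * ft s f \<xi> - ft s f \<xi>) / complex_of_real (h k)"
      by (simp only: ft_translate)
    also have "iexp (- s * (\<xi> \<bullet> (h k *\<^sub>R axis i 1))) = exp ((- \<i> * complex_of_real (s * \<xi> $ i)) * complex_of_real (h k))"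
      by (simp add: inner_axis mult_ac)
    finally show ?thesis by (simp add: left_diff_distrib diff_divide_distrib)
  qed
  have "(\<lambda>k. ft s (?u k) \<xi>) \<longlonglongrightarrow> (- \<i> * complex_of_real (s * \<xi> $ i)) * ft s f \<xi>"
    unfolding e using h(2) by (intro tendsto_mult tendsto_const exp_diff_quotient h(1)) (auto simp: less_imp_neq[OF h(2), symmetric])
  from LIMSEQ_unique[OF 1 this] show ?thesis .
qed

lemma ft_iter_partial_replicate:
  assumes f: "f \<in> schwartz"
  shows "ft s (iter_partial (replicate k i) f) \<xi> = (- \<i> * complex_of_real (s * \<xi> $ i)) ^ k * ft s f \<xi>"
proof (induction k)
  case (Suc k)
  have "iter_partial (replicate (Suc k) i) f = partial_deriv i (iter_partial (replicate k i) f)"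
    by (simp add: iter_partial_def)
  then show ?case
    using ft_partial_deriv[OF iter_partial_schwartz[OF f, of "replicate k i"], of s i \<xi>] Suc
    by (simp only: power_Suc mult.assoc)
qed (simp add: iter_partial_def)

lemma norm_le_card_component:
  fixes x :: "real^'n::finite"
  obtains i where "norm x \<le> real CARD('n) * \<bar>x $ i\<bar>"
proof -
  obtain i where i: "\<And>j. \<bar>x $ j\<bar> \<le> \<bar>x $ i\<bar>"
  proof -
    have "Max (range (\<lambda>j. \<bar>x $ j\<bar>)) \<in> range (\<lambda>j. \<bar>x $ j\<bar>)" by (rule Max_in) auto
    then obtain i where "Max (range (\<lambda>j. \<bar>x $ j\<bar>)) = \<bar>x $ i\<bar>" by (rule rangeE)
    then have "\<bar>x $ j\<bar> \<le> \<bar>x $ i\<bar>" for j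
      using Max_ge[of "range (\<lambda>j. \<bar>x $ j\<bar>)" "\<bar>x $ j\<bar>"] by auto
    then show thesis by (rule that)
  qed
  have "norm x \<le> (\<Sum>j\<in>UNIV. \<bar>x $ j\<bar>)" by (rule norm_le_l1_cart)
  also have "\<dots> \<le> (\<Sum>j\<in>(UNIV::'n set). \<bar>x $ i\<bar>)" by (intro sum_mono i)
  finally show thesis using that by simp
qed

text \<open>For each xi it suffices to differentiate k times in the coordinate in which xi is
  largest, since that coordinate controls |xi| up to the factor n. Summing the constants over all
  coordinates removes the dependence on the choice.\<close>

lemma ft_schwartz_decay:
  fixes f :: "real^'n::finite \<Rightarrow> complex"
  assumes f: "f \<in> schwartz" and s: "\<bar>s\<bar> = 1"
  shows "\<exists>C. \<forall>\<xi>. norm (ft s f \<xi>) * (1 + norm \<xi>) ^ k \<le> C"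
proof (rule weighted_bound)
  have b: "bounded (range (\<lambda>\<xi>. norm \<xi> ^ k * norm (ft s f \<xi>)))" for k
  proof -
    define A where "A i = (LINT y|lborel. norm (iter_partial (replicate k i) f y))" for i
    have A: "\<bar>\<xi> $ i\<bar> ^ k * norm (ft s f \<xi>) \<le> A i" for \<xi> i
    proof -
      have "\<bar>\<xi> $ i\<bar> ^ k * norm (ft s f \<xi>) = norm (ft s (iter_partial (replicate k i) f) \<xi>)"
        using s unfolding ft_iter_partial_replicate[OF f] by (simp add: norm_mult norm_power abs_mult)
      then show ?thesis using norm_ft_le by (simp add: A_def)
    qed
    have A0: "A i \<ge> 0" for i unfolding A_def by simp
    have "norm \<xi> ^ k * norm (ft s f \<xi>) \<le> real CARD('n) ^ k * (\<Sum>i\<in>UNIV. A i)" for \<xi>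
    proof -
      obtain i where i: "norm \<xi> \<le> real CARD('n) * \<bar>\<xi> $ i\<bar>" by (rule norm_le_card_component)
      have "norm \<xi> ^ k * norm (ft s f \<xi>) \<le> (real CARD('n) * \<bar>\<xi> $ i\<bar>) ^ k * norm (ft s f \<xi>)"
        by (intro mult_right_mono power_mono i) auto
      also have "\<dots> = real CARD('n) ^ k * (\<bar>\<xi> $ i\<bar> ^ k * norm (ft s f \<xi>))"
        by (simp only: power_mult_distrib mult.assoc)
      also have "\<dots> \<le> real CARD('n) ^ k * A i" by (intro mult_left_mono A) auto
      also have "A i \<le> (\<Sum>i\<in>UNIV. A i)" by (rule member_le_sum) (auto simp: A0)
      finally show ?thesis by (simp add: mult_left_mono)
    qed
    then show ?thesis unfolding bounded_iff by (auto simp: norm_mult norm_power)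
  qed
  show "bounded (range (\<lambda>\<xi>. norm \<xi> ^ (0::nat) * norm (ft s f \<xi>)))" by (rule b)
  show "bounded (range (\<lambda>\<xi>. norm \<xi> ^ k * norm (ft s f \<xi>)))" by (rule b)
qed

text \<open>Applied to the bounded symbol of Lambda_theta(t) with m = 0 and to the Bessel weight
  with m = 2, this makes both factors of the dual pairing admissible in
  \<open>plancherel_pairing\<close>.\<close>

lemma weighted_ft_schwartz:
  fixes f :: "real^'n::finite \<Rightarrow> complex"
  assumes f: "f \<in> schwartz" and s: "\<bar>s\<bar> = 1" and [measurable]: "b \<in> borel_measurable borel"
    and b: "\<And>\<xi>. \<bar>b \<xi>\<bar> \<le> K * (1 + norm \<xi>) ^ m"
  shows "integrable lborel (\<lambda>\<xi>. complex_of_real (b \<xi>) * ft s f \<xi>)"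
    and "\<exists>B. \<forall>\<xi>. norm (complex_of_real (b \<xi>) * ft s f \<xi>) \<le> B"
proof -
  have [measurable]: "f \<in> borel_measurable borel" by (rule schwartz_borel[OF f])
  have K: "K \<ge> 0" using order_trans[OF abs_ge_zero b[of 0]] by simp
  have *: "\<exists>C. \<forall>\<xi>. norm (complex_of_real (b \<xi>) * ft s f \<xi>) * (1 + norm \<xi>) ^ k \<le> C" for k
  proof -
    obtain C where C: "\<And>\<xi>. norm (ft s f \<xi>) * (1 + norm \<xi>) ^ (m + k) \<le> C"
      using ft_schwartz_decay[OF f s] by blast
    have "norm (complex_of_real (b \<xi>) * ft s f \<xi>) * (1 + norm \<xi>) ^ k \<le> K * C" for \<xi>
    proof -
      have "norm (complex_of_real (b \<xi>) * ft s f \<xi>) * (1 + norm \<xi>) ^ k = \<bar>b \<xi>\<bar> * (norm (ft s f \<xi>) * (1 + norm \<xi>) ^ k)"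
        by (simp add: norm_mult)
      also have "\<dots> \<le> (K * (1 + norm \<xi>) ^ m) * (norm (ft s f \<xi>) * (1 + norm \<xi>) ^ k)"
        by (intro mult_right_mono b) auto
      also have "\<dots> = K * (norm (ft s f \<xi>) * (1 + norm \<xi>) ^ (m + k))"
        by (simp add: power_add)
      also have "\<dots> \<le> K * C" by (intro mult_left_mono C K)
      finally show ?thesis .
    qed
    then show ?thesis by blast
  qed
  from *[of "DIM(real^'n) + 1"] show "integrable lborel (\<lambda>\<xi>. complex_of_real (b \<xi>) * ft s f \<xi>)"
    by (auto intro!: integrable_decay)
  from *[of 0] show "\<exists>B. \<forall>\<xi>. norm (complex_of_real (b \<xi>) * ft s f \<xi>) \<le> B" by simp
qed

section \<open>Real interpolation with a uniform constant\<close>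

text \<open>The constant is the Beta value B(q - 2, 3); the condition q > 2 makes the weight l^(q-3)
  integrable at 0.\<close>

lemma nn_integral_layer_square:
  assumes q: "q > (2::real)" and a: "a \<ge> 0"
  shows "(\<integral>\<^sup>+l. ennreal (indicator {0<..} l * l powr (q - 3) * (max 0 (a - l))\<^sup>2) \<partial>lborel) =
    ennreal (2 / (q * (q - 1) * (q - 2)) * a powr q)"
proof -
  have i: "((\<lambda>l. l powr p) has_integral a powr (p + 1) / (p + 1)) {0..a}" if "p > - 1" for p
    using has_integral_powr_from_0[OF that a] .
  have "((\<lambda>l. a\<^sup>2 * l powr (q - 3) - 2 * a * l powr (q - 2) + l powr (q - 1)) has_integral
      a\<^sup>2 * (a powr (q - 2) / (q - 2)) - 2 * a * (a powr (q - 1) / (q - 1)) + a powr q / q) {0..a}"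
    using i[of "q - 3"] i[of "q - 2"] i[of "q - 1"] q
    by (intro has_integral_add has_integral_diff has_integral_mult_right) (auto simp: algebra_simps)
  moreover have "a\<^sup>2 * l powr (q - 3) - 2 * a * l powr (q - 2) + l powr (q - 1) = l powr (q - 3) * (a - l)\<^sup>2"
    if "l \<in> {0..a}" for l
  proof -
    have "l powr (q - 2) = l * l powr (q - 3)" "l powr (q - 1) = l * l powr (q - 2)"
      using that powr_mult_base[of l "q - 3"] powr_mult_base[of l "q - 2"] by auto
    then show ?thesis by (simp add: power2_eq_square algebra_simps)
  qed
  ultimately have hi: "((\<lambda>l. l powr (q - 3) * (a - l)\<^sup>2) has_integral
      a\<^sup>2 * (a powr (q - 2) / (q - 2)) - 2 * a * (a powr (q - 1) / (q - 1)) + a powr q / q) {0..a}"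
    by (rule has_integral_cong[THEN iffD1, rotated])
  have "(\<integral>\<^sup>+l. ennreal (indicator {0<..} l * l powr (q - 3) * (max 0 (a - l))\<^sup>2) \<partial>lborel) =
    (\<integral>\<^sup>+l. ennreal (indicator {0..a} l * (l powr (q - 3) * (a - l)\<^sup>2)) \<partial>lborel)"
    by (intro nn_integral_cong) (auto simp: indicator_def max_def)
  also have "\<dots> = ennreal (a\<^sup>2 * (a powr (q - 2) / (q - 2)) - 2 * a * (a powr (q - 1) / (q - 1)) + a powr q / q)"
    by (rule nn_integral_has_integral_lebesgue[OF _ hi]) simp
  also have "a\<^sup>2 * (a powr (q - 2) / (q - 2)) - 2 * a * (a powr (q - 1) / (q - 1)) + a powr q / q =
      2 / (q * (q - 1) * (q - 2)) * a powr q"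
  proof -
    have e: "a powr (q - 1) = a * a powr (q - 2)" "a powr q = a * a powr (q - 1)"
      using a powr_mult_base[of a "q - 2"] powr_mult_base[of a "q - 1"] by auto
    have "1 / (q - 2) - 2 / (q - 1) + 1 / q = 2 / (q * (q - 1) * (q - 2))"
      using q by (simp add: divide_simps) (simp add: algebra_simps)
    moreover have "a\<^sup>2 * (a powr (q - 2) / (q - 2)) - 2 * a * (a powr (q - 1) / (q - 1)) + a powr q / q =
        (1 / (q - 2) - 2 / (q - 1) + 1 / q) * a powr q"
      unfolding e by (simp add: power2_eq_square left_diff_distrib distrib_right)
    ultimately show ?thesis by simp
  qed
  finally show ?thesis .
qed

lemma nn_integral_powr_Ioc:
  assumes p: "p > (- 1 :: real)" and T: "T \<ge> 0"
  shows "(\<integral>\<^sup>+l. ennreal (indicator {0<..T} l * l powr p) \<partial>lborel) = ennreal (T powr (p + 1) / (p + 1))"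
proof -
  have "(\<integral>\<^sup>+l. ennreal (indicator {0<..T} l * l powr p) \<partial>lborel) = (\<integral>\<^sup>+l. ennreal (indicator {0..T} l * l powr p) \<partial>lborel)"
    by (intro nn_integral_cong) (auto simp: indicator_def)
  also have "\<dots> = ennreal (T powr (p + 1) / (p + 1))"
    by (rule nn_integral_has_integral_lebesgue[OF _ has_integral_powr_from_0[OF p T]]) simp
  finally show ?thesis .
qed

text \<open>Real interpolation between \<open>L\<^sup>1 \<rightarrow> L\<^sup>\<infinity>\<close> (norm \<open>B\<close>) and \<open>L\<^sup>2 \<rightarrow> L\<^sup>2\<close> (norm \<open>A\<close>). Measuring
  \<open>h\<close> by \<open>(|h| - l)\<^sub>+\<^sup>2\<close> instead of by its distribution function makes the factor \<open>q - 2\<close> cancel,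
  so that the constant stays bounded as \<open>q\<close> tends to \<open>2\<close>.\<close>

lemma real_interpolation:
  fixes g h :: "'a::euclidean_space \<Rightarrow> complex"
  assumes [measurable]: "g \<in> borel_measurable borel" "h \<in> borel_measurable borel"
    and q: "q > 2" and r: "r = q / (q - 1)" and B: "B > 0" and G: "G > 0" "(\<integral>\<^sup>+x. ennreal (norm (g x) powr r) \<partial>lborel) \<le> ennreal G"
    and split: "\<And>\<gamma>. \<gamma> > 0 \<Longrightarrow> \<exists>k\<in>(borel_measurable borel :: ('a \<Rightarrow> complex) set).
      (\<forall>x. ennreal (norm (h x)) \<le> ennreal B * (\<integral>\<^sup>+y. ennreal (indicator {\<gamma><..} (norm (g y)) * norm (g y)) \<partial>lborel) + ennreal (norm (k x))) \<and>
      (\<integral>\<^sup>+x. ennreal ((norm (k x))\<^sup>2) \<partial>lborel) \<le> ennreal (A\<^sup>2) * (\<integral>\<^sup>+y. ennreal (indicator {..\<gamma>} (norm (g y)) * (norm (g y))\<^sup>2) \<partial>lborel)"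
  shows "(\<integral>\<^sup>+x. ennreal (norm (h x) powr q) \<partial>lborel)
    \<le> ennreal (q * (q - 1) / 2 * A\<^sup>2 * (B * G) powr (q - 2)) * (\<integral>\<^sup>+x. ennreal (norm (g x) powr r) \<partial>lborel)"
proof -
  let ?I = "\<integral>\<^sup>+x. ennreal (norm (g x) powr r) \<partial>lborel"
  let ?K = "A\<^sup>2 * (B * G) powr (q - 2) / (q - 2)"
  \<comment> \<open>The truncation height is chosen so that the part of g above it contributes at
    most l to |h|: there |g| <= \<gamma>(l)^(1-r) |g|^r, and \<gamma>(l)^(1-r) = l / (B G).\<close>
  define \<gamma> where "\<gamma> l = (B * G / l) powr (q - 1)" for l
  let ?T = "\<lambda>l. \<integral>\<^sup>+y. ennreal (indicator {\<gamma> l<..} (norm (g y)) * norm (g y)) \<partial>lborel"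
  let ?S = "\<lambda>l. \<integral>\<^sup>+y. ennreal (indicator {..\<gamma> l} (norm (g y)) * (norm (g y))\<^sup>2) \<partial>lborel"
  have BG: "B * G > 0" using B G by simp
  have g0: "\<gamma> l > 0" if "l > 0" for l using that B G by (simp add: \<gamma>_def)
  have [measurable]: "\<gamma> \<in> borel_measurable borel" unfolding \<gamma>_def[abs_def] by measurable
  have [measurable]: "Measurable.pred (borel \<Otimes>\<^sub>M borel) (\<lambda>z. norm (g (snd z)) \<in> {..\<gamma> (fst z)})"
    unfolding atMost_iff by measurable
  have r1: "1 - r = - (1 / (q - 1))" "r > 0" using q by (auto simp: r field_simps)
  have tail: "ennreal B * ?T l \<le> ennreal l" if l: "l > 0" for l
  proof -
    have gl: "\<gamma> l powr (1 - r) = l / (B * G)"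
      using l BG q by (simp add: \<gamma>_def powr_powr r1 powr_minus)
    have "?T l \<le>
        (\<integral>\<^sup>+y. ennreal (l / (B * G)) * ennreal (norm (g y) powr r) \<partial>lborel)"
    proof (rule nn_integral_mono)
      fix y
      show "ennreal (indicator {\<gamma> l<..} (norm (g y)) * norm (g y)) \<le> ennreal (l / (B * G)) * ennreal (norm (g y) powr r)"
      proof (cases "\<gamma> l < norm (g y)")
        case True
        then have n: "norm (g y) > 0" using g0[OF l] by linarith
        have "norm (g y) powr (1 - r) \<le> \<gamma> l powr (1 - r)"
          using True g0[OF l] q by (intro powr_mono2') (auto simp: r1)
        then have "norm (g y) powr (1 - r) * norm (g y) powr r \<le> l / (B * G) * norm (g y) powr r"
          unfolding gl by (rule mult_right_mono) simp
        then have "norm (g y) \<le> l / (B * G) * norm (g y) powr r"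
          using n by (simp add: powr_add[symmetric])
        then show ?thesis using True l BG
          by (subst ennreal_mult[symmetric]) (auto intro!: ennreal_leI)
      qed simp
    qed
    also have "\<dots> = ennreal (l / (B * G)) * ?I"
      by (rule nn_integral_cmult) measurable
    also have "\<dots> \<le> ennreal (l / (B * G)) * ennreal G"
      by (intro mult_left_mono G) simp
    finally have "ennreal B * ?T l \<le>
        ennreal B * (ennreal (l / (B * G)) * ennreal G)"
      by (intro mult_left_mono) auto
    also have "\<dots> = ennreal (B * (l / (B * G) * G))"
      using B G l by (simp only: ennreal_mult[symmetric] less_imp_le mult_nonneg_nonneg divide_nonneg_nonneg)
    also have "B * (l / (B * G) * G) = l" using B G by simp
    finally show ?thesis .
  qed
  \<comment> \<open>Since the upper part contributes at most l, the excess of |h| over l is at most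
    |k|, and the L^2 bound for the lower part applies.\<close>
  have level: "(\<integral>\<^sup>+x. ennreal ((max 0 (norm (h x) - l))\<^sup>2) \<partial>lborel)
      \<le> ennreal (A\<^sup>2) * ?S l" if l: "l > 0" for l
  proof -
    obtain k :: "'a \<Rightarrow> complex" where k: "\<And>x. ennreal (norm (h x)) \<le> ennreal B * ?T l + ennreal (norm (k x))"
      and k2: "(\<integral>\<^sup>+x. ennreal ((norm (k x))\<^sup>2) \<partial>lborel) \<le> ennreal (A\<^sup>2) * ?S l"
      using split[OF g0[OF l]] by blast
    have "(\<integral>\<^sup>+x. ennreal ((max 0 (norm (h x) - l))\<^sup>2) \<partial>lborel) \<le> (\<integral>\<^sup>+x. ennreal ((norm (k x))\<^sup>2) \<partial>lborel)"
    proof (rule nn_integral_mono)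
      fix x
      have "ennreal (norm (h x)) \<le> ennreal l + ennreal (norm (k x))"
        using k[of x] tail[OF l] by (meson add_right_mono order_trans)
      then have "norm (h x) \<le> l + norm (k x)"
        using l by (simp add: ennreal_plus[symmetric] ennreal_le_iff del: ennreal_plus)
      then show "ennreal ((max 0 (norm (h x) - l))\<^sup>2) \<le> ennreal ((norm (k x))\<^sup>2)"
        by (intro ennreal_leI power_mono) auto
    qed
    also note k2
    finally show ?thesis .
  qed
  \<comment> \<open>The reciprocal of the Beta factor in \<open>nn_integral_layer_square\<close>. It
    vanishes like q - 2, which offsets the singular denominator of \<open>?K\<close>.\<close>
  define c where "c = q * (q - 1) * (q - 2) / 2"
  have c: "c > 0" using q by (simp add: c_def)
  define w where "w l = indicator {0<..} l * l powr (q - 3)" for l :: real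
  have w0: "w l \<ge> 0" for l by (simp add: w_def)
  have [measurable]: "w \<in> borel_measurable borel" unfolding w_def[abs_def] by measurable
  let ?L = "\<lambda>l x. ennreal (w l) * ennreal ((max 0 (norm (h x) - l))\<^sup>2)"
  let ?R = "\<lambda>l y. ennreal (A\<^sup>2) * (ennreal (w l) * ennreal (indicator {..\<gamma> l} (norm (g y)) * (norm (g y))\<^sup>2))"
  have "(\<integral>\<^sup>+x. ennreal (norm (h x) powr q) \<partial>lborel) =
      (\<integral>\<^sup>+x. ennreal c * (\<integral>\<^sup>+l. ?L l x \<partial>lborel) \<partial>lborel)"
  proof (rule nn_integral_cong)
    fix x
    have "(\<integral>\<^sup>+l. ?L l x \<partial>lborel) = ennreal (2 / (q * (q - 1) * (q - 2)) * norm (h x) powr q)"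
      using nn_integral_layer_square[OF q, of "norm (h x)"] w0 by (simp add: w_def ennreal_mult)
    also have "ennreal c * \<dots> = ennreal (c * (2 / (q * (q - 1) * (q - 2)) * norm (h x) powr q))"
      using c by (intro ennreal_mult'[symmetric]) simp
    also have "c * (2 / (q * (q - 1) * (q - 2)) * norm (h x) powr q) = norm (h x) powr q"
      using q by (simp add: c_def)
    finally show "ennreal (norm (h x) powr q) = ennreal c * (\<integral>\<^sup>+l. ?L l x \<partial>lborel)" ..
  qed
  also have "\<dots> = ennreal c * (\<integral>\<^sup>+x. \<integral>\<^sup>+l. ?L l x \<partial>lborel \<partial>lborel)"
    by (rule nn_integral_cmult) measurable
  also have "(\<integral>\<^sup>+x. \<integral>\<^sup>+l. ?L l x \<partial>lborel \<partial>lborel) =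
      (\<integral>\<^sup>+l. \<integral>\<^sup>+x. ?L l x \<partial>lborel \<partial>lborel)"
    by (rule lborel_pair.Fubini') measurable
  also have "\<dots> \<le> (\<integral>\<^sup>+l. \<integral>\<^sup>+y. ?R l y \<partial>lborel \<partial>lborel)"
  proof (rule nn_integral_mono)
    fix l :: real
    have "(\<integral>\<^sup>+x. ?L l x \<partial>lborel) = ennreal (w l) * (\<integral>\<^sup>+x. ennreal ((max 0 (norm (h x) - l))\<^sup>2) \<partial>lborel)"
      by (rule nn_integral_cmult) measurable
    also have "\<dots> \<le> ennreal (w l) * (ennreal (A\<^sup>2) * ?S l)"
    proof (cases "l > 0")
      case True
      then show ?thesis by (intro mult_left_mono level) auto
    qed (simp add: w_def)
    also have "\<dots> = (\<integral>\<^sup>+y. ?R l y \<partial>lborel)"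
      by (subst nn_integral_cmult, measurable, subst nn_integral_cmult, measurable) (simp only: mult.left_commute)
    finally show "(\<integral>\<^sup>+x. ?L l x \<partial>lborel) \<le>
        (\<integral>\<^sup>+y. ?R l y \<partial>lborel)" .
  qed
  also have "\<dots> = (\<integral>\<^sup>+y. \<integral>\<^sup>+l. ?R l y \<partial>lborel \<partial>lborel)"
    by (rule lborel_pair.Fubini'[symmetric]) measurable
  also have "\<dots> \<le> (\<integral>\<^sup>+y. ennreal ?K * ennreal (norm (g y) powr r) \<partial>lborel)"
  proof (rule nn_integral_mono)
    fix y
    show "(\<integral>\<^sup>+l. ?R l y \<partial>lborel) \<le>
        ennreal ?K * ennreal (norm (g y) powr r)"
    proof (cases "g y = 0")
      case False
      define n where "n = norm (g y)"
      have n: "n > 0" using False by (simp add: n_def)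
      \<comment> \<open>The inverse of the height function: n <= \<gamma>(l) forces l <= T, so that
        the integral over the levels extends over a bounded interval.\<close>
      define T where "T = B * G * n powr (- (1 / (q - 1)))"
      have T: "T \<ge> 0" using BG by (simp add: T_def)
      have lT: "l \<le> T" if "l > 0" "n \<le> \<gamma> l" for l
      proof -
        have "n powr (1 / (q - 1)) \<le> \<gamma> l powr (1 / (q - 1))"
          using that n q by (intro powr_mono2) auto
        also have "\<dots> = B * G / l" using that BG q by (simp add: \<gamma>_def powr_powr)
        finally have "l * n powr (1 / (q - 1)) \<le> B * G" using that by (simp add: field_simps)
        then have "l * n powr (1 / (q - 1)) * n powr (- (1 / (q - 1))) \<le> B * G * n powr (- (1 / (q - 1)))"
          by (rule mult_right_mono) simp
        moreover have "n powr (1 / (q - 1)) * n powr (- (1 / (q - 1))) = 1"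
          using n by (simp add: powr_add[symmetric])
        ultimately show ?thesis by (simp add: T_def mult.assoc)
      qed
      have "(\<integral>\<^sup>+l. ?R l y \<partial>lborel) \<le>
          (\<integral>\<^sup>+l. ennreal (A\<^sup>2 * n\<^sup>2) * ennreal (indicator {0<..T} l * l powr (q - 3)) \<partial>lborel)"
      proof (rule nn_integral_mono)
        fix l
        show "?R l y \<le>
            ennreal (A\<^sup>2 * n\<^sup>2) * ennreal (indicator {0<..T} l * l powr (q - 3))"
        proof (cases "l > 0 \<and> n \<le> \<gamma> l")
          case True
          then show ?thesis using lT[of l]
            by (simp add: w_def n_def[symmetric] ennreal_mult[symmetric] mult_ac)
        next
          case False
          then show ?thesis by (auto simp: w_def n_def[symmetric])
        qed
      qed
      also have "\<dots> = ennreal (A\<^sup>2 * n\<^sup>2) * ennreal (T powr ((q - 3) + 1) / ((q - 3) + 1))"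
        using q T by (subst nn_integral_cmult, measurable, subst nn_integral_powr_Ioc) auto
      also have "\<dots> = ennreal (A\<^sup>2 * n\<^sup>2 * (T powr (q - 2) / (q - 2)))"
        using q by (simp add: ennreal_mult[symmetric])
      also have "A\<^sup>2 * n\<^sup>2 * (T powr (q - 2) / (q - 2)) = A\<^sup>2 * (B * G) powr (q - 2) / (q - 2) * n powr r"
      proof -
        have "n\<^sup>2 * T powr (q - 2) = (B * G) powr (q - 2) * (n powr 2 * n powr (- (1 / (q - 1)) * (q - 2)))"
          using n BG unfolding T_def by (subst powr_mult) (auto simp: powr_powr)
        also have "n powr 2 * n powr (- (1 / (q - 1)) * (q - 2)) = n powr r"
        proof -
          have "2 + - (1 / (q - 1)) * (q - 2) = r" using q by (simp add: r field_simps)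
          then show ?thesis by (simp only: powr_add[symmetric])
        qed
        finally show ?thesis by (simp add: mult.assoc)
      qed
      also have "ennreal (A\<^sup>2 * (B * G) powr (q - 2) / (q - 2) * n powr r) =
          ennreal ?K * ennreal (n powr r)"
        by (rule ennreal_mult'') simp
      finally show ?thesis by (simp only: n_def)
    qed simp
  qed
  also have "\<dots> = ennreal ?K * ?I"
    by (rule nn_integral_cmult) measurable
  finally have "(\<integral>\<^sup>+x. ennreal (norm (h x) powr q) \<partial>lborel) \<le>
      ennreal c * (ennreal ?K * ?I)"
    by (simp add: mult_left_mono)
  also have "\<dots> = ennreal (c * ?K) * ?I"
    using c by (subst ennreal_mult') (simp_all only: less_imp_le mult.assoc)
  also have "c * ?K = q * (q - 1) / 2 * A\<^sup>2 * (B * G) powr (q - 2)"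
  proof -
    have gen: "a * d * (X / d) = a * X" if "d \<noteq> 0" for a d X :: real using that by simp
    have "c = q * (q - 1) / 2 * (q - 2)" by (simp add: c_def)
    then show ?thesis using gen[of "q - 2" "q * (q - 1) / 2" "A\<^sup>2 * (B * G) powr (q - 2)"] q
      by (simp only: mult.assoc)
  qed
  finally show ?thesis .
qed

section \<open>Estimates for the symbol\<close>

text \<open>The symbol of (I - Delta)^(sigma/2) Lambda_theta(t).\<close>

definition M_symbol :: "real \<Rightarrow> real \<Rightarrow> real \<Rightarrow> real^'n::finite \<Rightarrow> real" where
  "M_symbol \<sigma> \<theta> t \<xi> = Lambda_symbol \<theta> t \<xi> * (1 + (norm \<xi>)\<^sup>2) powr (\<sigma> / 2)"

lemma S_symbol_borel [measurable]: "S_symbol t \<in> borel_measurable borel"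
  unfolding S_symbol_def[abs_def] by measurable

lemma Lambda_symbol_borel [measurable]: "Lambda_symbol \<theta> t \<in> borel_measurable borel"
  unfolding Lambda_symbol_def[abs_def] by measurable

lemma M_symbol_borel [measurable]: "M_symbol \<sigma> \<theta> t \<in> borel_measurable borel"
  unfolding M_symbol_def[abs_def] by measurable

lemma M_symbol_minus: "M_symbol \<sigma> \<theta> t (- \<xi>) = M_symbol \<sigma> \<theta> t \<xi>"
  unfolding M_symbol_def Lambda_symbol_def S_symbol_def by simp

text \<open>The prefactor of the sine is t divided by its argument, so |sin y| <= |y| leaves exactly
  t times the damping.\<close>

lemma S_symbol_bound:
  fixes \<xi> :: "real^'n::finite"
  assumes t: "t \<ge> 0"
  shows "\<bar>S_symbol t \<xi>\<bar> \<le> t * exp (- ((norm \<xi>)\<^sup>2 * t / (2 * (1 + (norm \<xi>)\<^sup>2))))"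
proof (cases "\<xi> = 0")
  case False
  define r where "r = norm \<xi>"
  define D where "D = sqrt (3 + 4 * r\<^sup>2)"
  define w where "w = 1 + r\<^sup>2"
  have r: "r > 0" using False by (simp add: r_def)
  have w: "w > 0" by (simp add: w_def add_pos_nonneg)
  have D: "D > 0" by (simp add: D_def add_pos_nonneg)
  define E where "E = exp (- (r\<^sup>2 * t / (2 * w)))"
  have "\<bar>sin (r\<^sup>2 * D * t / (2 * w))\<bar> \<le> \<bar>r\<^sup>2 * D * t / (2 * w)\<bar>" by (rule abs_sin_x_le_abs_x)
  also have "\<dots> = r\<^sup>2 * D * t / (2 * w)" using w D t by simp
  finally have s: "\<bar>sin (r\<^sup>2 * D * t / (2 * w))\<bar> \<le> r\<^sup>2 * D * t / (2 * w)" .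
  have "S_symbol t \<xi> = E * (2 * w / (r\<^sup>2 * D)) * sin (r\<^sup>2 * D * t / (2 * w))"
    using False by (simp add: S_symbol_def E_def D_def w_def r_def)
  then have "\<bar>S_symbol t \<xi>\<bar> = E * (2 * w / (r\<^sup>2 * D)) * \<bar>sin (r\<^sup>2 * D * t / (2 * w))\<bar>"
    using w D by (simp add: abs_mult E_def)
  also have "\<dots> \<le> E * (2 * w / (r\<^sup>2 * D)) * (r\<^sup>2 * D * t / (2 * w))"
    using w D by (intro mult_left_mono s) (auto simp: E_def)
  also have "\<dots> = t * E" using w D r by simp
  finally show ?thesis by (simp add: E_def w_def r_def)
qed (simp add: S_symbol_def t)

lemma power2_powr: "r > 0 \<Longrightarrow> (r\<^sup>2) powr s = r powr (2 * s)" for r s :: real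
  using powr_powr[of r 2 s] by simp

text \<open>A majorant free of theta, used to bound the symbol of Lambda_theta(t) and to absorb the
  power of |xi| into a Gaussian.\<close>

lemma powr_two_theta_le:
  assumes "0 \<le> \<theta>" "\<theta> \<le> 1" "r \<ge> (0::real)"
  shows "r powr (2 * \<theta>) \<le> 1 + r\<^sup>2"
proof (cases "r \<le> 1")
  case True
  then have "r powr (2 * \<theta>) \<le> 1" using assms by (cases "r = 0") (auto intro: powr_le1)
  then show ?thesis by (simp add: add_increasing2)
next
  case False
  then have "r powr (2 * \<theta>) \<le> r powr 2" using assms by (intro powr_mono) auto
  then show ?thesis using assms by (simp add: add_increasing)
qed

text \<open>Crude in t, but enough to make the integral that defines Lambda_theta(t) g absolutely
  convergent.\<close>

lemma Lambda_symbol_bound: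
  fixes \<xi> :: "real^'n::finite"
  assumes "0 \<le> \<theta>" "\<theta> \<le> 1" and t: "t \<ge> 0"
  shows "\<bar>Lambda_symbol \<theta> t \<xi>\<bar> \<le> t"
proof -
  define w where "w = 1 + (norm \<xi>)\<^sup>2"
  have w: "w > 0" by (simp add: w_def add_pos_nonneg)
  have "\<bar>S_symbol t \<xi>\<bar> \<le> t * exp (- ((norm \<xi>)\<^sup>2 * t / (2 * w)))"
    using S_symbol_bound[OF t, of \<xi>] by (simp add: w_def)
  also have "\<dots> \<le> t * 1" using t w by (intro mult_left_mono) auto
  finally have "\<bar>S_symbol t \<xi>\<bar> * (inverse w * norm \<xi> powr (2 * \<theta>)) \<le> t * (inverse w * w)"
    using assms w powr_two_theta_le[of \<theta> "norm \<xi>"]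
    by (intro mult_mono mult_left_mono) (auto simp: w_def)
  then show ?thesis using w by (simp add: Lambda_symbol_def w_def abs_mult mult.assoc)
qed

text \<open>For |xi| <= 1 the weight w = 1 + |xi|^2 lies between 1 and 2, so the damping is at least
  Gaussian, and sigma <= 2 makes w^(sigma/2 - 1) at most 1. No constant depending on sigma or theta
  appears.\<close>

lemma M_symbol_low:
  fixes \<xi> :: "real^'n::finite"
  assumes t: "t \<ge> 0" and \<sigma>: "\<sigma> \<le> 2" and r: "norm \<xi> \<le> 1"
  shows "\<bar>M_symbol \<sigma> \<theta> t \<xi>\<bar> \<le> t * exp (- (t * (norm \<xi>)\<^sup>2 / 4)) * norm \<xi> powr (2 * \<theta>)"
proof -
  define w where "w = 1 + (norm \<xi>)\<^sup>2"
  have w: "w \<ge> 1" "w \<le> 2" using r by (auto simp: w_def power_le_one)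
  have "(norm \<xi>)\<^sup>2 * t / 4 \<le> (norm \<xi>)\<^sup>2 * t / (2 * w)"
    using w t by (intro divide_left_mono) auto
  then have "exp (- ((norm \<xi>)\<^sup>2 * t / (2 * w))) \<le> exp (- (t * (norm \<xi>)\<^sup>2 / 4))"
    by (simp add: mult.commute)
  then have S: "\<bar>S_symbol t \<xi>\<bar> \<le> t * exp (- (t * (norm \<xi>)\<^sup>2 / 4))"
    using S_symbol_bound[OF t, of \<xi>] t by (smt (verit) mult_left_mono w_def)
  have "w powr (\<sigma> / 2 - 1) \<le> w powr 0" using w \<sigma> by (intro powr_mono) auto
  then have W: "inverse w * w powr (\<sigma> / 2) \<le> 1"
    using w by (simp add: powr_diff inverse_eq_divide)
  have "\<bar>M_symbol \<sigma> \<theta> t \<xi>\<bar> = \<bar>S_symbol t \<xi>\<bar> * norm \<xi> powr (2 * \<theta>) * (inverse w * w powr (\<sigma> / 2))"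
    using w by (simp add: M_symbol_def Lambda_symbol_def w_def abs_mult mult_ac)
  also have "\<dots> \<le> (t * exp (- (t * (norm \<xi>)\<^sup>2 / 4))) * norm \<xi> powr (2 * \<theta>) * 1"
    using w t by (intro mult_mono mult_right_mono S W mult_nonneg_nonneg) auto
  finally show ?thesis by simp
qed

lemma M_symbol_eq:
  fixes \<xi> :: "real^'n::finite"
  assumes "\<xi> \<noteq> 0"
  defines "r \<equiv> norm \<xi>" and "w \<equiv> 1 + (norm \<xi>)\<^sup>2" and "D \<equiv> sqrt (3 + 4 * (norm \<xi>)\<^sup>2)"
  shows "M_symbol \<sigma> \<theta> t \<xi> =
    2 * exp (- (r\<^sup>2 * t / (2 * w))) * sin (r\<^sup>2 * D / (2 * w) * t) * r powr (2 * \<theta> - 2) / D * w powr (\<sigma> / 2)"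
proof -
  have r: "r > 0" using assms(1) by (simp add: r_def)
  have w: "w > 0" by (simp add: w_def add_pos_nonneg)
  have D: "D > 0" by (simp add: D_def add_pos_nonneg)
  have p: "r powr (2 * \<theta> - 2) = r powr (2 * \<theta>) / r\<^sup>2"
    using r by (simp add: powr_diff)
  have "M_symbol \<sigma> \<theta> t \<xi> = exp (- (r\<^sup>2 * t / (2 * w))) * (2 * w / (r\<^sup>2 * D)) * sin (r\<^sup>2 * D * t / (2 * w)) * inverse w * r powr (2 * \<theta>) * w powr (\<sigma> / 2)"
    using assms(1) by (simp add: M_symbol_def Lambda_symbol_def S_symbol_def r_def w_def D_def)
  also have "\<dots> = 2 * exp (- (r\<^sup>2 * t / (2 * w))) * sin (r\<^sup>2 * D / (2 * w) * t) * r powr (2 * \<theta> - 2) / D * w powr (\<sigma> / 2)"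
    unfolding p using w by (simp add: inverse_eq_divide)
  finally show ?thesis .
qed

lemma abs_sin_le_powr:
  fixes u p :: real
  assumes "u > 0" "0 \<le> p" "p \<le> 1"
  shows "\<bar>sin u\<bar> \<le> u powr p"
proof (cases "u \<le> 1")
  case True
  have "\<bar>sin u\<bar> \<le> u" using abs_sin_x_le_abs_x[of u] assms by simp
  also have "u = u powr 1" using assms by simp
  also have "\<dots> \<le> u powr p" using assms True by (intro powr_mono') auto
  finally show ?thesis .
next
  case False
  then have "1 \<le> u powr p" using assms by (intro ge_one_powr_ge_zero) auto
  then show ?thesis using abs_sin_le_one[of u] by linarith
qed

text \<open>The exponent 1 - theta in the sine bound is the one for which the powers of |xi| cancel.
  Both D/(2w) and 1/D are at most w^(-1/2), and what remains is w^((sigma + theta - 2)/2), which is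
  at most 1 by the condition on sigma + theta.\<close>

lemma M_symbol_bound:
  fixes \<xi> :: "real^'n::finite"
  assumes \<theta>: "0 \<le> \<theta>" "\<theta> \<le> 1" and \<sigma>: "\<sigma> + \<theta> \<le> 2" and t: "t > 0"
  shows "\<bar>M_symbol \<sigma> \<theta> t \<xi>\<bar> \<le> 2 * t powr (1 - \<theta>)"
proof (cases "\<xi> = 0")
  case False
  define r where "r = norm \<xi>"
  define D where "D = sqrt (3 + 4 * r\<^sup>2)"
  define w where "w = 1 + r\<^sup>2"
  let ?d = "(D / (2 * w)) powr (1 - \<theta>)" and ?b = "w powr (\<sigma> / 2) / D"
  have r: "r > 0" using False by (simp add: r_def)
  have w: "w \<ge> 1" "w > 0" by (auto simp: w_def add_pos_nonneg)
  have D: "D > 0" by (simp add: D_def add_pos_nonneg)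
  define E where "E = exp (- (r\<^sup>2 * t / (2 * w)))"
  have E: "0 \<le> E" "E \<le> 1" using w t by (auto simp: E_def)
  define \<phi> where "\<phi> = r\<^sup>2 * D / (2 * w)"
  have \<phi>: "\<phi> > 0" using r w D by (simp add: \<phi>_def)
  have M: "\<bar>M_symbol \<sigma> \<theta> t \<xi>\<bar> = 2 * (E * (\<bar>sin (\<phi> * t)\<bar> * (r powr (2 * \<theta> - 2) * ?b)))"
    unfolding M_symbol_eq[OF False] using D
    by (simp add: abs_mult E_def w_def r_def D_def \<phi>_def)
  have "\<bar>sin (\<phi> * t)\<bar> \<le> (\<phi> * t) powr (1 - \<theta>)"
    using \<phi> t \<theta> by (intro abs_sin_le_powr) auto
  also have "\<dots> = t powr (1 - \<theta>) * (r powr (2 - 2 * \<theta>) * ?d)"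
  proof -
    have "\<phi> powr (1 - \<theta>) = (r\<^sup>2) powr (1 - \<theta>) * ?d"
      unfolding \<phi>_def times_divide_eq_right[symmetric] by (rule powr_mult)
    also have "(r\<^sup>2) powr (1 - \<theta>) = r powr (2 - 2 * \<theta>)"
      using r by (simp add: power2_powr right_diff_distrib)
    finally show ?thesis using \<phi> t by (simp add: powr_mult mult.commute)
  qed
  finally have s: "\<bar>sin (\<phi> * t)\<bar> \<le> t powr (1 - \<theta>) * (r powr (2 - 2 * \<theta>) * ?d)" .
  have D2: "D / (2 * w) \<le> w powr (- (1 / 2))"
  proof -
    have "D \<le> sqrt (4 * w)" unfolding D_def w_def by (rule real_sqrt_le_mono) simp
    also have "\<dots> = 2 * sqrt w" by (simp add: real_sqrt_mult)
    finally have "D / (2 * w) \<le> sqrt w / w" using w by (simp add: field_simps)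
    also have "sqrt w / w = w powr (1 / 2 - 1)" unfolding powr_diff using w by (simp add: powr_half_sqrt)
    finally show ?thesis by simp
  qed
  have D1: "1 / D \<le> w powr (- (1 / 2))"
  proof -
    have "sqrt w \<le> D" unfolding D_def w_def by (rule real_sqrt_le_mono) (use zero_le_power2[of r] in linarith)
    then have "1 / D \<le> 1 / sqrt w" using w D by (intro divide_left_mono mult_pos_pos) auto
    also have "\<dots> = w powr (- (1 / 2))" using w by (simp add: powr_minus powr_half_sqrt inverse_eq_divide)
    finally show ?thesis .
  qed
  have "?d \<le> (w powr (- (1 / 2))) powr (1 - \<theta>)"
    using D w \<theta> D2 by (intro powr_mono2) auto
  then have "?d * (w powr (\<sigma> / 2) * (1 / D)) \<le>
      (w powr (- (1 / 2))) powr (1 - \<theta>) * (w powr (\<sigma> / 2) * w powr (- (1 / 2)))"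
    using D1 D by (intro mult_mono mult_left_mono) auto
  also have "\<dots> = w powr ((\<sigma> + \<theta> - 2) / 2)"
  proof -
    have "- (1 / 2) * (1 - \<theta>) + (\<sigma> / 2 + - (1 / 2)) = (\<sigma> + \<theta> - 2) / 2" by (simp add: field_simps)
    then show ?thesis by (simp only: powr_powr powr_add[symmetric])
  qed
  also have "\<dots> \<le> w powr 0" using w \<sigma> by (intro powr_mono) auto
  also have "w powr 0 = 1" using w by simp
  finally have W: "?d * ?b \<le> 1" by simp
  have "\<bar>sin (\<phi> * t)\<bar> * (r powr (2 * \<theta> - 2) * ?b) \<le>
      (t powr (1 - \<theta>) * (r powr (2 - 2 * \<theta>) * ?d)) * (r powr (2 * \<theta> - 2) * ?b)"
    using D by (intro mult_right_mono s) auto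
  also have "\<dots> = t powr (1 - \<theta>) * ((r powr (2 - 2 * \<theta>) * r powr (2 * \<theta> - 2)) * (?d * ?b))"
    by (simp only: mult_ac)
  also have "r powr (2 - 2 * \<theta>) * r powr (2 * \<theta> - 2) = 1" using r by (simp add: powr_add[symmetric])
  also have "t powr (1 - \<theta>) * (1 * (?d * ?b)) \<le> t powr (1 - \<theta>) * (1 * 1)"
    by (intro mult_left_mono W) auto
  finally have X: "\<bar>sin (\<phi> * t)\<bar> * (r powr (2 * \<theta> - 2) * ?b) \<le> t powr (1 - \<theta>) * (1 * 1)" .
  have "E * (\<bar>sin (\<phi> * t)\<bar> * (r powr (2 * \<theta> - 2) * ?b)) \<le> 1 * (t powr (1 - \<theta>) * (1 * 1))"
    by (rule mult_mono[OF E(2) X]) (use D in auto)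
  then show ?thesis unfolding M by simp
qed (simp add: M_symbol_def Lambda_symbol_def)

lemma abs_exp_minus_one_le: "\<bar>exp x - 1\<bar> \<le> \<bar>x\<bar> * exp \<bar>x\<bar>" for x :: real
proof (cases "x \<ge> 0")
  case True
  have "1 - x \<le> exp (- x)" using exp_ge_add_one_self[of "- x"] by simp
  then have "(1 - x) * exp x \<le> exp (- x) * exp x" by (rule mult_right_mono) simp
  then have "(1 - x) * exp x \<le> 1" by (simp add: exp_add[symmetric])
  then show ?thesis using True by (simp add: algebra_simps)
next
  case False
  have "1 - exp x \<le> - x" using exp_ge_add_one_self[of x] by linarith
  moreover have "\<bar>x\<bar> * 1 \<le> \<bar>x\<bar> * exp \<bar>x\<bar>" by (intro mult_left_mono) auto
  moreover have "\<bar>exp x - 1\<bar> = 1 - exp x" "\<bar>x\<bar> = - x" using False by auto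
  ultimately show ?thesis by linarith
qed

text \<open>The constant depends on the exponent s alone; with s = sigma/2 it keeps the
  high-frequency error uniform in theta and t.\<close>

lemma powr_one_plus_bound:
  assumes "0 \<le> u" "u \<le> (1::real)"
  shows "\<bar>(1 + u) powr s - 1\<bar> \<le> \<bar>s\<bar> * exp \<bar>s\<bar> * u"
proof -
  have l: "0 \<le> ln (1 + u)" "ln (1 + u) \<le> u" using assms ln_add_one_self_le_self[of u] by auto
  then have "\<bar>s * ln (1 + u)\<bar> \<le> \<bar>s\<bar> * u" by (simp add: abs_mult mult_left_mono)
  moreover have "\<bar>s\<bar> * u \<le> \<bar>s\<bar> * 1" using assms by (intro mult_left_mono) auto
  ultimately have "\<bar>s * ln (1 + u)\<bar> * exp \<bar>s * ln (1 + u)\<bar> \<le> (\<bar>s\<bar> * u) * exp \<bar>s\<bar>"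
    using assms by (intro mult_mono) auto
  moreover have "(1 + u) powr s = exp (s * ln (1 + u))" using assms by (simp add: powr_def)
  ultimately show ?thesis using abs_exp_minus_one_le[of "s * ln (1 + u)"] by (simp add: mult_ac)
qed

text \<open>At high frequencies the symbol is \<open>e\<^bsup>-t/2\<^esup> sin(t|\<xi>|) |\<xi>|\<^bsup>\<sigma>+2\<theta>-3\<^esup>\<close> up to a relative error
  \<open>O(1/|\<xi>|)\<close>. The main term is barely integrable when \<open>\<theta>\<close> approaches \<open>(3-n-\<sigma>)/2\<close>, so that
  uniformity in \<open>\<theta>\<close> has to come from its oscillation.\<close>

lemma M_symbol_high:
  fixes \<xi> :: "real^'n::finite"
  assumes r1: "norm \<xi> \<ge> 1" and t: "t \<ge> 0"
  shows "\<bar>M_symbol \<sigma> \<theta> t \<xi> - exp (- t / 2) * sin (t * norm \<xi>) * norm \<xi> powr (\<sigma> + 2 * \<theta> - 3)\<bar>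
    \<le> (\<bar>\<sigma>\<bar> * exp \<bar>\<sigma>\<bar> + 3) * (1 + t) * exp (- t / 4) * norm \<xi> powr (\<sigma> + 2 * \<theta> - 4)"
proof -
  define r where "r = norm \<xi>"
  define D where "D = sqrt (3 + 4 * r\<^sup>2)"
  define w where "w = 1 + r\<^sup>2"
  \<comment> \<open>Everything is expanded in u = 1/r^2: w = r^2 (1 + u), D = 2 r Q with Q = sqrt(1
    + 3u/4), and the phase is \<phi> = r Q / (1 + u). At u = 0 the main term remains.\<close>
  define u where "u = 1 / r\<^sup>2"
  define Q where "Q = sqrt (1 + 3 * u / 4)"
  define P where "P = (1 + u) powr (\<sigma> / 2)"
  define E where "E = exp (- (r\<^sup>2 * t / (2 * w)))"
  define E0 where "E0 = exp (- t / 2)"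
  \<comment> \<open>A common majorant of both damping factors \<open>E\<close> and
    \<open>E0\<close>: since w <= 2 r^2, the exponent r^2 t / (2w) is at least t/4.\<close>
  define e where "e = exp (- t / 4)"
  define \<phi> where "\<phi> = r\<^sup>2 * D / (2 * w)"
  define \<rho> where "\<rho> = \<sigma> + 2 * \<theta> - 3"
  define K where "K = \<bar>\<sigma> / 2\<bar> * exp \<bar>\<sigma> / 2\<bar>"
  have r: "r \<ge> 1" "r > 0" using r1 by (auto simp: r_def)
  have r2: "r\<^sup>2 \<ge> 1" using r by (simp add: one_le_power)
  have nz: "\<xi> \<noteq> 0" using r1 by auto
  have w: "w > 0" "w \<ge> r\<^sup>2" "w \<le> 2 * r\<^sup>2" using r2 by (auto simp: w_def)
  have u: "0 < u" "u \<le> 1" "u \<le> 1 / r"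
    using r r2 self_le_power[of r 2] by (auto simp: u_def field_simps intro!: divide_left_mono)
  have ur: "r\<^sup>2 * u = 1" using r by (simp add: u_def)
  have Q: "1 \<le> Q" "Q \<le> 1 + u"
  proof -
    show "1 \<le> Q" using u by (simp add: Q_def)
    have "1 + 3 * u / 4 \<le> (1 + u)\<^sup>2" using u by (simp add: power2_eq_square algebra_simps)
    then have "Q \<le> sqrt ((1 + u)\<^sup>2)" unfolding Q_def by (rule real_sqrt_le_mono)
    then show "Q \<le> 1 + u" using u by simp
  qed
  have D: "D = 2 * r * Q"
  proof -
    have "3 + 4 * r\<^sup>2 = (2 * r)\<^sup>2 * (1 + 3 * u / 4)" using ur by (simp add: power2_eq_square algebra_simps)
    then show ?thesis unfolding D_def Q_def using r by (simp add: real_sqrt_mult)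
  qed
  have wr: "w = r\<^sup>2 * (1 + u)" using ur by (simp add: w_def algebra_simps)
  have wp: "w powr (\<sigma> / 2) = r powr \<sigma> * P"
    unfolding wr P_def using r u
    by (simp add: powr_mult power2_powr)
  have \<phi>: "\<phi> = r * (Q / (1 + u))"
  proof -
    have "a * (2 * r * Q) / (2 * (a * c)) = r * (Q / c)" if "a \<noteq> 0" for a c using that by simp
    moreover have "r\<^sup>2 \<noteq> 0" using r by simp
    ultimately show ?thesis unfolding \<phi>_def D wr by blast
  qed
  have M: "M_symbol \<sigma> \<theta> t \<xi> = r powr \<rho> * (E * sin (\<phi> * t) * (P / Q))"
  proof -
    have rr: "r powr (2 * \<theta> - 2) / r * r powr \<sigma> = r powr \<rho>"
    proof -
      have "r powr (2 * \<theta> - 2) / r = r powr (2 * \<theta> - 2 - 1)" using powr_diff[of r "2 * \<theta> - 2" 1] r by simp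
      moreover have "2 * \<theta> - 2 - 1 + \<sigma> = \<rho>" by (simp add: \<rho>_def)
      ultimately show ?thesis by (simp only: powr_add[symmetric])
    qed
    have "M_symbol \<sigma> \<theta> t \<xi> = 2 * E * sin (\<phi> * t) * r powr (2 * \<theta> - 2) / D * w powr (\<sigma> / 2)"
      unfolding M_symbol_eq[OF nz] by (simp add: E_def w_def r_def D_def \<phi>_def)
    also have "\<dots> = (r powr (2 * \<theta> - 2) / r * r powr \<sigma>) * (E * sin (\<phi> * t) * (P / Q))"
      unfolding wp D using r Q by (simp add: field_simps)
    finally show ?thesis unfolding rr .
  qed
  have e: "e \<ge> 0" by (simp add: e_def)
  have Ee: "0 \<le> E" "E \<le> e"
  proof -
    have "t / 4 \<le> r\<^sup>2 * t / (2 * w)"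
    proof -
      have "t * (2 * w) \<le> t * (4 * r\<^sup>2)" using w t by (intro mult_left_mono) auto
      then show ?thesis using w by (simp add: field_simps)
    qed
    then show "E \<le> e" by (simp add: E_def e_def)
  qed (simp add: E_def)
  have E0e: "0 \<le> E0" "E0 \<le> e" using t by (auto simp: E0_def e_def)
  have EE0: "\<bar>E - E0\<bar> \<le> e * (t * u)"
  proof -
    have "E0 = E * exp (- (t / (2 * w)))"
    proof -
      have "r\<^sup>2 * t / (2 * w) + t / (2 * w) = w * t / (2 * w)"
        unfolding add_divide_distrib[symmetric] by (simp add: w_def algebra_simps)
      then have "r\<^sup>2 * t / (2 * w) + t / (2 * w) = t / 2" using w by simp
      then show ?thesis by (simp add: E_def E0_def exp_add[symmetric])
    qed
    then have "E - E0 = E * (1 - exp (- (t / (2 * w))))" by (simp add: algebra_simps)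
    moreover have x: "0 \<le> 1 - exp (- (t / (2 * w)))" "1 - exp (- (t / (2 * w))) \<le> t / (2 * w)"
      using exp_ge_add_one_self[of "- (t / (2 * w))"] w t by auto
    ultimately have "\<bar>E - E0\<bar> = E * (1 - exp (- (t / (2 * w))))" using Ee by (simp add: abs_mult)
    also have "\<dots> \<le> e * (t * u)"
    proof (intro mult_mono Ee e x)
      have "t / (2 * w) \<le> t / r\<^sup>2" using w r t by (intro divide_left_mono) auto
      then show "1 - exp (- (t / (2 * w))) \<le> t * u" using x by (simp add: u_def)
    qed
    finally show ?thesis .
  qed
  have PQ: "\<bar>P / Q - 1\<bar> \<le> (K + 1) * u"
  proof -
    have "\<bar>P - 1\<bar> \<le> K * u" unfolding P_def K_def using u by (intro powr_one_plus_bound) auto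
    then have "\<bar>P - Q\<bar> \<le> (K + 1) * u" using Q by (simp add: distrib_right)
    moreover have "\<bar>P / Q - 1\<bar> = \<bar>P - Q\<bar> / Q"
    proof -
      have "P / Q - 1 = (P - Q) / Q" using Q by (simp add: diff_divide_distrib)
      then show ?thesis using Q by simp
    qed
    moreover have "\<bar>P - Q\<bar> / Q \<le> \<bar>P - Q\<bar> / 1" using Q by (intro divide_left_mono) auto
    ultimately show ?thesis by (metis div_by_1 order_trans)
  qed
  \<comment> \<open>The phase error is the dominant one: \<phi> - r is only bounded by 1/r, whereas
    amplitude and damping deviate by multiples of u = 1/r^2.\<close>
  have ss: "\<bar>sin (\<phi> * t) - sin (t * r)\<bar> \<le> t * (1 / r)"
  proof -
    have "\<bar>sin (\<phi> * t) - sin (t * r)\<bar> \<le> \<bar>\<phi> * t - t * r\<bar>"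
    proof -
      have "sin a - sin b = 2 * sin ((a - b) / 2) * cos ((a + b) / 2)" for a b :: real
        by (rule sin_diff_sin)
      then have "\<bar>sin (\<phi> * t) - sin (t * r)\<bar> = 2 * (\<bar>sin ((\<phi> * t - t * r) / 2)\<bar> * \<bar>cos ((\<phi> * t + t * r) / 2)\<bar>)"
        by (simp add: abs_mult)
      also have "\<dots> \<le> 2 * (\<bar>(\<phi> * t - t * r) / 2\<bar> * 1)"
        by (intro mult_left_mono mult_mono abs_sin_x_le_abs_x abs_cos_le_one) auto
      finally show ?thesis by simp
    qed
    also have "\<dots> = t * \<bar>\<phi> - r\<bar>"
    proof -
      have "\<phi> * t - t * r = t * (\<phi> - r)" by (simp add: algebra_simps)
      then show ?thesis using t by (simp add: abs_mult)
    qed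
    also have "\<bar>\<phi> - r\<bar> \<le> 1 / r"
    proof -
      have "\<phi> - r = r * ((Q - (1 + u)) / (1 + u))" unfolding \<phi> using u by (simp add: field_simps)
      then have "\<bar>\<phi> - r\<bar> = r * (\<bar>Q - (1 + u)\<bar> / (1 + u))" using r u by (simp add: abs_mult)
      also have "\<dots> \<le> r * (u / 1)" using r u Q by (intro mult_left_mono frac_le) auto
      also have "\<dots> = 1 / r" using r by (simp add: u_def power2_eq_square)
      finally show ?thesis .
    qed
    finally show ?thesis using t by (simp add: mult_left_mono)
  qed
  have K0: "K \<ge> 0" by (simp add: K_def)
  \<comment> \<open>Amplitude, damping and phase are replaced by their limits one after the
    other.\<close>
  have "E * sin (\<phi> * t) * (P / Q) - E0 * sin (t * r) =
      E * sin (\<phi> * t) * (P / Q - 1) + (E - E0) * sin (\<phi> * t) + E0 * (sin (\<phi> * t) - sin (t * r))"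
    by (simp add: algebra_simps)
  also have "\<bar>\<dots>\<bar> \<le> \<bar>E * sin (\<phi> * t) * (P / Q - 1)\<bar> + \<bar>(E - E0) * sin (\<phi> * t)\<bar> + \<bar>E0 * (sin (\<phi> * t) - sin (t * r))\<bar>"
    by (rule order_trans[OF abs_triangle_ineq add_right_mono[OF abs_triangle_ineq]])
  also have "\<bar>E * sin (\<phi> * t) * (P / Q - 1)\<bar> \<le> e * 1 * ((K + 1) * u)"
    unfolding abs_mult using Ee e PQ by (intro mult_mono abs_sin_le_one) auto
  also have "\<bar>(E - E0) * sin (\<phi> * t)\<bar> \<le> e * (t * u) * 1"
    unfolding abs_mult using EE0 e t u by (intro mult_mono abs_sin_le_one) auto
  also have "\<bar>E0 * (sin (\<phi> * t) - sin (t * r))\<bar> \<le> e * (t * (1 / r))"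
    unfolding abs_mult using E0e e ss by (intro mult_mono) auto
  finally have "\<bar>E * sin (\<phi> * t) * (P / Q) - E0 * sin (t * r)\<bar> \<le> e * ((K + 1) * u + t * u + t * (1 / r))"
    by (simp add: algebra_simps)
  also have "\<dots> \<le> e * ((K + 1) * (1 / r) + t * (1 / r) + t * (1 / r))"
    using e K0 t u by (intro mult_left_mono add_mono) auto
  also have "\<dots> = e * (1 / r) * (K + 1 + 2 * t)"
  proof -
    have "e * ((K + 1) * v + t * v + t * v) = e * v * (K + 1 + 2 * t)" for v by (simp add: algebra_simps)
    then show ?thesis .
  qed
  also have "\<dots> \<le> e * (1 / r) * ((\<bar>\<sigma>\<bar> * exp \<bar>\<sigma>\<bar> + 3) * (1 + t))"
  proof (intro mult_left_mono)
    have "K \<le> \<bar>\<sigma>\<bar> * exp \<bar>\<sigma>\<bar>" unfolding K_def by (intro mult_mono) auto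
    moreover have "(K + 3) * (1 + t) = K + 3 + (K * t + 3 * t)" by (simp add: algebra_simps)
    moreover have "K * t \<ge> 0" using K0 t by simp
    ultimately have "K + 1 + 2 * t \<le> (K + 3) * (1 + t)" using t by linarith
    also have "\<dots> \<le> (\<bar>\<sigma>\<bar> * exp \<bar>\<sigma>\<bar> + 3) * (1 + t)"
      using \<open>K \<le> \<bar>\<sigma>\<bar> * exp \<bar>\<sigma>\<bar>\<close> t by (intro mult_right_mono) auto
    finally show "K + 1 + 2 * t \<le> (\<bar>\<sigma>\<bar> * exp \<bar>\<sigma>\<bar> + 3) * (1 + t)" .
  qed (use e r in auto)
  finally have "r powr \<rho> * \<bar>E * sin (\<phi> * t) * (P / Q) - E0 * sin (t * r)\<bar> \<le> r powr \<rho> * (e * (1 / r) * ((\<bar>\<sigma>\<bar> * exp \<bar>\<sigma>\<bar> + 3) * (1 + t)))"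
    by (rule mult_left_mono) simp
  also have "\<dots> = (\<bar>\<sigma>\<bar> * exp \<bar>\<sigma>\<bar> + 3) * (1 + t) * e * (r powr \<rho> / r)" by (simp add: mult_ac)
  also have "r powr \<rho> / r = r powr (\<sigma> + 2 * \<theta> - 4)"
  proof -
    have "\<sigma> + 2 * \<theta> - 4 = \<rho> - 1" by (simp add: \<rho>_def)
    then show ?thesis using r by (simp only: powr_diff) simp
  qed
  also have "r powr \<rho> * \<bar>E * sin (\<phi> * t) * (P / Q) - E0 * sin (t * r)\<bar> =
      \<bar>M_symbol \<sigma> \<theta> t \<xi> - E0 * sin (t * r) * r powr \<rho>\<bar>"
  proof -
    have "M_symbol \<sigma> \<theta> t \<xi> - E0 * sin (t * r) * r powr \<rho> = r powr \<rho> * (E * sin (\<phi> * t) * (P / Q) - E0 * sin (t * r))"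
      unfolding M by (simp add: algebra_simps)
    then show ?thesis by (simp add: abs_mult)
  qed
  finally show ?thesis by (simp add: r_def E0_def e_def \<rho>_def)
qed

section \<open>The convolution kernel\<close>

lemma integral_gauss_scaled:
  assumes c: "c > 0"
  shows "(LINT x|lborel. gauss c (x::'a::euclidean_space)) = (sqrt (2 * pi) / c) ^ DIM('a)"
proof -
  have "sqrt (2 * pi) ^ DIM('a) = (LINT x|lborel. gauss 1 (x::'a))" by (rule integral_gauss[symmetric])
  also have "\<dots> = \<bar>c\<bar> ^ DIM('a) *\<^sub>R (LINT x|lborel. gauss 1 (0 + c *\<^sub>R (x::'a)))"
    using c by (intro lborel_integral_affine) simp
  also have "(LINT x|lborel. gauss 1 (0 + c *\<^sub>R (x::'a))) = (LINT x|lborel. gauss c (x::'a))"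
    by (simp add: gauss_def)
  finally show ?thesis using c by (simp add: power_divide field_simps)
qed

text \<open>With d = 4m, the m-th power of 1 + t <= d exp(t/d) has the exponent t/4.\<close>

lemma exp_poly_bound:
  assumes "t \<ge> 0" "m > 0"
  shows "(1 + t) ^ m * exp (- t / 4) \<le> (4 * real m) ^ m"
proof -
  define d where "d = 4 * real m"
  have d: "d \<ge> 1" "d > 0" using assms by (auto simp: d_def)
  have "1 + t / d \<le> exp (t / d)" by (rule exp_ge_add_one_self)
  then have "d * (1 + t / d) \<le> d * exp (t / d)" using d by (intro mult_left_mono) auto
  then have "d + t \<le> d * exp (t / d)" using d by (simp add: distrib_left)
  then have "1 + t \<le> d * exp (t / d)" using d by linarith
  then have "(1 + t) ^ m \<le> (d * exp (t / d)) ^ m" using assms by (intro power_mono) auto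
  also have "\<dots> = d ^ m * exp (real m * (t / d))" by (simp only: power_mult_distrib exp_of_nat_mult)
  also have "real m * (t / d) = t / 4" using assms by (simp add: d_def)
  finally have "(1 + t) ^ m * exp (- t / 4) \<le> d ^ m * exp (t / 4) * exp (- t / 4)"
    by (rule mult_right_mono) simp
  also have "\<dots> = d ^ m" by (simp add: mult.assoc exp_add[symmetric])
  finally show ?thesis by (simp add: d_def)
qed

text \<open>Exponential decay is traded for a negative power of t. As k >= 0, this also holds near t
  = 0, and the constant depends on n only, uniformly in k <= n.\<close>

lemma decay_to_powr:
  assumes t: "t > 0" and k: "0 \<le> k" "k \<le> real n"
  shows "(1 + t) * exp (- t / 4) \<le> (4 * real (n + 1)) ^ (n + 1) * t powr (- k)"
proof -
  have "t powr k \<le> (1 + t) powr k" using t k by (intro powr_mono2) auto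
  also have "\<dots> \<le> (1 + t) powr real n" using t k by (intro powr_mono) auto
  also have "\<dots> = (1 + t) ^ n" using t by (simp add: powr_realpow)
  finally have "t powr k * ((1 + t) * exp (- t / 4)) \<le> (1 + t) ^ n * ((1 + t) * exp (- t / 4))"
    using t by (intro mult_right_mono) auto
  also have "\<dots> = (1 + t) ^ (n + 1) * exp (- t / 4)" by (simp add: mult_ac)
  also have "\<dots> \<le> (4 * real (n + 1)) ^ (n + 1)" using t by (intro exp_poly_bound) auto
  finally have "t powr (- k) * (t powr k * ((1 + t) * exp (- t / 4))) \<le> t powr (- k) * (4 * real (n + 1)) ^ (n + 1)"
    by (rule mult_left_mono) simp
  moreover have "t powr (- k) * (t powr k * ((1 + t) * exp (- t / 4))) = (1 + t) * exp (- t / 4)"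
  proof -
    have "t powr (- k) * t powr k = 1" using t by (simp add: powr_add[symmetric])
    then show ?thesis by (simp only: mult.assoc[symmetric] mult_1_left)
  qed
  ultimately show ?thesis by (simp only: mult.commute)
qed

text \<open>In the scaled variable y = sqrt(t) |xi|, half of the Gaussian exponent absorbs the
  power, by y^(2 theta) <= 1 + y^2 <= 8 exp(y^2/8). The other half is
  \<open>gauss (sqrt t / 2)\<close>, whose integral produces t^(-n/2).\<close>

lemma low_frequency_gauss:
  fixes \<xi> :: "'a::euclidean_space"
  assumes t: "t > 0" and \<theta>: "0 \<le> \<theta>" "\<theta> \<le> 1"
  shows "t * exp (- (t * (norm \<xi>)\<^sup>2 / 4)) * norm \<xi> powr (2 * \<theta>) \<le> 8 * t powr (1 - \<theta>) * gauss (sqrt t / 2) \<xi>"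
proof -
  define y where "y = sqrt t * norm \<xi>"
  have y: "y \<ge> 0" "y\<^sup>2 = t * (norm \<xi>)\<^sup>2" using t by (auto simp: y_def power_mult_distrib)
  have "y powr (2 * \<theta>) = t powr \<theta> * norm \<xi> powr (2 * \<theta>)"
    using t by (simp add: y_def powr_mult powr_half_sqrt[symmetric] powr_powr)
  then have e: "t * norm \<xi> powr (2 * \<theta>) = t powr (1 - \<theta>) * y powr (2 * \<theta>)"
    using t by (simp add: powr_diff)
  have "1 + y\<^sup>2 / 8 \<le> exp (y\<^sup>2 / 8)" by (rule exp_ge_add_one_self)
  then have "1 + y\<^sup>2 \<le> 8 * exp (y\<^sup>2 / 8)" by linarith
  then have "y powr (2 * \<theta>) \<le> 8 * exp (y\<^sup>2 / 8)"
    using powr_two_theta_le[OF \<theta> y(1)] by linarith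
  then have "t powr (1 - \<theta>) * y powr (2 * \<theta>) * exp (- (y\<^sup>2 / 4)) \<le> t powr (1 - \<theta>) * (8 * exp (y\<^sup>2 / 8)) * exp (- (y\<^sup>2 / 4))"
    by (intro mult_right_mono mult_left_mono) auto
  also have "\<dots> = 8 * t powr (1 - \<theta>) * (exp (y\<^sup>2 / 8) * exp (- (y\<^sup>2 / 4)))" by simp
  also have "exp (y\<^sup>2 / 8) * exp (- (y\<^sup>2 / 4)) = gauss (sqrt t / 2) \<xi>"
    unfolding exp_add[symmetric] gauss_def using t y(2) by (simp add: power_mult_distrib power_divide)
  finally show ?thesis unfolding e[symmetric] y(2) by (simp add: mult_ac)
qed

text \<open>The constant is chosen before theta and t. The low frequencies have the exact scaling
  t^(1-theta-n/2); the remaining parts decay exponentially in t and are converted to that power,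
  which is where 1 <= theta + n/2 is used.\<close>

lemma M_symbol_kernel:
  "\<exists>C>0. \<forall>\<theta> t. 0 \<le> \<theta> \<longrightarrow> \<theta> \<le> 1 \<longrightarrow> 1 \<le> \<theta> + real CARD('n) / 2 \<longrightarrow> \<sigma> < 3 - real CARD('n) - 2 * \<theta> \<longrightarrow> t > 0 \<longrightarrow>
    integrable lborel (M_symbol \<sigma> \<theta> t :: real^'n::finite \<Rightarrow> real) \<and>
    (\<forall>x :: real^'n. \<bar>LINT \<xi>|lborel. M_symbol \<sigma> \<theta> t \<xi> * cos (x \<bullet> \<xi>)\<bar> \<le> C * t powr (1 - \<theta> - real CARD('n) / 2))"
proof -
  let ?I = "\<lambda>(f :: real^'n \<Rightarrow> real) x. LINT \<xi>|lborel. f \<xi> * cos (x \<bullet> \<xi>)"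
  define n where "n = CARD('n)"
  define K where "K = \<bar>\<sigma>\<bar> * exp \<bar>\<sigma>\<bar> + 3"
  define tl where "tl \<xi> = indicator {1..} (norm \<xi>) * norm \<xi> powr (- real n - 1)" for \<xi> :: "real^'n"
  define J where "J = (LINT \<xi>|lborel. tl \<xi>)"
  define V where "V = 3 * measure lborel (cball (0::real^'n) 2) / ln 2"
  define L where "L = 8 * (2 * sqrt (2 * pi)) ^ n"
  define H where "H = (4 * real (n + 1)) ^ (n + 1)"
  have K0: "K \<ge> 0" by (simp add: K_def)
  have tl: "integrable lborel tl"
    using integrable_norm_powr_tail[of 1, where 'a="real^'n"] by (simp add: tl_def[abs_def] n_def)
  have J0: "J \<ge> 0" unfolding J_def by (intro integral_nonneg_AE) (auto simp: tl_def)
  have V0: "V \<ge> 0" by (simp add: V_def)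
  have L0: "L > 0" by (simp add: L_def)
  have H0: "H > 0" by (simp add: H_def)
  \<comment> \<open>\<open>L\<close> comes from the Gaussian majorant at low frequencies,
    \<open>K * J\<close> from the high-frequency error, \<open>V\<close> from the oscillatory main
    term; \<open>H\<close> converts (1 + t) e^(-t/4) into a power of t.\<close>
  define C where "C = L + (K * J + V) * H"
  have C0: "C > 0" using L0 H0 K0 J0 V0 by (auto simp: C_def intro!: add_pos_nonneg)
  have main: "integrable lborel (M_symbol \<sigma> \<theta> t :: real^'n \<Rightarrow> real) \<and>
    (\<forall>x :: real^'n. \<bar>LINT \<xi>|lborel. M_symbol \<sigma> \<theta> t \<xi> * cos (x \<bullet> \<xi>)\<bar> \<le> C * t powr (1 - \<theta> - real n / 2))"
    if \<theta>: "0 \<le> \<theta>" "\<theta> \<le> 1" "1 \<le> \<theta> + real n / 2" and \<sigma>: "\<sigma> < 3 - real n - 2 * \<theta>" and t: "t > 0" for \<theta> t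
  proof -
    have n1: "n \<ge> 1" by (simp add: n_def Suc_leI)
    let ?t = "t powr (1 - \<theta> - real n / 2)" and ?e = "(1 + t) * exp (- t / 4)"
    have \<sigma>2: "\<sigma> \<le> 2" using \<sigma> \<theta> n1 by linarith
    define \<epsilon> where "\<epsilon> = 3 - real n - 2 * \<theta> - \<sigma>"
    have \<epsilon>: "\<epsilon> > 0" using \<sigma> by (simp add: \<epsilon>_def)
    let ?M = "M_symbol \<sigma> \<theta> t :: real^'n \<Rightarrow> real"
    define osc where "osc \<xi> = indicator {1..} (norm \<xi>) * norm \<xi> powr (- real n - \<epsilon>) * sin (t * norm \<xi>)" for \<xi> :: "real^'n"
    define lo where "lo \<xi> = indicator {..<1} (norm \<xi>) * ?M \<xi>" for \<xi>
    define hi where "hi \<xi> = indicator {1..} (norm \<xi>) * (?M \<xi> - exp (- t / 2) * sin (t * norm \<xi>) * norm \<xi> powr (\<sigma> + 2 * \<theta> - 3))" for \<xi>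
    have [measurable]: "osc \<in> borel_measurable borel" "lo \<in> borel_measurable borel" "hi \<in> borel_measurable borel"
      unfolding osc_def[abs_def] lo_def[abs_def] hi_def[abs_def] by measurable
    have split: "?M \<xi> = lo \<xi> + hi \<xi> + exp (- t / 2) * osc \<xi>" for \<xi>
    proof -
      have "\<sigma> + 2 * \<theta> - 3 = - real n - \<epsilon>" by (simp add: \<epsilon>_def)
      then show ?thesis by (auto simp: lo_def hi_def osc_def indicator_def)
    qed
    define gl where "gl \<xi> = 8 * t powr (1 - \<theta>) * gauss (sqrt t / 2) \<xi>" for \<xi> :: "real^'n"
    have gli: "integrable lborel gl"
      unfolding gl_def[abs_def] using t by (intro integrable_mult_right integrable_gauss) simp
    have glv: "(LINT \<xi>|lborel. gl \<xi>) = L * ?t"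
    proof -
      have "(LINT \<xi>|lborel. gl \<xi>) = 8 * t powr (1 - \<theta>) * (sqrt (2 * pi) / (sqrt t / 2)) ^ n"
        unfolding gl_def using t by (simp add: integral_gauss_scaled n_def)
      also have "sqrt (2 * pi) / (sqrt t / 2) = (2 * sqrt (2 * pi)) * inverse (sqrt t)"
        by (simp add: field_simps)
      also have "\<dots> ^ n = (2 * sqrt (2 * pi)) ^ n * inverse (sqrt t ^ n)"
        by (simp only: power_mult_distrib power_inverse)
      also have "sqrt t ^ n = t powr (real n / 2)"
        using t by (simp add: powr_realpow[symmetric] powr_half_sqrt[symmetric] powr_powr)
      also have "8 * t powr (1 - \<theta>) * ((2 * sqrt (2 * pi)) ^ n * inverse (t powr (real n / 2))) =
          L * (t powr (1 - \<theta>) / t powr (real n / 2))"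
        unfolding L_def divide_inverse by (simp only: mult_ac)
      also have "t powr (1 - \<theta>) / t powr (real n / 2) = ?t"
        by (rule powr_diff[symmetric])
      finally show ?thesis .
    qed
    have lob: "\<bar>lo \<xi>\<bar> \<le> gl \<xi>" for \<xi>
    proof (cases "norm \<xi> < 1")
      case True
      then have "\<bar>lo \<xi>\<bar> = \<bar>?M \<xi>\<bar>" by (simp add: lo_def)
      also have "\<dots> \<le> t * exp (- (t * (norm \<xi>)\<^sup>2 / 4)) * norm \<xi> powr (2 * \<theta>)"
        using True t \<sigma>2 by (intro M_symbol_low) auto
      also have "\<dots> \<le> gl \<xi>" unfolding gl_def by (rule low_frequency_gauss[OF t \<theta>(1,2)])
      finally show ?thesis .
    qed (simp add: lo_def gl_def gauss_bounds)
    define hb where "hb \<xi> = K * (?e) * tl \<xi>" for \<xi>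
    have hbi: "integrable lborel hb" unfolding hb_def[abs_def] by (intro integrable_mult_right tl)
    have hib: "\<bar>hi \<xi>\<bar> \<le> hb \<xi>" for \<xi>
    proof (cases "norm \<xi> \<ge> 1")
      case True
      then have "\<bar>hi \<xi>\<bar> \<le> K * ?e * norm \<xi> powr (\<sigma> + 2 * \<theta> - 4)"
        using M_symbol_high[OF True, of t \<sigma> \<theta>] t by (simp add: hi_def K_def)
      \<comment> \<open>The gain of one power of |xi| makes the exponent smaller than -n - 1
        whatever the size of \<epsilon>, so the majorant \<open>tl\<close> and its integral
        \<open>J\<close> do not involve theta.\<close>
      also have "norm \<xi> powr (\<sigma> + 2 * \<theta> - 4) \<le> norm \<xi> powr (- real n - 1)"
        using True \<sigma> by (intro powr_mono) auto
      finally show ?thesis using True K0 t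
        by (simp add: hb_def tl_def mult_left_mono mult.assoc)
    qed (simp add: hi_def hb_def tl_def)
    have oscb: "\<bar>osc \<xi>\<bar> \<le> indicator {1..} (norm \<xi>) * norm \<xi> powr (- real n - \<epsilon>)" for \<xi>
    proof -
      have "indicator {1..} (norm \<xi>) * norm \<xi> powr (- real n - \<epsilon>) * \<bar>sin (t * norm \<xi>)\<bar> \<le>
          indicator {1..} (norm \<xi>) * norm \<xi> powr (- real n - \<epsilon>) * 1"
        by (intro mult_left_mono) auto
      then show ?thesis by (simp add: osc_def abs_mult)
    qed
    \<comment> \<open>Absolute integrability enters only qualitatively, to split the integral; its
      size degenerates as \<epsilon> tends to 0, and the quantitative bound is that of
      \<open>oscillatory_bound\<close>.\<close>
    have osci: "integrable lborel osc"
    proof (rule Bochner_Integration.integrable_bound)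
      show "integrable lborel (\<lambda>\<xi>::real^'n. indicator {1..} (norm \<xi>) * norm \<xi> powr (- real n - \<epsilon>))"
        using integrable_norm_powr_tail[OF \<epsilon>, where 'a="real^'n"] by (simp add: n_def)
    qed (use oscb in auto)
    have ci: "integrable lborel (\<lambda>\<xi>. f \<xi> * cos (x \<bullet> \<xi>))" if "integrable lborel f" for f and x :: "real^'n"
    proof (rule Bochner_Integration.integrable_bound[OF that])
      have [measurable]: "f \<in> borel_measurable borel" using borel_measurable_integrable[OF that] by simp
      show "(\<lambda>\<xi>. f \<xi> * cos (x \<bullet> \<xi>)) \<in> borel_measurable lborel" by measurable
      show "AE \<xi> in lborel. norm (f \<xi> * cos (x \<bullet> \<xi>)) \<le> norm (f \<xi>)"
        by (auto simp: abs_mult intro!: mult_left_le)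
    qed
    have loi: "integrable lborel lo"
      by (rule Bochner_Integration.integrable_bound[OF gli]) (use lob in \<open>auto intro: order_trans[OF lob abs_ge_self]\<close>)
    have hii: "integrable lborel hi"
      by (rule Bochner_Integration.integrable_bound[OF hbi]) (use hib in \<open>auto intro: order_trans[OF hib abs_ge_self]\<close>)
    have Mi: "integrable lborel ?M"
    proof -
      have "integrable lborel (\<lambda>\<xi>. lo \<xi> + hi \<xi> + exp (- t / 2) * osc \<xi>)"
        by (intro Bochner_Integration.integrable_add loi hii integrable_mult_right osci)
      then show ?thesis by (simp only: split[symmetric])
    qed
    have bnd: "\<bar>?I f x\<bar> \<le> (LINT \<xi>|lborel. g \<xi>)"
      if "integrable lborel f" "integrable lborel g" "\<And>\<xi>. \<bar>f \<xi>\<bar> \<le> g \<xi>" for f g and x :: "real^'n"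
    proof -
      have "norm (LINT \<xi>|lborel. f \<xi> * cos (x \<bullet> \<xi>)) \<le> (LINT \<xi>|lborel. g \<xi>)"
      proof (rule Bochner_Integration.integral_norm_bound_integral[OF ci[OF that(1)] that(2)])
        fix \<xi>
        have "\<bar>f \<xi>\<bar> * \<bar>cos (x \<bullet> \<xi>)\<bar> \<le> \<bar>f \<xi>\<bar> * 1" by (intro mult_left_mono) auto
        then show "norm (f \<xi> * cos (x \<bullet> \<xi>)) \<le> g \<xi>" using that(3)[of \<xi>] by (simp add: abs_mult)
      qed
      then show ?thesis by simp
    qed
    have "\<bar>?I ?M x\<bar> \<le> C * ?t" for x :: "real^'n"
    proof -
      have "?M \<xi> * cos (x \<bullet> \<xi>) = lo \<xi> * cos (x \<bullet> \<xi>) + hi \<xi> * cos (x \<bullet> \<xi>) + exp (- t / 2) * (osc \<xi> * cos (x \<bullet> \<xi>))" for \<xi>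
        unfolding split by (simp only: distrib_right mult.assoc)
      then have "(LINT \<xi>|lborel. ?M \<xi> * cos (x \<bullet> \<xi>)) =
          ?I lo x + ?I hi x + exp (- t / 2) * ?I osc x"
        using ci[OF loi] ci[OF hii] ci[OF osci] by simp
      also have "\<bar>\<dots>\<bar> \<le> \<bar>?I lo x\<bar> + \<bar>?I hi x\<bar> + \<bar>exp (- t / 2) * ?I osc x\<bar>"
        by (rule order_trans[OF abs_triangle_ineq add_right_mono[OF abs_triangle_ineq]])
      also have "\<bar>?I lo x\<bar> \<le> L * ?t"
        using bnd[OF loi gli lob, of x] by (simp only: glv)
      also have "\<bar>?I hi x\<bar> \<le> K * (?e) * J"
        using bnd[OF hii hbi hib, of x] by (simp add: hb_def J_def)
      also have "\<bar>exp (- t / 2) * ?I osc x\<bar> \<le> (?e) * V"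
        unfolding abs_mult
      proof (rule mult_mono)
        have "exp (- t / 2) \<le> 1 * exp (- t / 4)" using t by simp
        also have "\<dots> \<le> ?e" using t by (intro mult_right_mono) auto
        finally show "\<bar>exp (- t / 2)\<bar> \<le> ?e" by simp
        show "\<bar>?I osc x\<bar> \<le> V"
          using oscillatory_bound[OF \<epsilon>, of t x] unfolding V_def osc_def n_def by simp
      qed (use t in auto)
      finally have "\<bar>?I ?M x\<bar> \<le>
          L * ?t + K * (?e) * J + ?e * V"
        by simp
      also have "\<dots> = L * ?t + (K * J + V) * (?e)"
        by (simp add: algebra_simps)
      also have "\<dots> \<le> L * ?t + (K * J + V) * (H * ?t)"
      proof (intro add_left_mono mult_left_mono)
        \<comment> \<open>Here k = theta + n/2 - 1, which lies between 0 and n because theta <= 1 <=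
          theta + n/2.\<close>
        have "?e \<le> H * t powr (- (\<theta> + real n / 2 - 1))"
          unfolding H_def using \<theta> by (intro decay_to_powr t) auto
        also have "- (\<theta> + real n / 2 - 1) = 1 - \<theta> - real n / 2" by simp
        finally show "?e \<le> H * ?t" .
      qed (use K0 J0 V0 in simp)
      also have "\<dots> = C * ?t" unfolding C_def by (simp only: distrib_right mult.assoc)
      finally show ?thesis .
    qed
    with Mi show ?thesis by blast
  qed
  show ?thesis using C0 main unfolding n_def by blast
qed

text \<open>Averaging over xi and -xi leaves the cosine, the form in which the kernel is
  estimated.\<close>

lemma ft_even:
  fixes F :: "'a::euclidean_space \<Rightarrow> real"
  assumes F: "integrable lborel F" and even: "\<And>\<xi>. F (- \<xi>) = F \<xi>"
  shows "ft 1 (\<lambda>\<xi>. complex_of_real (F \<xi>)) x = complex_of_real (LINT \<xi>|lborel. F \<xi> * cos (x \<bullet> \<xi>))"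
proof -
  let ?f = "\<lambda>\<xi>. complex_of_real (F \<xi>)"
  have [measurable]: "F \<in> borel_measurable borel" using borel_measurable_integrable[OF F] by simp
  have i: "integrable lborel (\<lambda>\<xi>. iexp (s * (x \<bullet> \<xi>)) * ?f \<xi>)" for s
    by (rule integrable_iexp_mult) (use F in auto)
  have "ft 1 ?f x = (LINT \<xi>|lborel. iexp (1 * (x \<bullet> (0 + (- 1) *\<^sub>R \<xi>))) * ?f (0 + (- 1) *\<^sub>R \<xi>))"
    unfolding ft_def by (subst lborel_integral_affine[where c="-1" and t=0]) auto
  also have "\<dots> = ft (- 1) ?f x" unfolding ft_def by (simp add: even)
  finally have "2 * ft 1 ?f x = ft 1 ?f x + ft (- 1) ?f x" by simp
  also have "\<dots> = (LINT \<xi>|lborel. iexp (1 * (x \<bullet> \<xi>)) * ?f \<xi> + iexp (- 1 * (x \<bullet> \<xi>)) * ?f \<xi>)"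
    unfolding ft_def by (rule Bochner_Integration.integral_add[OF i i, symmetric])
  also have "\<dots> = (LINT \<xi>|lborel. 2 * complex_of_real (F \<xi> * cos (x \<bullet> \<xi>)))"
  proof (rule Bochner_Integration.integral_cong[OF refl])
    fix \<xi>
    show "iexp (1 * (x \<bullet> \<xi>)) * ?f \<xi> + iexp (- 1 * (x \<bullet> \<xi>)) * ?f \<xi> = 2 * complex_of_real (F \<xi> * cos (x \<bullet> \<xi>))"
      by (simp add: cos_of_real[symmetric] cos_exp_eq field_simps)
  qed
  also have "\<dots> = 2 * complex_of_real (LINT \<xi>|lborel. F \<xi> * cos (x \<bullet> \<xi>))"
    unfolding integral_mult_right_zero integral_complex_of_real ..
  finally show ?thesis by simp
qed

section \<open>Fourier multipliers on Lebesgue spaces\<close>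

text \<open>The operator \<open>fourier_multiplier\<close> rewritten through \<open>ft\<close>, so
  that the duality and Plancherel results apply directly.\<close>

definition mult_op :: "(real^'n::finite \<Rightarrow> real) \<Rightarrow> (real^'n \<Rightarrow> complex) \<Rightarrow> real^'n \<Rightarrow> complex" where
  "mult_op m f x = complex_of_real (1 / (2 * pi) ^ CARD('n)) * ft 1 (\<lambda>\<xi>. complex_of_real (m \<xi>) * ft (- 1) f \<xi>) x"

lemma fourier_multiplier_eq: "fourier_multiplier m f = mult_op m f"
  by (rule ext) (simp add: fourier_multiplier_def mult_op_def inv_fourier_eq_ft fourier_eq_ft)

lemma integrable_symbol_ft:
  assumes m: "integrable lborel m" and f: "integrable lborel f"
  shows "integrable lborel (\<lambda>\<xi>. complex_of_real (m \<xi>) * ft (- 1) f \<xi>)"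
  using integrable_ft_mult[OF f, of "\<lambda>\<xi>. complex_of_real (m \<xi>)" "- 1"] m by (simp add: mult.commute)

lemma mult_op_borel:
  assumes [measurable]: "m \<in> borel_measurable borel" "f \<in> borel_measurable borel"
  shows "mult_op m f \<in> borel_measurable borel"
  unfolding mult_op_def[abs_def] by measurable

lemma mult_op_add:
  assumes m: "integrable lborel m" and f: "integrable lborel f" and g: "integrable lborel g"
  shows "mult_op m (\<lambda>x. f x + g x) x = mult_op m f x + mult_op m g x"
proof -
  have ft_add: "ft s (\<lambda>x. f x + g x) \<xi> = ft s f \<xi> + ft s g \<xi>"
    if f: "integrable lborel f" and g: "integrable lborel g" for s \<xi> and f g :: "real^'n \<Rightarrow> complex"
  proof -
    have "integrable lborel (\<lambda>y. iexp (s * (\<xi> \<bullet> y)) * f y)" "integrable lborel (\<lambda>y. iexp (s * (\<xi> \<bullet> y)) * g y)"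
      by (rule integrable_iexp_mult[OF f], measurable, rule integrable_iexp_mult[OF g], measurable)
    then show ?thesis unfolding ft_def distrib_left by (rule Bochner_Integration.integral_add)
  qed
  show ?thesis
    unfolding mult_op_def ft_add[OF f g] distrib_left
      ft_add[OF integrable_symbol_ft[OF m f] integrable_symbol_ft[OF m g]] ..
qed

text \<open>Duality turns the operator into convolution with the transform of m, which is bounded by
  K. The normalising factor (2 pi)^(-n) is at most 1 and is discarded.\<close>

lemma mult_op_sup:
  fixes m :: "real^'n::finite \<Rightarrow> real"
  assumes m: "integrable lborel m" and f: "integrable lborel f"
    and K: "\<And>x. norm (ft 1 (\<lambda>\<xi>. complex_of_real (m \<xi>)) x) \<le> K"
  shows "ennreal (norm (mult_op m f x)) \<le> ennreal K * (\<integral>\<^sup>+y. ennreal (norm (f y)) \<partial>lborel)"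
proof -
  let ?k = "ft 1 (\<lambda>\<xi>. complex_of_real (m \<xi>))"
  let ?e = "\<lambda>\<xi>. iexp (1 * (x \<bullet> \<xi>)) * complex_of_real (m \<xi>)"
  let ?T = "ft 1 (\<lambda>\<xi>. complex_of_real (m \<xi>) * ft (- 1) f \<xi>) x"
  have [measurable]: "m \<in> borel_measurable borel" "f \<in> borel_measurable borel"
    using borel_measurable_integrable[OF m] borel_measurable_integrable[OF f] by simp_all
  have K0: "K \<ge> 0" using order_trans[OF norm_ge_zero K] .
  have mi: "integrable lborel (\<lambda>\<xi>. iexp (1 * (x \<bullet> \<xi>)) * complex_of_real (m \<xi>))"
    by (rule integrable_iexp_mult) (use m in auto)
  have "?T = (LINT \<xi>|lborel. ft (- 1) f \<xi> * (iexp (1 * (x \<bullet> \<xi>)) * complex_of_real (m \<xi>)))"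
    unfolding ft_def[of 1] by (simp only: mult_ac)
  also have "\<dots> = (LINT y|lborel. f y * ft (- 1) ?e y)"
    by (rule ft_mult[OF f mi])
  also have "\<dots> = (LINT y|lborel. f y * ?k (x - y))"
  proof (rule Bochner_Integration.integral_cong[OF refl])
    fix y
    have "ft (- 1) ?e y = ?k (x - y)"
      unfolding ft_def
    proof (rule Bochner_Integration.integral_cong[OF refl])
      fix \<xi>
      have "iexp (- 1 * (y \<bullet> \<xi>)) * iexp (1 * (x \<bullet> \<xi>)) = iexp (1 * ((x - y) \<bullet> \<xi>))"
        by (simp add: exp_add[symmetric] inner_diff_left algebra_simps)
      then show "iexp (- 1 * (y \<bullet> \<xi>)) * (iexp (1 * (x \<bullet> \<xi>)) * complex_of_real (m \<xi>)) = iexp (1 * ((x - y) \<bullet> \<xi>)) * complex_of_real (m \<xi>)"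
        by (simp only: mult.assoc[symmetric])
    qed
    then show "f y * ft (- 1) ?e y = f y * ?k (x - y)"
      by simp
  qed
  finally have e: "?T = (LINT y|lborel. f y * ?k (x - y))" .
  have "1 \<le> (2 * pi) ^ CARD('n)" by (rule one_le_power) (use pi_gt3 in simp)
  then have "1 / (2 * pi) ^ CARD('n) \<le> 1" by (simp only: divide_le_eq_1) simp
  then have n: "norm (complex_of_real (1 / (2 * pi) ^ CARD('n))) \<le> 1"
    unfolding norm_of_real by (subst abs_of_nonneg) auto
  have "norm (mult_op m f x) \<le> 1 * norm (?T)"
    unfolding mult_op_def norm_mult by (intro mult_right_mono n) simp
  then have "ennreal (norm (mult_op m f x)) \<le> ennreal (norm (LINT y|lborel. f y * ?k (x - y)))"
    unfolding e by (intro ennreal_leI) simp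
  also have "\<dots> \<le> (\<integral>\<^sup>+y. ennreal (norm (f y * ?k (x - y))) \<partial>lborel)"
    by (rule norm_integral_le_nn_integral)
  also have "\<dots> \<le> (\<integral>\<^sup>+y. ennreal K * ennreal (norm (f y)) \<partial>lborel)"
  proof (rule nn_integral_mono)
    fix y
    have "norm (f y) * norm (?k (x - y)) \<le> norm (f y) * K"
      by (intro mult_left_mono K) simp
    then show "ennreal (norm (f y * ?k (x - y))) \<le> ennreal K * ennreal (norm (f y))"
      using K0 by (simp add: norm_mult ennreal_mult[symmetric] ennreal_leI mult.commute)
  qed
  also have "\<dots> = ennreal K * (\<integral>\<^sup>+y. ennreal (norm (f y)) \<partial>lborel)"
    by (rule nn_integral_cmult) measurable
  finally show ?thesis .
qed

text \<open>Plancherel is used twice, once for each transform; the two factors (2 pi)^n cancel the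
  squared normalisation.\<close>

lemma mult_op_L2:
  fixes m :: "real^'n::finite \<Rightarrow> real"
  assumes m: "integrable lborel m" and f: "integrable lborel f" and A: "\<And>\<xi>. \<bar>m \<xi>\<bar> \<le> A"
  shows "(\<integral>\<^sup>+x. ennreal ((norm (mult_op m f x))\<^sup>2) \<partial>lborel) \<le> ennreal (A\<^sup>2) * (\<integral>\<^sup>+y. ennreal ((norm (f y))\<^sup>2) \<partial>lborel)"
proof -
  have [measurable]: "m \<in> borel_measurable borel" "f \<in> borel_measurable borel"
    using borel_measurable_integrable[OF m] borel_measurable_integrable[OF f] by simp_all
  define N where "N = (2 * pi) ^ CARD('n)"
  have N: "N > 0" by (simp add: N_def)
  let ?u = "\<lambda>\<xi>. complex_of_real (m \<xi>) * ft (- 1) f \<xi>"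
  let ?F = "\<integral>\<^sup>+y. ennreal ((norm (f y))\<^sup>2) \<partial>lborel"
  let ?U = "\<lambda>x. ennreal ((norm (ft 1 ?u x))\<^sup>2)" and ?V = "\<lambda>\<xi>. ennreal ((norm (ft (- 1) f \<xi>))\<^sup>2)"
  have "(\<integral>\<^sup>+x. ennreal ((norm (mult_op m f x))\<^sup>2) \<partial>lborel) = (\<integral>\<^sup>+x. ennreal ((1 / N)\<^sup>2) * ?U x \<partial>lborel)"
  proof (rule nn_integral_cong)
    fix x
    have "norm (mult_op m f x) = 1 / N * norm (ft 1 ?u x)"
      unfolding mult_op_def N_def norm_mult norm_of_real by simp
    then show "ennreal ((norm (mult_op m f x))\<^sup>2) = ennreal ((1 / N)\<^sup>2) * ?U x"
      by (simp only: power_mult_distrib) (rule ennreal_mult; simp)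
  qed
  also have "\<dots> = ennreal ((1 / N)\<^sup>2) * (\<integral>\<^sup>+x. ?U x \<partial>lborel)"
    by (rule nn_integral_cmult) measurable
  also have "\<dots> \<le> ennreal ((1 / N)\<^sup>2) * (ennreal N * (\<integral>\<^sup>+\<xi>. ennreal ((norm (?u \<xi>))\<^sup>2) \<partial>lborel))"
    using plancherel_le[OF integrable_symbol_ft[OF m f], of 1] by (intro mult_left_mono) (simp_all add: N_def)
  also have "(\<integral>\<^sup>+\<xi>. ennreal ((norm (?u \<xi>))\<^sup>2) \<partial>lborel) \<le> (\<integral>\<^sup>+\<xi>. ennreal (A\<^sup>2) * ?V \<xi> \<partial>lborel)"
  proof (rule nn_integral_mono)
    fix \<xi>
    have "(norm (?u \<xi>))\<^sup>2 = \<bar>m \<xi>\<bar>\<^sup>2 * (norm (ft (- 1) f \<xi>))\<^sup>2" by (simp add: norm_mult power_mult_distrib)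
    also have "\<dots> \<le> A\<^sup>2 * (norm (ft (- 1) f \<xi>))\<^sup>2" by (intro mult_right_mono power_mono A) auto
    finally show "ennreal ((norm (?u \<xi>))\<^sup>2) \<le> ennreal (A\<^sup>2) * ?V \<xi>"
      by (simp add: ennreal_mult[symmetric] ennreal_leI)
  qed
  also have "\<dots> = ennreal (A\<^sup>2) * (\<integral>\<^sup>+\<xi>. ?V \<xi> \<partial>lborel)"
    by (rule nn_integral_cmult) measurable
  also have "\<dots> \<le> ennreal (A\<^sup>2) * (ennreal N * ?F)"
    using plancherel_le[OF f, of "- 1"] by (intro mult_left_mono) (simp_all add: N_def)
  finally have "(\<integral>\<^sup>+x. ennreal ((norm (mult_op m f x))\<^sup>2) \<partial>lborel) \<le>
      ennreal ((1 / N)\<^sup>2) * (ennreal N * (ennreal (A\<^sup>2) * (ennreal N * ?F)))"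
    by (simp add: mult_left_mono)
  also have "\<dots> = (ennreal ((1 / N)\<^sup>2) * ennreal N * ennreal N) * (ennreal (A\<^sup>2) * ?F)"
    by (simp only: mult_ac)
  also have "ennreal ((1 / N)\<^sup>2) * ennreal N * ennreal N = ennreal ((1 / N)\<^sup>2 * N * N)"
    using N by (simp only: ennreal_mult less_imp_le zero_le_power2 mult_nonneg_nonneg)
  also have "(1 / N)\<^sup>2 * N * N = 1" using N by (simp add: power2_eq_square)
  finally show ?thesis by simp
qed

section \<open>Lebesgue norms and the Bessel potential norm\<close>

lemma Lp_norm_infinity_le:
  assumes [measurable]: "f \<in> borel_measurable borel" and c: "\<And>x. ennreal (norm (f x)) \<le> c"
  shows "Lp_norm \<infinity> f \<le> c"
  unfolding Lp_norm_def by (simp, intro esssup_I) (use c in auto)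

lemma Lp_norm_le:
  assumes q: "q > 0" and Y: "Y \<ge> 0" and I: "(\<integral>\<^sup>+x. ennreal (norm (f x) powr q) \<partial>lborel) \<le> ennreal (Y powr q)"
  shows "Lp_norm (ennreal q) f \<le> ennreal Y"
proof -
  let ?I = "\<integral>\<^sup>+x. ennreal (norm (f x) powr q) \<partial>lborel"
  have fin: "?I \<noteq> \<infinity>" using I by (auto simp: top_unique)
  have "enn2real ?I \<le> Y powr q" using I by (simp add: enn2real_leI)
  then have "enn2real ?I powr (1 / q) \<le> (Y powr q) powr (1 / q)"
    using q by (intro powr_mono2) auto
  also have "\<dots> = Y" using q Y by (simp add: powr_powr)
  finally have "ennreal (enn2real ?I powr (1 / q)) \<le> ennreal Y" by (rule ennreal_leI)
  then show ?thesis using q fin by (simp add: Lp_norm_def Let_def)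
qed

lemma Lp_norm_eq:
  assumes q: "q > 0" and I: "(\<integral>\<^sup>+x. ennreal (norm (f x) powr q) \<partial>lborel) = ennreal G" and G: "G \<ge> 0"
  shows "Lp_norm (ennreal q) f = ennreal (G powr (1 / q))"
  using q G by (simp add: Lp_norm_def Let_def I)

lemma Lp_norm_top:
  assumes q: "q > 0" and I: "(\<integral>\<^sup>+x. ennreal (norm (f x) powr q) \<partial>lborel) = \<infinity>"
  shows "Lp_norm (ennreal q) f = \<infinity>"
  using q by (simp add: Lp_norm_def Let_def I)

text \<open>The norm is an infimum, so a single representative of finite norm bounds it; if the norm
  of h is infinite, then so is c.\<close>

lemma bessel_norm_le:
  assumes "h \<in> borel_measurable borel" "Lp_norm p h \<le> c" "\<And>\<phi>. \<phi> \<in> schwartz \<Longrightarrow> bessel_op_distr s u \<phi> = distr_of_fun h \<phi>"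
  shows "bessel_norm s p u \<le> c"
proof (cases "Lp_norm p h < \<infinity>")
  case True
  then have "bessel_norm s p u \<le> Lp_norm p h"
    unfolding bessel_norm_def using assms by (intro Inf_lower) (auto simp: Lp_space_def)
  then show ?thesis using assms(2) by (rule order_trans)
next
  case False
  then have "c = \<infinity>" using assms(2) by (simp add: top_unique less_top[symmetric])
  then show ?thesis by simp
qed

lemma bessel_op_distr_Lambda:
  fixes g \<phi> :: "real^'n::finite \<Rightarrow> complex"
  assumes \<theta>: "0 \<le> \<theta>" "\<theta> \<le> 1" and \<sigma>: "\<sigma> \<le> 2" and t: "t \<ge> 0" and g: "g \<in> schwartz" and \<phi>: "\<phi> \<in> schwartz"
    and M: "integrable lborel (M_symbol \<sigma> \<theta> t :: real^'n \<Rightarrow> real)"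
  shows "bessel_op_distr \<sigma> (distr_of_fun (Lambda \<theta> t g)) \<phi> = distr_of_fun (mult_op (M_symbol \<sigma> \<theta> t) g) \<phi>"
proof -
  define N where "N = complex_of_real ((2 * pi) ^ CARD('n))"
  have N: "N \<noteq> 0" by (simp add: N_def)
  define b where "b \<xi> = (1 + (norm \<xi>)\<^sup>2) powr (\<sigma> / 2)" for \<xi> :: "real^'n"
  have [measurable]: "b \<in> borel_measurable borel" unfolding b_def[abs_def] by measurable
  have bb: "\<bar>b \<xi>\<bar> \<le> 1 * (1 + norm \<xi>) ^ 2" for \<xi>
  proof -
    have "b \<xi> \<le> (1 + (norm \<xi>)\<^sup>2) powr 1" unfolding b_def using \<sigma> by (intro powr_mono) auto
    also have "\<dots> = 1 + (norm \<xi>)\<^sup>2" by (simp add: add_nonneg_nonneg)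
    also have "\<dots> \<le> (1 + norm \<xi>)\<^sup>2" by (simp add: power2_eq_square algebra_simps)
    finally show ?thesis by (simp add: b_def)
  qed
  let ?u = "\<lambda>\<xi>. complex_of_real (Lambda_symbol \<theta> t \<xi>) * ft (- 1) g \<xi>"
  let ?v = "\<lambda>\<xi>. complex_of_real (b \<xi>) * ft (- 1) \<phi> \<xi>"
  let ?m = "\<lambda>\<xi>. complex_of_real (M_symbol \<sigma> \<theta> t \<xi>) * ft (- 1) g \<xi>"
  have ab: "\<bar>Lambda_symbol \<theta> t \<xi>\<bar> \<le> t * (1 + norm \<xi>) ^ 0" for \<xi> :: "real^'n"
    using Lambda_symbol_bound[OF \<theta> t, of \<xi>] by simp
  obtain Bu where Bu: "\<And>\<xi>. norm (?u \<xi>) \<le> Bu"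
    using weighted_ft_schwartz(2)[OF g _ Lambda_symbol_borel ab, of "- 1"] by auto
  have u: "integrable lborel ?u"
    by (rule weighted_ft_schwartz(1)[OF g _ Lambda_symbol_borel ab]) simp
  obtain Bv where Bv: "\<And>\<xi>. norm (?v \<xi>) \<le> Bv"
    using weighted_ft_schwartz(2)[OF \<phi> _ _ bb, of "- 1"] by auto
  have v: "integrable lborel ?v"
    by (rule weighted_ft_schwartz(1)[OF \<phi> _ _ bb]) auto
  have gi: "integrable lborel g" and \<phi>i: "integrable lborel \<phi>"
    using g \<phi> by (auto intro: schwartz_integrable)
  have "continuous_on UNIV b" unfolding b_def
    by (intro continuous_intros) (auto simp: add_pos_nonneg less_imp_neq[symmetric] intro!: less_imp_neq[OF add_pos_nonneg, symmetric])
  then have vc: "continuous_on UNIV ?v"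
    by (intro continuous_intros continuous_ft \<phi>i)
  have "bessel_op_distr \<sigma> (distr_of_fun (Lambda \<theta> t g)) \<phi> =
      (LINT x|lborel. (1 / N * ft 1 ?u x) * (1 / N * ft 1 ?v x))"
    by (simp add: bessel_op_distr_def distr_of_fun_def Lambda_def bessel_op_def fourier_multiplier_eq mult_op_def[abs_def] N_def b_def)
  also have "\<dots> = (LINT x|lborel. (1 / N) * (1 / N) * (ft 1 ?u x * ft 1 ?v x))"
    by (simp only: mult_ac)
  also have "\<dots> = (1 / N) * (1 / N) * (LINT x|lborel. ft 1 ?u x * ft 1 ?v x)"
    by (rule integral_mult_right_zero)
  also have "(LINT x|lborel. ft 1 ?u x * ft 1 ?v x) = N * (LINT \<xi>|lborel. ?u \<xi> * ?v (- \<xi>))"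
    using plancherel_pairing[OF u nn_integral_norm2_finite[OF u Bu] v vc Bv] by (simp add: N_def)
  \<comment> \<open>The reflection from the bilinear pairing does not affect the even weight
    \<open>b\<close> and changes the sign in the transform of \<phi>.\<close>
  also have "(LINT \<xi>|lborel. ?u \<xi> * ?v (- \<xi>)) = (LINT \<xi>|lborel. ?m \<xi> * ft 1 \<phi> \<xi>)"
  proof (rule Bochner_Integration.integral_cong[OF refl])
    fix \<xi>
    have "ft (- 1) \<phi> (- \<xi>) = ft 1 \<phi> \<xi>" by (simp add: ft_def)
    moreover have "b (- \<xi>) = b \<xi>" by (simp add: b_def)
    moreover have "M_symbol \<sigma> \<theta> t \<xi> = Lambda_symbol \<theta> t \<xi> * b \<xi>" by (simp add: M_symbol_def b_def)
    ultimately show "?u \<xi> * ?v (- \<xi>) = ?m \<xi> * ft 1 \<phi> \<xi>"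
      by (simp only: of_real_mult mult_ac)
  qed
  also have "\<dots> = (LINT x|lborel. ft 1 ?m x * \<phi> x)"
    by (rule ft_mult[OF integrable_symbol_ft[OF M gi] \<phi>i, symmetric])
  also have "(1 / N) * (1 / N) * (N * \<dots>) = 1 / N * (LINT x|lborel. ft 1 ?m x * \<phi> x)"
    using N by simp
  also have "\<dots> = (LINT x|lborel. 1 / N * (ft 1 ?m x * \<phi> x))"
    by (rule integral_mult_right_zero[symmetric])
  also have "\<dots> = distr_of_fun (mult_op (M_symbol \<sigma> \<theta> t) g) \<phi>"
    by (simp add: distr_of_fun_def mult_op_def N_def mult.assoc)
  finally show ?thesis .
qed

section \<open>Bounds between conjugate exponents\<close>

lemma conjugate_exponent:
  fixes p p' :: ennreal
  assumes p: "2 \<le> p" "p \<noteq> \<infinity>" and pp: "1 / p + 1 / p' = 1"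
  obtains q where "q \<ge> 2" "p = ennreal q" "p' = ennreal (q / (q - 1))"
proof -
  obtain q where q: "p = ennreal q" "q \<ge> 0" using p(2) by (cases p) auto
  have q2: "q \<ge> 2" using p(1) q ennreal_le_iff[of q 2] by (simp flip: ennreal_numeral)
  have ip: "1 / p = ennreal (1 / q)" using q q2 divide_ennreal[of 1 q] by simp
  have "p' = ennreal (q / (q - 1))"
  proof (cases p')
    case (real r)
    have "r > 0"
    proof (rule ccontr)
      assume "\<not> r > 0"
      then have "p' = 0" using real by simp
      then show False using pp by (simp add: ennreal_divide_zero)
    qed
    then have "1 / p' = ennreal (1 / r)" using real divide_ennreal[of 1 r] by simp
    then have "ennreal (1 / q + 1 / r) = ennreal 1" using pp ip q2 \<open>r > 0\<close> by (simp add: ennreal_plus)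
    then have "1 / q + 1 / r = 1" using q2 \<open>r > 0\<close> by (subst (asm) ennreal_inj) auto
    then have "r = q / (q - 1)" using q2 \<open>r > 0\<close> by (simp add: field_simps)
    then show ?thesis using real by simp
  next
    case top
    then have "ennreal (1 / q) = ennreal 1" using pp ip by simp
    then have "1 / q = 1" using q2 by (subst (asm) ennreal_inj) auto
    then show ?thesis using q2 by simp
  qed
  with q2 q that show thesis by blast
qed

text \<open>Origin of the factor exp 2: q (q - 1) / 2 <= q^2 <= exp(2q), so the q-th root of the
  interpolation constant stays below exp 2 for every q. The powers of a, v and G match
  exactly.\<close>

lemma interpolation_constant_bound:
  fixes q a v G :: real
  assumes q: "q > 2" and a: "a > 0" and v: "v > 0" and G: "G > 0"
  shows "q * (q - 1) / 2 * a\<^sup>2 * (a * v * G) powr (q - 2) * G \<le> (exp 2 * (a * v powr (1 - 2 / q) * G powr ((q - 1) / q))) powr q"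
proof -
  have "(exp 2 * (a * v powr (1 - 2 / q) * G powr ((q - 1) / q))) powr q =
      (exp 2) powr q * (a powr q * (v powr (1 - 2 / q)) powr q * (G powr ((q - 1) / q)) powr q)"
    using a v G by (simp add: powr_mult)
  also have "(v powr (1 - 2 / q)) powr q = v powr (q - 2)"
  proof -
    have "(1 - 2 / q) * q = q - 2" using q by (simp add: left_diff_distrib)
    then show ?thesis by (simp only: powr_powr)
  qed
  also have "(G powr ((q - 1) / q)) powr q = G powr (q - 1)"
    using q by (simp add: powr_powr)
  also have "a powr q = a\<^sup>2 * a powr (q - 2)"
    using a by (simp add: powr_diff)
  also have "G powr (q - 1) = G powr (q - 2) * G"
    using G powr_mult_base[of G "q - 2"] by (simp add: mult.commute)
  finally have R: "(exp 2 * (a * v powr (1 - 2 / q) * G powr ((q - 1) / q))) powr q =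
      (exp 2) powr q * (a\<^sup>2 * (a * v * G) powr (q - 2) * G)"
    using a v G by (simp add: powr_mult mult_ac)
  have "q * (q - 1) / 2 \<le> (exp 2) powr q"
  proof -
    have "q \<le> exp q" using exp_ge_add_one_self[of q] by linarith
    then have "q * q \<le> exp q * exp q" using q by (intro mult_mono) auto
    also have "\<dots> = (exp 2) powr q" by (simp add: powr_def exp_add[symmetric])
    finally have qq: "q * q \<le> (exp 2) powr q" .
    have "q * (q - 1) \<le> q * q" using q by (intro mult_left_mono) auto
    moreover have "0 \<le> q * (q - 1)" using q by simp
    ultimately have "q * (q - 1) / 2 \<le> q * q" by simp
    then show ?thesis using qq by (rule order_trans)
  qed
  then have "q * (q - 1) / 2 * (a\<^sup>2 * (a * v * G) powr (q - 2) * G) \<le> (exp 2) powr q * (a\<^sup>2 * (a * v * G) powr (q - 2) * G)"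
    using G by (intro mult_right_mono) auto
  then show ?thesis unfolding R by (simp only: mult.assoc)
qed

lemma mult_op_Lp:
  fixes m :: "real^'n::finite \<Rightarrow> real" and g :: "real^'n \<Rightarrow> complex"
  assumes m: "integrable lborel m" and g: "integrable lborel g"
    and a: "a > 0" "\<And>\<xi>. \<bar>m \<xi>\<bar> \<le> a"
    and v: "v > 0" "\<And>x. norm (ft 1 (\<lambda>\<xi>. complex_of_real (m \<xi>)) x) \<le> a * v"
    and q: "q \<ge> 2"
  shows "Lp_norm (ennreal q) (mult_op m g) \<le> ennreal (exp 2 * (a * v powr (1 - 2 / q))) * Lp_norm (ennreal (q / (q - 1))) g"
proof -
  have [measurable]: "m \<in> borel_measurable borel" "g \<in> borel_measurable borel"
    using borel_measurable_integrable[OF m] borel_measurable_integrable[OF g] by simp_all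
  have [measurable]: "mult_op m g \<in> borel_measurable borel" by (rule mult_op_borel) measurable
  define r where "r = q / (q - 1)"
  have r: "r > 0" using q by (simp add: r_def)
  let ?c = "exp 2 * (a * v powr (1 - 2 / q))"
  have c: "?c > 0" using a v by simp
  let ?I = "\<integral>\<^sup>+x. ennreal (norm (g x) powr r) \<partial>lborel"
  have "Lp_norm (ennreal q) (mult_op m g) \<le> ennreal ?c * Lp_norm (ennreal r) g"
  proof (cases ?I)
    case top
    then have "Lp_norm (ennreal r) g = \<infinity>" using r by (intro Lp_norm_top) auto
    \<comment> \<open>Positivity of the constant matters, since 0 times infinity is 0 in
      \<open>ennreal\<close>.\<close>
    moreover have "ennreal ?c \<noteq> 0" using c by (simp only: ennreal_eq_0_iff not_le)
    ultimately have "ennreal ?c * Lp_norm (ennreal r) g = top"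
      by (simp only: ennreal_mult_eq_top_iff infinity_ennreal_def) simp
    then show ?thesis by (simp only: top_greatest)
  next
    case (real G)
    define Y where "Y = ?c * G powr (1 / r)"
    have Y: "Y \<ge> 0" using c by (simp add: Y_def)
    have ir: "1 / r = (q - 1) / q" by (simp add: r_def)
    have "(\<integral>\<^sup>+x. ennreal (norm (mult_op m g x) powr q) \<partial>lborel) \<le> ennreal (Y powr q)"
    \<comment> \<open>The interpolation lemma requires q > 2; at q = 2 the L^2 bound suffices, with
      exp 2 as slack.\<close>
    proof (cases "q = 2")
      case True
      then have r2: "r = 2" by (simp add: r_def)
      have p2: "z powr 2 = z\<^sup>2" if "z \<ge> 0" for z :: real using that by simp
      have I2: "(\<integral>\<^sup>+y. ennreal ((norm (g y))\<^sup>2) \<partial>lborel) = ennreal G"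
        using real(2) by (simp add: r2 p2)
      have "(\<integral>\<^sup>+x. ennreal (norm (mult_op m g x) powr q) \<partial>lborel) = (\<integral>\<^sup>+x. ennreal ((norm (mult_op m g x))\<^sup>2) \<partial>lborel)"
        by (simp add: True p2)
      also have "\<dots> \<le> ennreal (a\<^sup>2) * ennreal G"
        using mult_op_L2[OF m g a(2)] by (simp only: I2)
      also have "\<dots> = ennreal (a\<^sup>2 * G)" using real(1) by (simp add: ennreal_mult)
      also have "a\<^sup>2 * G \<le> Y powr q"
      proof -
        have "Y powr q = (exp 2)\<^sup>2 * (a\<^sup>2 * G)"
          using Y real(1) v by (simp add: True r2 p2 Y_def power_mult_distrib powr_half_sqrt)
        moreover have "1 * (a\<^sup>2 * G) \<le> (exp 2)\<^sup>2 * (a\<^sup>2 * G)"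
          using real(1) by (intro mult_right_mono) (auto simp: one_le_power)
        ultimately show ?thesis by simp
      qed
      finally show ?thesis by (simp add: ennreal_leI)
    next
      case False
      then have q2: "q > 2" using q by simp
      \<comment> \<open>The interpolation lemma asks for a positive upper bound of the integral. If
        G = 0, any positive value serves, because its conclusion still contains the vanishing
        integral as a factor.\<close>
      define G' where "G' = (if G = 0 then 1 else G)"
      have G': "G' > 0" "?I \<le> ennreal G'" using real by (auto simp: G'_def)
      have "(\<integral>\<^sup>+x. ennreal (norm (mult_op m g x) powr q) \<partial>lborel) \<le>
          ennreal (q * (q - 1) / 2 * a\<^sup>2 * (a * v * G') powr (q - 2)) * ?I"
      proof (rule real_interpolation[OF _ _ q2 r_def _ G'])
        show "a * v > 0" using a v by simp
        fix \<gamma> :: real assume "\<gamma> > 0"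
        \<comment> \<open>The large values of g are treated by the sup bound, the small ones by the
          L^2 bound. Both truncations inherit integrability from g.\<close>
        define g1 where "g1 x = complex_of_real (indicator {\<gamma><..} (norm (g x))) * g x" for x
        define g2 where "g2 x = complex_of_real (indicator {..\<gamma>} (norm (g x))) * g x" for x
        have g12: "g = (\<lambda>x. g1 x + g2 x)" by (auto simp: g1_def g2_def indicator_def fun_eq_iff)
        have n1: "norm (g1 x) = indicator {\<gamma><..} (norm (g x)) * norm (g x)"
          and n2: "(norm (g2 x))\<^sup>2 = indicator {..\<gamma>} (norm (g x)) * (norm (g x))\<^sup>2" for x
          by (auto simp: g1_def g2_def indicator_def)
        have [measurable]: "g1 \<in> borel_measurable borel" "g2 \<in> borel_measurable borel"
          unfolding g1_def[abs_def] g2_def[abs_def] by measurable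
        have i1: "integrable lborel g1"
          by (rule Bochner_Integration.integrable_bound[OF g]) (auto simp: g1_def indicator_def)
        have i2: "integrable lborel g2"
          by (rule Bochner_Integration.integrable_bound[OF g]) (auto simp: g2_def indicator_def)
        show "\<exists>k\<in>(borel_measurable borel :: (real^'n \<Rightarrow> complex) set).
          (\<forall>x. ennreal (norm (mult_op m g x)) \<le> ennreal (a * v) * (\<integral>\<^sup>+y. ennreal (indicator {\<gamma><..} (norm (g y)) * norm (g y)) \<partial>lborel) + ennreal (norm (k x))) \<and>
          (\<integral>\<^sup>+x. ennreal ((norm (k x))\<^sup>2) \<partial>lborel) \<le> ennreal (a\<^sup>2) * (\<integral>\<^sup>+y. ennreal (indicator {..\<gamma>} (norm (g y)) * (norm (g y))\<^sup>2) \<partial>lborel)"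
        proof (intro bexI conjI allI)
          show "mult_op m g2 \<in> borel_measurable borel" by (rule mult_op_borel) measurable
          show "(\<integral>\<^sup>+x. ennreal ((norm (mult_op m g2 x))\<^sup>2) \<partial>lborel) \<le> ennreal (a\<^sup>2) * (\<integral>\<^sup>+y. ennreal (indicator {..\<gamma>} (norm (g y)) * (norm (g y))\<^sup>2) \<partial>lborel)"
            using mult_op_L2[OF m i2 a(2)] by (simp only: n2)
          fix x
          have "mult_op m g x = mult_op m g1 x + mult_op m g2 x"
            by (subst (1) g12) (rule mult_op_add[OF m i1 i2])
          then have "ennreal (norm (mult_op m g x)) \<le> ennreal (norm (mult_op m g1 x) + norm (mult_op m g2 x))"
            by (simp only:) (intro ennreal_leI norm_triangle_ineq)
          also have "\<dots> = ennreal (norm (mult_op m g1 x)) + ennreal (norm (mult_op m g2 x))"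
            by (rule ennreal_plus) auto
          also have "\<dots> \<le> ennreal (a * v) * (\<integral>\<^sup>+y. ennreal (indicator {\<gamma><..} (norm (g y)) * norm (g y)) \<partial>lborel) + ennreal (norm (mult_op m g2 x))"
            using mult_op_sup[OF m i1 v(2), of x] by (intro add_right_mono) (simp only: n1)
          finally show "ennreal (norm (mult_op m g x)) \<le> ennreal (a * v) * (\<integral>\<^sup>+y. ennreal (indicator {\<gamma><..} (norm (g y)) * norm (g y)) \<partial>lborel) + ennreal (norm (mult_op m g2 x))" .
        qed
      qed measurable
      also have "\<dots> = ennreal (q * (q - 1) / 2 * a\<^sup>2 * (a * v * G') powr (q - 2) * G)"
        unfolding real(2) by (rule ennreal_mult''[OF real(1), symmetric])
      also have "\<dots> \<le> ennreal (Y powr q)"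
      proof (cases "G = 0")
        case False
        then have G: "G > 0" "G' = G" using real(1) by (auto simp: G'_def)
        show ?thesis unfolding Y_def ir G(2)
          using interpolation_constant_bound[OF q2 a(1) v(1) G(1)] by (intro ennreal_leI) (simp only: mult.assoc)
      qed simp
      finally show ?thesis .
    qed
    then have "Lp_norm (ennreal q) (mult_op m g) \<le> ennreal Y"
      using q Y by (intro Lp_norm_le) auto
    also have "\<dots> = ennreal ?c * ennreal (G powr (1 / r))"
      unfolding Y_def using c by (intro ennreal_mult) auto
    also have "ennreal (G powr (1 / r)) = Lp_norm (ennreal r) g"
      using Lp_norm_eq[OF r real(2,1)] by simp
    finally show ?thesis .
  qed
  then show ?thesis by (simp only: r_def)
qed

lemma mult_op_Linfinity:
  fixes m :: "real^'n::finite \<Rightarrow> real" and g :: "real^'n \<Rightarrow> complex"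
  assumes m: "integrable lborel m" and g: "integrable lborel g"
    and K: "\<And>x. norm (ft 1 (\<lambda>\<xi>. complex_of_real (m \<xi>)) x) \<le> K"
  shows "Lp_norm \<infinity> (mult_op m g) \<le> ennreal K * Lp_norm 1 g"
proof -
  have [measurable]: "m \<in> borel_measurable borel" "g \<in> borel_measurable borel"
    using borel_measurable_integrable[OF m] borel_measurable_integrable[OF g] by simp_all
  have fin: "(\<integral>\<^sup>+x. ennreal (norm (g x)) \<partial>lborel) < \<infinity>"
    using g by (simp add: integrable_iff_bounded)
  have "Lp_norm 1 g = (\<integral>\<^sup>+x. ennreal (norm (g x)) \<partial>lborel)"
    using fin by (simp add: Lp_norm_def Let_def)
  then show ?thesis
    using mult_op_sup[OF m g K] by (intro Lp_norm_infinity_le mult_op_borel) auto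
qed

theorem lemma3p6:
  fixes \<sigma> :: real
  shows "\<exists>C>0. \<forall>(\<theta>::real) (p::ennreal) (p'::ennreal).
    (CARD('n::finite) \<le> 2 \<longrightarrow> \<theta> \<in> {(2 - real CARD('n)) / 2 <.. 1}) \<longrightarrow>
    (CARD('n) \<ge> 3 \<longrightarrow> \<theta> \<in> {0..1}) \<longrightarrow>
    \<sigma> < 3 - real CARD('n) - 2 * \<theta> \<longrightarrow>
    2 \<le> p \<longrightarrow> 1 / p + 1 / p' = 1 \<longrightarrow>
    (\<forall>g \<in> (schwartz :: (real^'n \<Rightarrow> complex) set). \<forall>t>0.
       bessel_norm \<sigma> p (distr_of_fun (Lambda \<theta> t g))
         \<le> ennreal (C * t powr (1 - \<theta> - real CARD('n) / 2 * (1 - enn2real (2 / p)))) * Lp_norm p' g)"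
proof -
  let ?n = "real CARD('n)"
  obtain C\<^sub>0 where C0: "C\<^sub>0 > 0" and kernel: "\<And>\<theta> t. 0 \<le> \<theta> \<Longrightarrow> \<theta> \<le> 1 \<Longrightarrow> 1 \<le> \<theta> + ?n / 2 \<Longrightarrow> \<sigma> < 3 - ?n - 2 * \<theta> \<Longrightarrow> t > 0 \<Longrightarrow>
    integrable lborel (M_symbol \<sigma> \<theta> t :: real^'n \<Rightarrow> real) \<and>
    (\<forall>x :: real^'n. \<bar>LINT \<xi>|lborel. M_symbol \<sigma> \<theta> t \<xi> * cos (x \<bullet> \<xi>)\<bar> \<le> C\<^sub>0 * t powr (1 - \<theta> - ?n / 2))"
    using M_symbol_kernel[where 'n='n and \<sigma>=\<sigma>] by blast
  \<comment> \<open>One constant for both endpoints: 2 from the symbol bound,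
    \<open>C\<^sub>0\<close> from the kernel. It then enters the interpolated bound linearly,
    whatever p is.\<close>
  define C\<^sub>1 where "C\<^sub>1 = max 2 C\<^sub>0"
  have C1: "C\<^sub>1 \<ge> 2" "C\<^sub>1 \<ge> C\<^sub>0" by (auto simp: C\<^sub>1_def)
  have main: "bessel_norm \<sigma> p (distr_of_fun (Lambda \<theta> t g))
         \<le> ennreal (exp 2 * C\<^sub>1 * t powr (1 - \<theta> - ?n / 2 * (1 - enn2real (2 / p)))) * Lp_norm p' g"
    if th: "CARD('n) \<le> 2 \<longrightarrow> \<theta> \<in> {(2 - ?n) / 2 <.. 1}" "CARD('n) \<ge> 3 \<longrightarrow> \<theta> \<in> {0..1}"
      and \<sigma>: "\<sigma> < 3 - ?n - 2 * \<theta>" and p: "2 \<le> p" "1 / p + 1 / p' = 1" and g: "g \<in> schwartz" and t: "t > 0"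
    for \<theta> t :: real and p p' :: ennreal and g :: "real^'n \<Rightarrow> complex"
  proof -
    have n1: "?n \<ge> 1" by (simp add: Suc_leI)
    have \<theta>: "0 \<le> \<theta>" "\<theta> \<le> 1" "1 \<le> \<theta> + ?n / 2"
    proof -
      \<comment> \<open>For n <= 2 the lower limit (2 - n)/2 is itself nonnegative and is equivalent
        to 1 <= theta + n/2; for n >= 3 the latter follows from theta >= 0.\<close>
      have "0 \<le> \<theta> \<and> \<theta> \<le> 1 \<and> 1 \<le> \<theta> + ?n / 2"
      proof (cases "CARD('n) \<le> 2")
        case True
        then have "\<theta> > (2 - ?n) / 2" "\<theta> \<le> 1" "?n \<le> 2" using th(1) by auto
        then show ?thesis by (simp add: field_simps)
      next
        case False
        then have "0 \<le> \<theta>" "\<theta> \<le> 1" "?n \<ge> 3" using th(2) by auto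
        then show ?thesis by simp
      qed
      then show "0 \<le> \<theta>" "\<theta> \<le> 1" "1 \<le> \<theta> + ?n / 2" by auto
    qed
    have \<sigma>2: "\<sigma> \<le> 2" "\<sigma> + \<theta> \<le> 2" using \<sigma> \<theta> n1 by linarith+
    let ?m = "M_symbol \<sigma> \<theta> t :: real^'n \<Rightarrow> real"
    have m: "integrable lborel ?m" using kernel[OF \<theta> \<sigma> t] by blast
    have gi: "integrable lborel g" using g by (rule schwartz_integrable)
    define a where "a = C\<^sub>1 * t powr (1 - \<theta>)"
    \<comment> \<open>The ratio of the kernel bound to the L^2 bound; v^(1-2/q) yields the factor
      t^(-(n/2)(1-2/q)).\<close>
    define v where "v = t powr (- (?n / 2))"
    have av0: "a > 0" "v > 0" using C1 t by (auto simp: a_def v_def)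
    have a: "\<bar>?m \<xi>\<bar> \<le> a" for \<xi>
    proof -
      have "\<bar>?m \<xi>\<bar> \<le> 2 * t powr (1 - \<theta>)" by (rule M_symbol_bound[OF \<theta>(1,2) \<sigma>2(2) t])
      also have "\<dots> \<le> a" unfolding a_def using C1 by (intro mult_right_mono) auto
      finally show ?thesis .
    qed
    have av: "a * v = C\<^sub>1 * t powr (1 - \<theta> - ?n / 2)"
      by (simp add: a_def v_def mult.assoc powr_add[symmetric])
    have v: "norm (ft 1 (\<lambda>\<xi>. complex_of_real (?m \<xi>)) x) \<le> a * v" for x
    proof -
      have "norm (ft 1 (\<lambda>\<xi>. complex_of_real (?m \<xi>)) x) = \<bar>LINT \<xi>|lborel. ?m \<xi> * cos (x \<bullet> \<xi>)\<bar>"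
        unfolding ft_even[OF m M_symbol_minus] by (rule norm_of_real)
      also have "\<dots> \<le> C\<^sub>0 * t powr (1 - \<theta> - ?n / 2)" using kernel[OF \<theta> \<sigma> t] by blast
      also have "\<dots> \<le> a * v" unfolding av using C1 by (intro mult_right_mono) auto
      finally show ?thesis .
    qed
    let ?c = "ennreal (exp 2 * C\<^sub>1 * t powr (1 - \<theta> - ?n / 2 * (1 - enn2real (2 / p))))"
    have "Lp_norm p (mult_op ?m g) \<le> ?c * Lp_norm p' g"
    proof (cases "p = \<infinity>")
      case True
      \<comment> \<open>As 1/\<infinity> = 0, the relation reads 1/p' = 1; the values p' = 0 and p'
        = \<infinity> are excluded because their reciprocals are \<infinity> and 0.\<close>
      then have p': "p' = 1" 
    proof (cases p')
      case (real r)
      then show ?thesis using p(2) True by (cases "r = 0") (auto simp: divide_ennreal_def inverse_ennreal)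
    next
      case top
      then show ?thesis using p(2) True by simp
    qed
      have "Lp_norm p (mult_op ?m g) \<le> ennreal (a * v) * Lp_norm p' g"
        unfolding True p' by (rule mult_op_Linfinity[OF m gi v])
      also have "\<dots> \<le> ?c * Lp_norm p' g"
      proof (intro mult_right_mono ennreal_leI)
        have "1 * (a * v) \<le> exp 2 * (a * v)" using av0 by (intro mult_right_mono) auto
        then show "a * v \<le> exp 2 * C\<^sub>1 * t powr (1 - \<theta> - ?n / 2 * (1 - enn2real (2 / p)))"
          unfolding av True by (simp add: mult.assoc)
      qed simp
      finally show ?thesis .
    next
      case False
      obtain q where q: "q \<ge> 2" "p = ennreal q" "p' = ennreal (q / (q - 1))"
        using conjugate_exponent[OF p(1) False p(2)] by blast
      have "2 / p = ennreal (2 / q)"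
        using q divide_ennreal[of 2 q] by simp
      then have e: "enn2real (2 / p) = 2 / q" using q by simp
      have "exp 2 * (a * v powr (1 - 2 / q)) = exp 2 * C\<^sub>1 * t powr (1 - \<theta> - ?n / 2 * (1 - enn2real (2 / p)))"
        unfolding e by (simp add: a_def v_def powr_powr mult.assoc powr_add[symmetric])
      then show ?thesis
        using mult_op_Lp[OF m gi av0(1) a av0(2) v q(1)] unfolding q(2,3) by (simp only:)
    qed
    then show ?thesis
      using bessel_op_distr_Lambda[OF \<theta>(1,2) \<sigma>2(1) less_imp_le[OF t] g _ m]
      by (intro bessel_norm_le[of "mult_op ?m g"] mult_op_borel schwartz_borel g M_symbol_borel)
  qed
  have "exp 2 * C\<^sub>1 > 0" using C1 by simp
  with main show ?thesis by blast
qed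

end
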